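(* Let $\alpha>0$, $2\alpha+3\beta\ge0$, $1<\gamma\le\frac32$ and $\delta\in[\gamma-1,1)$. Assume that $m(0)>0$ and $|\mathbb{P}(0)|>0$. Then for the Cauchy problem (CP) there is no global regular solution $(\rho,u)$ satisfying the decay $$\limsup_{t\to+\infty}\|u(t,\cdot)\|_{L^\infty(\mathbb{R}^3)}=0.$$
   Context: All function spaces are over $\mathbb{R}^3$. $H^s$, $L^p$ are the usual spaces; $D^{k,r}=\{f\in L^1_{loc}(\mathbb{R}^3):|f|_{D^{k,r}}=|\nabla^k f|_{L^r}<\infty\}$; $D^k=D^{k,2}$ for $k\ge2$; $D^1=\{f\in L^6(\mathbb{R}^3):|f|_{D^1}=|\nabla f|_{L^2}<\infty\}$. $X([0,T];Y)$ means $X([0,T];Y(\mathbb{R}^3))$. The Cauchy problem (CP): for the density $\rho\ge0$ and the velocity $u\in\mathbb{R}^3$, $$\rho_t+\mathrm{div}(\rho u)=0,\qquad (\rho u)_t+\mathrm{div}(\rho u\otimes u)+\nabla P=\mathrm{div}\,\mathbb{T},$$ with $P=A\rho^\gamma$, $A>0$ constant, $\mathbb{T}=\alpha\rho^\delta(\nabla u+(\nabla u)^\top)+\beta\rho^\delta\,\mathrm{div}u\,\mathbb{I}_3$ ($\alpha,\beta$ constants, $\mathbb{I}_3$ the $3\times3$ identity), with initial data $(\rho,u)|_{t=0}=(\rho_0(x)\ge0,u_0(x))$ for $x\in\mathbb{R}^3$, and far field behavior $(\rho,u)(t,x)\to(0,0)$ as $|x|\to\infty$ for $t\ge0$. $m(t)=\int_{\mathbb{R}^3}\rho(t,x)\,dx$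 is the total mass and $\mathbb{P}(t)=\int_{\mathbb{R}^3}\rho(t,x)u(t,x)\,dx$ the momentum. Regular solution: for finite $T>0$, a solution $(\rho,u)$ to (CP) is called a regular solution in $[0,T]\times\mathbb{R}^3$ if it satisfies (CP) in the sense of distributions and: (A) $\rho>0$, $\rho^{\gamma-1}\in C([0,T];H^3)$, $\nabla\rho^{\delta-1}\in L^\infty([0,T];L^\infty\cap D^2)$; (B) $u\in C([0,T];H^3)\cap L^2([0,T];H^4)$, $u_t\in C([0,T];H^1)\cap L^2([0,T];D^2)$, $\rho^{\frac{\delta-1}{2}}\nabla u\in C([0,T];L^2)$, $\rho^{\frac{\delta-1}{2}}\nabla u_t\in L^\infty([0,T];L^2)$, $\rho^{\delta-1}\nabla u\in L^\infty([0,T];D^1)$, $\rho^{\delta-1}\nabla^2u\in C([0,T];H^1)\cap L^2([0,T];D^2)$. A global regular solution is one defined for all $t\ge0$ that is a regular solution in $[0,T]\times\mathbb{R}^3$ for every $T>0$. *)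

theory Defs
  imports "HOL-Analysis.Analysis" "HOL-Probability.Essential_Supremum"
begin

section \<open>Distributions and weak derivatives\<close>

primrec C_k :: "nat \<Rightarrow> ('n::euclidean_space \<Rightarrow> real) \<Rightarrow> bool" where
  "C_k 0 f \<longleftrightarrow> continuous_on UNIV f"
| "C_k (Suc k) f \<longleftrightarrow> f differentiable_on UNIV \<and>
     (\<forall>b\<in>Basis. C_k k (\<lambda>x. frechet_derivative f (at x) b))"

definition test_functions :: "'n::euclidean_space set \<Rightarrow> ('n \<Rightarrow> real) set" where
  "test_functions \<Omega> = {\<phi>. (\<forall>k. C_k k \<phi>) \<and>
     compact (closure {x. \<phi> x \<noteq> 0}) \<and> closure {x. \<phi> x \<noteq> 0} \<subseteq> \<Omega>}"

primrec partial_derivs :: "'n::euclidean_space list \<Rightarrow> ('n \<Rightarrow> real) \<Rightarrow> 'n \<Rightarrow> real" where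
  "partial_derivs [] \<phi> = \<phi>"
| "partial_derivs (b # bs) \<phi> = (\<lambda>x. frechet_derivative (partial_derivs bs \<phi>) (at x) b)"

definition locally_integrable :: "'n::euclidean_space set \<Rightarrow> ('n \<Rightarrow> 'a::euclidean_space) \<Rightarrow> bool" where
  "locally_integrable \<Omega> f \<longleftrightarrow> (\<forall>K. compact K \<and> K \<subseteq> \<Omega> \<longrightarrow> f absolutely_integrable_on K)"

definition weak_deriv ::
  "'n::euclidean_space set \<Rightarrow> 'n list \<Rightarrow> ('n \<Rightarrow> 'a::euclidean_space) \<Rightarrow> ('n \<Rightarrow> 'a) \<Rightarrow> bool" where
  "weak_deriv \<Omega> bs f g \<longleftrightarrow> locally_integrable \<Omega> f \<and> locally_integrable \<Omega> g \<and>
     (\<forall>\<phi>\<in>test_functions \<Omega>.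
        (LINT x|lebesgue. partial_derivs bs \<phi> x *\<^sub>R f x) =
        (-1) ^ length bs *\<^sub>R (LINT x|lebesgue. \<phi> x *\<^sub>R g x))"

text \<open>The \<open>j\<close>-th entry of the gradient is the partial derivative in direction \<open>j\<close>. Hence for a vector
  field \<open>u\<close> with gradient \<open>G\<close>, the entry \<open>G x $ j $ i\<close> is the \<open>j\<close>-th partial derivative of \<open>u\<^sub>i\<close>.\<close>
definition weak_gradient :: "(real^3 \<Rightarrow> 'a::euclidean_space) \<Rightarrow> (real^3 \<Rightarrow> 'a^3) \<Rightarrow> bool" where
  "weak_gradient f G \<longleftrightarrow> (\<forall>j. weak_deriv UNIV [axis j 1] f (\<lambda>x. G x $ j))"

text \<open>The distributional derivative in direction \<open>b\<close> of the locally integrable function \<open>f\<close>,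
  evaluated at the test function \<open>\<phi>\<close>.\<close>
definition dist_deriv :: "'n::euclidean_space \<Rightarrow> ('n \<Rightarrow> real) \<Rightarrow> ('n \<Rightarrow> real) \<Rightarrow> real" where
  "dist_deriv b f \<phi> = - (LINT x|lebesgue. f x * partial_derivs [b] \<phi> x)"


section \<open>Function spaces on \<open>\<real>\<^sup>3\<close>\<close>

text \<open>A space is represented by its extended (semi)norm, which takes the value \<open>\<infinity>\<close> exactly
  off the space.\<close>

definition Lp_norm :: "real \<Rightarrow> (real^3 \<Rightarrow> 'a::euclidean_space) \<Rightarrow> ennreal" where
  "Lp_norm p f =
     (if f \<in> borel_measurable lebesgue \<and> integrable lebesgue (\<lambda>x. norm (f x) powr p)
      then ennreal ((LINT x|lebesgue. norm (f x) powr p) powr (1 / p)) else \<infinity>)"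

text \<open>The auxiliary conjunct is needed since \<open>norm \<circ> f\<close> may be measurable when \<open>f\<close> is not.\<close>
definition Linfty_norm :: "(real^3 \<Rightarrow> 'a::euclidean_space) \<Rightarrow> ennreal" where
  "Linfty_norm f = (if f \<in> borel_measurable lebesgue
     then esssup lebesgue (\<lambda>x. ennreal (norm (f x))) else \<infinity>)"

definition directions :: "nat \<Rightarrow> (real^3) list set" where
  "directions k = {bs. length bs = k \<and> set bs \<subseteq> Basis}"

text \<open>The seminorm of \<open>D\<^sup>k\<^sup>,\<^sup>r\<close>, i.e. the \<open>L\<^sup>r\<close> norm of the pointwise Euclidean norm of the tensor of
  all weak derivatives of order \<open>k\<close>. Weak derivatives are unique up to null sets, so the infimum is
  over a single value, or over the empty set (giving \<open>\<infinity>\<close>) if some weak derivative does not exist.\<close>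
definition D_norm :: "nat \<Rightarrow> real \<Rightarrow> (real^3 \<Rightarrow> 'a::euclidean_space) \<Rightarrow> ennreal" where
  "D_norm k r f =
     (INF G\<in>{G. \<forall>bs\<in>directions k. weak_deriv UNIV bs f (G bs)}.
        Lp_norm r (\<lambda>x. L2_set (\<lambda>bs. norm (G bs x)) (directions k)))"

text \<open>\<open>D\<^sup>1\<close> consists of \<open>L\<^sup>6\<close> functions, whereas \<open>D\<^sup>k = D\<^sup>k\<^sup>,\<^sup>2\<close> for \<open>k \<ge> 2\<close>.\<close>
definition D1_norm :: "(real^3 \<Rightarrow> 'a::euclidean_space) \<Rightarrow> ennreal" where
  "D1_norm f = (if Lp_norm 6 f < \<infinity> then D_norm 1 2 f else \<infinity>)"

definition D2_norm :: "(real^3 \<Rightarrow> 'a::euclidean_space) \<Rightarrow> ennreal" where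
  "D2_norm f = D_norm 2 2 f"

definition H_norm :: "nat \<Rightarrow> (real^3 \<Rightarrow> 'a::euclidean_space) \<Rightarrow> ennreal" where
  "H_norm s f = (\<Sum>k\<le>s. D_norm k 2 f)"


section \<open>Spaces of functions of time with values in a function space\<close>

text \<open>\<open>N\<close> is the extended norm of the space \<open>Y\<close>. The three predicates express membership of \<open>f\<close> in
  \<open>C([0,T];Y)\<close>, \<open>L\<^sup>2([0,T];Y)\<close> and \<open>L\<^sup>\<infinity>([0,T];Y)\<close>. For the last two, measurability in time is joint
  measurability in \<open>(t, x)\<close>; strong measurability would be too restrictive
  for the nonseparable \<open>Y = L\<^sup>\<infinity>\<close>.\<close>

definition C_time ::
  "real \<Rightarrow> ((real^3 \<Rightarrow> 'a::euclidean_space) \<Rightarrow> ennreal) \<Rightarrow> (real \<Rightarrow> real^3 \<Rightarrow> 'a) \<Rightarrow> bool" where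
  "C_time T N f \<longleftrightarrow> (\<forall>t\<in>{0..T}. N (f t) < \<infinity>) \<and>
     (\<forall>s\<in>{0..T}. ((\<lambda>t. N (\<lambda>x. f t x - f s x)) \<longlongrightarrow> 0) (at s within {0..T}))"

definition jointly_measurable :: "real \<Rightarrow> (real \<Rightarrow> real^3 \<Rightarrow> 'a::euclidean_space) \<Rightarrow> bool" where
  "jointly_measurable T f \<longleftrightarrow> (\<lambda>(t, x). f t x) \<in> borel_measurable (lebesgue_on ({0..T} \<times> UNIV))"

definition L2_time ::
  "real \<Rightarrow> ((real^3 \<Rightarrow> 'a::euclidean_space) \<Rightarrow> ennreal) \<Rightarrow> (real \<Rightarrow> real^3 \<Rightarrow> 'a) \<Rightarrow> bool" where
  "L2_time T N f \<longleftrightarrow> jointly_measurable T f \<and>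
     (\<lambda>t. N (f t)) \<in> borel_measurable (lebesgue_on {0..T}) \<and>
     (\<integral>\<^sup>+ t. N (f t) ^ 2 \<partial>lebesgue_on {0..T}) < \<infinity>"

text \<open>The essential supremum of a non-measurable function is \<open>\<infinity>\<close> by convention.\<close>
definition Linfty_time ::
  "real \<Rightarrow> ((real^3 \<Rightarrow> 'a::euclidean_space) \<Rightarrow> ennreal) \<Rightarrow> (real \<Rightarrow> real^3 \<Rightarrow> 'a) \<Rightarrow> bool" where
  "Linfty_time T N f \<longleftrightarrow> jointly_measurable T f \<and>
     esssup (lebesgue_on {0..T}) (\<lambda>t. N (f t)) < \<infinity>"


section \<open>The Cauchy problem and its regular solutions\<close>

definition viscous_stress :: "real \<Rightarrow> real \<Rightarrow> real \<Rightarrow> real \<Rightarrow> real^3^3 \<Rightarrow> real^3^3" where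
  "viscous_stress \<alpha> \<beta> \<delta> r M =
     (\<alpha> * r powr \<delta>) *\<^sub>R (M + transpose M) + (\<beta> * r powr \<delta> * trace M) *\<^sub>R mat 1"

abbreviation slab :: "real \<Rightarrow> (real \<times> (real^3)) set" where
  "slab T \<equiv> {0<..<T} \<times> UNIV"

abbreviation time_dir :: "real \<times> (real^3)" where
  "time_dir \<equiv> (1, 0)"

abbreviation space_dir :: "3 \<Rightarrow> real \<times> (real^3)" where
  "space_dir j \<equiv> (0, axis j 1)"

definition mass_equation ::
  "real \<Rightarrow> (real \<Rightarrow> real^3 \<Rightarrow> real) \<Rightarrow> (real \<Rightarrow> real^3 \<Rightarrow> real^3) \<Rightarrow> bool" where
  "mass_equation T \<rho> u \<longleftrightarrow>
     locally_integrable (slab T) (\<lambda>(t, x). \<rho> t x) \<and>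
     locally_integrable (slab T) (\<lambda>(t, x). \<rho> t x *\<^sub>R u t x) \<and>
     (\<forall>\<phi>\<in>test_functions (slab T).
        dist_deriv time_dir (\<lambda>(t, x). \<rho> t x) \<phi> +
        (\<Sum>j\<in>UNIV. dist_deriv (space_dir j) (\<lambda>(t, x). \<rho> t x * u t x $ j) \<phi>) = 0)"

text \<open>\<open>Du\<close> stands for the spatial gradient of \<open>u\<close>.\<close>
definition momentum_equation ::
  "real \<Rightarrow> real \<Rightarrow> real \<Rightarrow> real \<Rightarrow> real \<Rightarrow> real \<Rightarrow>
   (real \<Rightarrow> real^3 \<Rightarrow> real) \<Rightarrow> (real \<Rightarrow> real^3 \<Rightarrow> real^3) \<Rightarrow> (real \<Rightarrow> real^3 \<Rightarrow> real^3^3) \<Rightarrow> bool" where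
  "momentum_equation A \<alpha> \<beta> \<gamma> \<delta> T \<rho> u Du \<longleftrightarrow>
     locally_integrable (slab T) (\<lambda>(t, x). \<rho> t x *\<^sub>R u t x) \<and>
     (\<forall>i j. locally_integrable (slab T) (\<lambda>(t, x). \<rho> t x * u t x $ i * u t x $ j)) \<and>
     locally_integrable (slab T) (\<lambda>(t, x). A * \<rho> t x powr \<gamma>) \<and>
     locally_integrable (slab T) (\<lambda>(t, x). viscous_stress \<alpha> \<beta> \<delta> (\<rho> t x) (Du t x)) \<and>
     (\<forall>\<phi>\<in>test_functions (slab T). \<forall>i.
        dist_deriv time_dir (\<lambda>(t, x). \<rho> t x * u t x $ i) \<phi> +
        (\<Sum>j\<in>UNIV. dist_deriv (space_dir j) (\<lambda>(t, x). \<rho> t x * u t x $ i * u t x $ j) \<phi>) +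
        dist_deriv (space_dir i) (\<lambda>(t, x). A * \<rho> t x powr \<gamma>) \<phi> =
        (\<Sum>j\<in>UNIV. dist_deriv (space_dir j)
           (\<lambda>(t, x). viscous_stress \<alpha> \<beta> \<delta> (\<rho> t x) (Du t x) $ i $ j) \<phi>))"

definition solves_CP ::
  "real \<Rightarrow> real \<Rightarrow> real \<Rightarrow> real \<Rightarrow> real \<Rightarrow> (real^3 \<Rightarrow> real) \<Rightarrow> (real^3 \<Rightarrow> real^3) \<Rightarrow> real \<Rightarrow>
   (real \<Rightarrow> real^3 \<Rightarrow> real) \<Rightarrow> (real \<Rightarrow> real^3 \<Rightarrow> real^3) \<Rightarrow> (real \<Rightarrow> real^3 \<Rightarrow> real^3^3) \<Rightarrow> bool" where
  "solves_CP A \<alpha> \<beta> \<gamma> \<delta> \<rho>0 u0 T \<rho> u Du \<longleftrightarrow>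
     mass_equation T \<rho> u \<and>
     momentum_equation A \<alpha> \<beta> \<gamma> \<delta> T \<rho> u Du \<and>
     (\<forall>x. \<rho> 0 x = \<rho>0 x \<and> u 0 x = u0 x) \<and>
     (\<forall>t\<in>{0..T}. ((\<lambda>x. (\<rho> t x, u t x)) \<longlongrightarrow> (0, 0)) at_infinity)"

text \<open>The derivatives of \<open>\<rho>\<close> and \<open>u\<close> are unique up to null sets; they are bound existentially so that
  representatives measurable in \<open>(t, x)\<close> can be chosen: \<open>D\<rho>\<close> is the gradient of \<open>\<rho> powr (\<delta> - 1)\<close>,
  \<open>Du\<close> and \<open>D2u\<close> are the first and second order spatial derivatives of \<open>u\<close>, \<open>ut\<close> is its
  time derivative and \<open>Dut\<close> the spatial gradient of \<open>ut\<close>.\<close>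
definition regular_solution ::
  "real \<Rightarrow> real \<Rightarrow> real \<Rightarrow> real \<Rightarrow> real \<Rightarrow> (real^3 \<Rightarrow> real) \<Rightarrow> (real^3 \<Rightarrow> real^3) \<Rightarrow> real \<Rightarrow>
   (real \<Rightarrow> real^3 \<Rightarrow> real) \<Rightarrow> (real \<Rightarrow> real^3 \<Rightarrow> real^3) \<Rightarrow> bool" where
  "regular_solution A \<alpha> \<beta> \<gamma> \<delta> \<rho>0 u0 T \<rho> u \<longleftrightarrow>
     (\<exists>D\<rho> Du D2u ut Dut.
        solves_CP A \<alpha> \<beta> \<gamma> \<delta> \<rho>0 u0 T \<rho> u Du \<and>
        (AE t in lebesgue_on {0..T}. weak_gradient (\<lambda>x. \<rho> t x powr (\<delta> - 1)) (D\<rho> t)) \<and>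
        (\<forall>t\<in>{0..T}. weak_gradient (u t) (Du t)) \<and>
        (\<forall>t\<in>{0..T}. weak_gradient (Du t) (D2u t)) \<and>
        weak_deriv (slab T) [time_dir] (\<lambda>(t, x). u t x) (\<lambda>(t, x). ut t x) \<and>
        (\<forall>t\<in>{0..T}. weak_gradient (ut t) (Dut t)) \<and>
        (\<forall>t\<in>{0..T}. \<forall>x. \<rho> t x > 0) \<and>
        C_time T (H_norm 3) (\<lambda>t x. \<rho> t x powr (\<gamma> - 1)) \<and>
        Linfty_time T (\<lambda>f. Linfty_norm f + D2_norm f) D\<rho> \<and>
        C_time T (H_norm 3) u \<and>
        L2_time T (H_norm 4) u \<and>
        C_time T (H_norm 1) ut \<and>
        L2_time T D2_norm ut \<and>
        C_time T (Lp_norm 2) (\<lambda>t x. \<rho> t x powr ((\<delta> - 1) / 2) *\<^sub>R Du t x) \<and>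
        Linfty_time T (Lp_norm 2) (\<lambda>t x. \<rho> t x powr ((\<delta> - 1) / 2) *\<^sub>R Dut t x) \<and>
        Linfty_time T D1_norm (\<lambda>t x. \<rho> t x powr (\<delta> - 1) *\<^sub>R Du t x) \<and>
        C_time T (H_norm 1) (\<lambda>t x. \<rho> t x powr (\<delta> - 1) *\<^sub>R D2u t x) \<and>
        L2_time T D2_norm (\<lambda>t x. \<rho> t x powr (\<delta> - 1) *\<^sub>R D2u t x))"

definition global_regular_solution ::
  "real \<Rightarrow> real \<Rightarrow> real \<Rightarrow> real \<Rightarrow> real \<Rightarrow> (real^3 \<Rightarrow> real) \<Rightarrow> (real^3 \<Rightarrow> real^3) \<Rightarrow>
   (real \<Rightarrow> real^3 \<Rightarrow> real) \<Rightarrow> (real \<Rightarrow> real^3 \<Rightarrow> real^3) \<Rightarrow> bool" where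
  "global_regular_solution A \<alpha> \<beta> \<gamma> \<delta> \<rho>0 u0 \<rho> u \<longleftrightarrow>
     (\<forall>T>0. regular_solution A \<alpha> \<beta> \<gamma> \<delta> \<rho>0 u0 T \<rho> u)"

text \<open>At time \<open>t\<close> the total mass is \<open>total_mass (\<rho> t)\<close> and the momentum is
  \<open>total_momentum (\<rho> t) (u t)\<close>. Densities are nonnegative, so the mass is defined in
  \<open>[0, \<infinity>]\<close> without an integrability assumption.\<close>
definition total_mass :: "(real^3 \<Rightarrow> real) \<Rightarrow> ennreal" where
  "total_mass r = (\<integral>\<^sup>+ x. ennreal (r x) \<partial>lebesgue)"

definition total_momentum :: "(real^3 \<Rightarrow> real) \<Rightarrow> (real^3 \<Rightarrow> real^3) \<Rightarrow> real^3" where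
  "total_momentum r v = (LINT x|lebesgue. r x *\<^sub>R v x)"

end

theory Submission
  imports Defs
begin

text \<open>Mass and momentum are conserved, so \<open>|P(0)| = |P(t)| \<le> m(0) |u(t)|\<^sub>L\<^sub>\<infinity>\<close>, and the right-hand side
  tends to 0. The work lies in the conservation laws. The function \<open>a = \<rho> powr (\<gamma> - 1)\<close> lies in \<open>H\<^sup>3\<close>,
  hence is bounded, uniformly on compact time intervals; the sup bound needs only the mixed
  derivatives of order at most 3, in which the one-dimensional fundamental theorem of calculus is applied in each
  variable. As \<open>\<gamma> \<le> 3 / 2\<close>, \<open>\<rho>\<close> is a power of \<open>a\<close> with exponent at least 2, so that \<open>\<rho>\<close>, \<open>\<rho>u\<close>
  and all fluxes are integrable in space. The equations are then tested with \<open>\<theta>(t)\<close>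
  times a spatial cutoff; as the cutoff exhausts the space, the fluxes drop out, and mass and
  momentum are weakly constant in time. They are continuous up to \<open>t = 0\<close> because \<open>a\<close> and \<open>u\<close> are
  continuous with values in \<open>L\<^sup>2\<close>.\<close>

section \<open>Smooth functions\<close>

text \<open>The bounds on a time interval may grow with its length, but conservation is exact, so
  none of them enters the final estimate and one late time suffices. Besides \<open>u\<close>, two
  functions are in L^2: \<open>a\<close> and the weighted gradient
  \<open>\<rho> powr ((\<delta> - 1) / 2) *\<^sub>R Du\<close>. Since \<rho> is at most a multiple
  of \<open>a\<^sup>2\<close>, Young's inequality bounds the momentum by the squares of
  \<open>a\<close> and \<open>u\<close>, and the stress by the squares of \<open>a\<close> and the
  weighted gradient; convection is a bounded density times a square of \<open>u\<close>, and
  pressure is \<rho> times the bounded \<open>a\<close>. The obstacle is the sup bound on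
  \<open>a\<close>: the seminorms supply a separate family of weak derivatives for every order, with
  no stated relation between the orders. The bound is therefore obtained by duality, from averages
  over small cubes and Lebesgue differentiation. Integrability of the fluxes over the whole space is
  what allows cutoffs whose gradients stay of size 1 while their supports escape to
  infinity.\<close>

lemma C_k_SucI:
  assumes "\<And>x. (f has_derivative D x) (at x)" and "\<And>b. b \<in> Basis \<Longrightarrow> C_k k (\<lambda>x. D x b)"
  shows "C_k (Suc k) f"
proof -
  have "frechet_derivative f (at x) = D x" for x
    using assms(1) frechet_derivative_at by metis
  then show ?thesis
    using assms by (auto simp: differentiable_on_def differentiable_def)
qed

text \<open>Together with \<open>C_k_SucI\<close> this hides the choice made by
  \<open>frechet_derivative\<close>: derivatives are unique, so inductions on \<open>k\<close> can
  run on the calculus rules for \<open>has_derivative\<close>.\<close>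

lemma C_k_SucD:
  assumes "C_k (Suc k) f"
  shows "\<exists>D. (\<forall>x. (f has_derivative D x) (at x)) \<and> (\<forall>b\<in>Basis. C_k k (\<lambda>x. D x b))"
  using assms by (intro exI[of _ "\<lambda>x. frechet_derivative f (at x)"])
    (auto simp: differentiable_on_def frechet_derivative_works[symmetric])

lemma C_k_Suc_imp: "C_k (Suc k) f \<Longrightarrow> C_k k f"
proof (induction k arbitrary: f)
  case 0
  then show ?case by (simp add: differentiable_imp_continuous_on)
next
  case (Suc k)
  obtain D where D: "\<And>x. (f has_derivative D x) (at x)"
      "\<And>b. b \<in> Basis \<Longrightarrow> C_k (Suc k) (\<lambda>x. D x b)"
    using C_k_SucD[OF Suc.prems] by blast
  show ?case
    by (rule C_k_SucI[OF D(1)]) (use D(2) Suc.IH in blast)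
qed

lemma C_k_add: "C_k k f \<Longrightarrow> C_k k g \<Longrightarrow> C_k k (\<lambda>x. f x + g x)"
proof (induction k arbitrary: f g)
  case 0
  then show ?case by (simp add: continuous_on_add)
next
  case (Suc k)
  obtain D where D: "\<And>x. (f has_derivative D x) (at x)" "\<And>b. b \<in> Basis \<Longrightarrow> C_k k (\<lambda>x. D x b)"
    using C_k_SucD[OF Suc.prems(1)] by blast
  obtain E where E: "\<And>x. (g has_derivative E x) (at x)" "\<And>b. b \<in> Basis \<Longrightarrow> C_k k (\<lambda>x. E x b)"
    using C_k_SucD[OF Suc.prems(2)] by blast
  show ?case
    by (rule C_k_SucI[OF has_derivative_add[OF D(1) E(1)]]) (use D(2) E(2) Suc.IH in blast)
qed

lemma C_k_const: "C_k k (\<lambda>x. c)"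
proof (induction k arbitrary: c)
  case (Suc k)
  show ?case by (rule C_k_SucI[OF has_derivative_const]) (use Suc in blast)
qed simp

lemma C_k_mult: "C_k k f \<Longrightarrow> C_k k g \<Longrightarrow> C_k k (\<lambda>x. f x * g x)"
proof (induction k arbitrary: f g)
  case 0
  then show ?case by (simp add: continuous_on_mult)
next
  case (Suc k)
  obtain D where D: "\<And>x. (f has_derivative D x) (at x)" "\<And>b. b \<in> Basis \<Longrightarrow> C_k k (\<lambda>x. D x b)"
    using C_k_SucD[OF Suc.prems(1)] by blast
  obtain E where E: "\<And>x. (g has_derivative E x) (at x)" "\<And>b. b \<in> Basis \<Longrightarrow> C_k k (\<lambda>x. E x b)"
    using C_k_SucD[OF Suc.prems(2)] by blast
  \<comment> \<open>The derivative of a product contains each factor undifferentiated, so the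
    induction hypothesis needs \<open>f\<close> and \<open>g\<close> themselves one order
    lower.\<close>
  have "C_k k f" "C_k k g"
    using Suc.prems by (auto intro: C_k_Suc_imp)
  then show ?case
    by (intro C_k_SucI[OF has_derivative_mult[OF D(1) E(1)]] C_k_add Suc.IH D(2) E(2))
qed

text \<open>The derivative along \<open>h\<close> is a constant times another function of
  \<open>x \<bullet> b\<close>, because a linear map on the reals is multiplication by its value at
  1. The induction over all \<open>g\<close> closes for this reason.\<close>

lemma C_k_inner_comp:
  fixes g :: "real \<Rightarrow> real" and b :: "'n::euclidean_space"
  shows "C_k k g \<Longrightarrow> C_k k (\<lambda>x. g (x \<bullet> b))"
proof (induction k arbitrary: g)
  case 0
  then have "continuous_on UNIV g" by simp
  then show ?case
    by (auto intro!: continuous_on_compose2[of UNIV g] continuous_intros)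
next
  case (Suc k)
  obtain D where D: "\<And>x. (g has_derivative D x) (at x)" "\<And>b. b \<in> Basis \<Longrightarrow> C_k k (\<lambda>x. D x b)"
    using C_k_SucD[OF Suc.prems] by blast
  have D1: "C_k k (\<lambda>x. D x 1)" using D(2)[of 1] by simp
  have lin: "D y h = h * D y 1" for y h
    using has_derivative_linear[OF D(1)[of y]] linear_cmul[of "D y" h 1] by simp
  have "((\<lambda>x. g (x \<bullet> b)) has_derivative (\<lambda>h. (h \<bullet> b) * D (x \<bullet> b) 1)) (at x)" for x
  proof -
    have "((\<lambda>x. x \<bullet> b) has_derivative (\<lambda>h. h \<bullet> b)) (at x)"
      by (auto intro!: derivative_eq_intros)
    from has_derivative_compose[OF this D(1)] show ?thesis
      by (simp add: lin[of "x \<bullet> b" "_ \<bullet> b"])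
  qed
  then show ?case
    by (rule C_k_SucI) (intro C_k_mult C_k_const Suc.IH[OF D1])
qed

definition smooth :: "('n::euclidean_space \<Rightarrow> real) \<Rightarrow> bool" where
  "smooth f \<longleftrightarrow> (\<forall>k. C_k k f)"

lemma smooth_const: "smooth (\<lambda>x. c)"
  and smooth_add: "smooth f \<Longrightarrow> smooth g \<Longrightarrow> smooth (\<lambda>x. f x + g x)"
  and smooth_mult: "smooth f \<Longrightarrow> smooth g \<Longrightarrow> smooth (\<lambda>x. f x * g x)"
  and smooth_inner_comp: "smooth h \<Longrightarrow> smooth (\<lambda>x. h (x \<bullet> b))"
  by (simp_all add: smooth_def C_k_const C_k_add C_k_mult C_k_inner_comp)

lemma smooth_diff: "smooth f \<Longrightarrow> smooth g \<Longrightarrow> smooth (\<lambda>x. f x - g x)"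
  using smooth_add[of f "\<lambda>x. (-1) * g x"] smooth_mult[OF smooth_const, of g "-1"] by simp

lemma smooth_prod: "(\<And>b. b \<in> S \<Longrightarrow> smooth (h b)) \<Longrightarrow> smooth (\<lambda>x. \<Prod>b\<in>S. h b x)"
  by (induction S rule: infinite_finite_induct) (auto intro: smooth_const smooth_mult)

lemma smooth_continuous: "smooth f \<Longrightarrow> continuous_on S f"
proof -
  assume "smooth f"
  then have "C_k 0 f" unfolding smooth_def by blast
  then show ?thesis by (auto intro: continuous_on_subset)
qed

section \<open>Smooth functions of one real variable, up to a smooth step\<close>

lemma smooth_real_deriv:
  fixes g :: "real \<Rightarrow> real"
  assumes "smooth g"
  shows "(g has_real_derivative deriv g x) (at x)" "smooth (deriv g)"
proof -
  have *: "(g has_real_derivative frechet_derivative g (at x) 1) (at x)" for x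
  proof -
    have "C_k (Suc 0) g" using assms unfolding smooth_def by blast
    then have d: "g differentiable (at x)" by (auto simp: differentiable_on_def)
    then have der: "(g has_derivative frechet_derivative g (at x)) (at x)"
      by (simp add: frechet_derivative_works)
    have "frechet_derivative g (at x) h = frechet_derivative g (at x) 1 * h" for h
      using linear_cmul[OF has_derivative_linear[OF der], of h 1] by (simp add: mult.commute)
    with der show ?thesis
      unfolding has_field_derivative_def by (metis (no_types, lifting) ext)
  qed
  then have eq: "deriv g = (\<lambda>x. frechet_derivative g (at x) 1)"
    using DERIV_imp_deriv by blast
  show "(g has_real_derivative deriv g x) (at x)" using * eq by simp
  have "C_k k (deriv g)" for k
  proof -
    have "C_k (Suc k) g" using assms unfolding smooth_def by blast
    then show ?thesis by (simp add: eq)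
  qed
  then show "smooth (deriv g)" by (simp add: smooth_def)
qed

lemma C_k_Suc_realI:
  fixes g :: "real \<Rightarrow> real"
  assumes "\<And>x. (g has_real_derivative g' x) (at x)" and "C_k k g'"
  shows "C_k (Suc k) g"
  by (rule C_k_SucI[where D = "\<lambda>x h. g' x * h"])
    (use assms in \<open>auto simp: has_field_derivative_def\<close>)

lemma smooth_realI:
  fixes g :: "real \<Rightarrow> real"
  assumes der: "\<And>x. (g has_real_derivative g' x) (at x)" and "smooth g'"
  shows "smooth g"
  unfolding smooth_def
proof
  fix k
  have "C_k (Suc k) g"
    using C_k_Suc_realI[OF der] \<open>smooth g'\<close> by (simp add: smooth_def del: C_k.simps)
  then show "C_k k g" by (rule C_k_Suc_imp)
qed

lemma smooth_antiderivative:
  fixes g :: "real \<Rightarrow> real"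
  assumes "smooth g"
  obtains G where "smooth G" "\<And>x. (G has_real_derivative g x) (at x)"
proof -
  have "isCont g x" for x
    using smooth_continuous[OF assms, of UNIV] by (simp add: continuous_on_eq_continuous_at)
  then obtain G where G: "\<And>x. (G has_real_derivative g x) (at x)"
    using einterval_antiderivative[of "-\<infinity>" "\<infinity>" g]
    by (auto simp: has_real_derivative_iff_has_vector_derivative)
  show ?thesis by (rule that[OF smooth_realI[OF G assms] G])
qed

lemma smooth_affine_comp:
  fixes g :: "real \<Rightarrow> real"
  assumes "smooth g"
  shows "smooth (\<lambda>x. g (c * x + d))"
proof -
  have "C_k k (\<lambda>x. h (c * x + d))" if "C_k k h" for k and h :: "real \<Rightarrow> real"
    using that
  proof (induction k arbitrary: h)
    case 0
    then show ?case
      by (auto intro!: continuous_on_compose2[of UNIV h] continuous_intros)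
  next
    case (Suc k)
    obtain D where D: "\<And>x. (h has_derivative D x) (at x)" "\<And>b. b \<in> Basis \<Longrightarrow> C_k k (\<lambda>x. D x b)"
      using C_k_SucD[OF Suc.prems] by blast
    have lin: "D y v = D y 1 * v" for y v
      using linear_cmul[OF has_derivative_linear[OF D(1)[of y]], of v 1] by simp
    have *: "(h has_real_derivative D x 1) (at x)" for x
      using D(1)[of x] lin[of x] unfolding has_field_derivative_def
      by (metis (no_types, lifting) ext)
    have "((\<lambda>x. h (c * x + d)) has_real_derivative D (c * x + d) 1 * c) (at x)" for x
      by (rule DERIV_chain2[OF *]) (auto intro!: derivative_eq_intros)
    moreover have "C_k k (\<lambda>x. D (c * x + d) 1 * c)"
      using Suc.IH[of "\<lambda>x. D x 1"] D(2)[of 1] by (intro C_k_mult C_k_const) simp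
    ultimately show ?case by (rule C_k_Suc_realI)
  qed
  then show ?thesis using assms by (simp add: smooth_def)
qed

text \<open>These functions form a family closed under differentiation: with \<open>E\<close> as
  below, \<open>E m\<close> has derivative \<open>E (m + 2) - m * E (m + 1)\<close>. One induction
  on the order, for all \<open>m\<close> at once, gives smoothness; the step function is built from
  \<open>m = 0\<close>.\<close>

lemma smooth_flat_exp: "smooth (\<lambda>x::real. if x \<le> 0 then 0 else exp (- 1 / x) / x ^ m)"
proof -
  define E :: "nat \<Rightarrow> real \<Rightarrow> real"
    where "E m x = (if x \<le> 0 then 0 else exp (- 1 / x) / x ^ m)" for m x
  have lim: "(E m \<longlongrightarrow> 0) (at 0)" for m
  proof -
    have "((\<lambda>x. exp (- 1 / x) / x ^ m) \<longlongrightarrow> 0) (at_right (0::real))"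
    proof -
      \<comment> \<open>Substituting \<open>y = 1 / x\<close> turns flatness at 0 into exponential
        decay at infinity.\<close>
      have "((\<lambda>y::real. y ^ m / exp y) \<longlongrightarrow> 0) at_top" by (rule tendsto_power_div_exp_0)
      from filterlim_compose[OF this filterlim_inverse_at_top_right]
      show ?thesis by (simp add: field_simps exp_minus)
    qed
    then have r: "(E m \<longlongrightarrow> 0) (at_right 0)"
      by (rule Lim_transform_eventually) (auto simp: E_def eventually_at_right_less eventually_at_filter)
    have l: "(E m \<longlongrightarrow> 0) (at_left 0)"
      by (rule Lim_transform_eventually[of "\<lambda>x. 0"]) (auto simp: E_def eventually_at_filter)
    show ?thesis using l r by (simp add: filterlim_split_at_real)
  qed
  have der: "(E m has_real_derivative (E (m + 2) x - m * E (m + 1) x)) (at x)" for m x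
  proof -
    consider "x < 0" | "x = 0" | "x > 0" by linarith
    then show ?thesis
    proof cases
      case 1
      have "((\<lambda>x. 0) has_real_derivative 0) (at x)" by simp
      then have "(E m has_real_derivative 0) (at x)"
        by (rule has_field_derivative_transform_within_open[of _ _ _ "{..<0}"])
           (use 1 in \<open>auto simp: E_def\<close>)
      then show ?thesis using 1 by (simp add: E_def)
    next
      case 2
      \<comment> \<open>For \<open>h \<noteq> 0\<close> the difference quotient at 0 is
        \<open>E (Suc m) h\<close>.\<close>
      have "((\<lambda>h. (E m (0 + h) - E m 0) / h) \<longlongrightarrow> 0) (at 0)"
        by (rule Lim_transform_eventually[OF lim[of "Suc m"]])
           (auto simp: E_def eventually_at_filter field_simps)
      then show ?thesis using 2 by (simp add: DERIV_def E_def)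
    next
      case 3
      have "((\<lambda>x. exp (- 1 / x) / x ^ m) has_real_derivative
              (exp (- 1 / x) / x ^ (m + 2) - m * (exp (- 1 / x) / x ^ (m + 1)))) (at x)"
      proof -
        have "((\<lambda>x. x ^ m) has_real_derivative real m * x ^ m / x) (at x)"
          using DERIV_pow[of m x] 3 by (cases m) auto
        moreover have "((\<lambda>x. exp (- 1 / x)) has_real_derivative exp (- 1 / x) / x\<^sup>2) (at x)"
          using 3 by (auto intro!: derivative_eq_intros simp: power2_eq_square)
        ultimately have "((\<lambda>x. exp (- 1 / x) / x ^ m) has_real_derivative
          (exp (- 1 / x) / x\<^sup>2 * x ^ m - exp (- 1 / x) * (real m * x ^ m / x)) / (x ^ m * x ^ m)) (at x)"
          using 3 by (intro DERIV_divide) auto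
        moreover have "(exp (- 1 / x) / x\<^sup>2 * x ^ m - exp (- 1 / x) * (real m * x ^ m / x)) / (x ^ m * x ^ m)
          = exp (- 1 / x) / x ^ (m + 2) - m * (exp (- 1 / x) / x ^ (m + 1))"
        proof -
          have "(y / x\<^sup>2 * z - y * (c * z / x)) / (z * z) = y / (z * x\<^sup>2) - c * (y / (z * x))"
            if "z > 0" for y z c
            using that 3 by (simp add: divide_simps) (simp add: algebra_simps power2_eq_square)
          moreover have "x ^ (m + 2) = x ^ m * x\<^sup>2" "x ^ (m + 1) = x ^ m * x" "x ^ m > 0"
            using 3 by (simp_all add: power_add power2_eq_square)
          ultimately show ?thesis by (simp only:)
        qed
        ultimately show ?thesis by (simp only:)
      qed
      then have "(E m has_real_derivative
              (exp (- 1 / x) / x ^ (m + 2) - m * (exp (- 1 / x) / x ^ (m + 1)))) (at x)"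
        by (rule has_field_derivative_transform_within_open[of _ _ _ "{0<..}"])
           (use 3 in \<open>auto simp: E_def\<close>)
      then show ?thesis using 3 by (simp add: E_def)
    qed
  qed
  have "C_k k (E m)" for k m
  proof (induction k arbitrary: m)
    case 0
    have "continuous_on UNIV (E m)"
      using der by (auto simp: continuous_on_eq_continuous_at intro: DERIV_isCont)
    then show ?case by simp
  next
    case (Suc k)
    have "C_k k (\<lambda>x. E (m + 2) x + (- real m) * E (m + 1) x)"
      by (intro C_k_add C_k_mult C_k_const Suc)
    then show ?case
      by (intro C_k_Suc_realI[OF der]) simp
  qed
  then have "smooth (E m)" by (simp add: smooth_def)
  then show ?thesis by (simp add: E_def[abs_def])
qed

text \<open>The step is the normalised primitive of \<open>e x * e (1 - x)\<close>. This product is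
  positive exactly on the open unit interval, so the primitive is constant on either side of
  it.\<close>

lemma smooth_step_exists:
  obtains s :: "real \<Rightarrow> real" where "smooth s" "\<And>x. x \<le> 0 \<Longrightarrow> s x = 0" "\<And>x. x \<ge> 1 \<Longrightarrow> s x = 1"
    "\<And>x. s x \<in> {0..1}"
proof -
  define e :: "real \<Rightarrow> real" where "e x = (if x \<le> 0 then 0 else exp (- 1 / x))" for x
  have e: "smooth e" using smooth_flat_exp[of 0] by (simp add: e_def[abs_def] cong: if_cong)
  define g where "g x = e x * e (1 - x)" for x
  have "smooth (\<lambda>x. e (1 - x))" using smooth_affine_comp[OF e, of "-1" 1] by simp
  then have "smooth g" unfolding g_def using e by (intro smooth_mult)
  then obtain G where G: "smooth G" "\<And>x. (G has_real_derivative g x) (at x)"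
    using smooth_antiderivative by blast
  have g0: "g x \<ge> 0" for x by (simp add: g_def e_def)
  have mono: "G x \<le> G y" if "x \<le> y" for x y
    by (rule DERIV_nonneg_imp_nondecreasing[OF that]) (use G g0 in blast)
  have lt: "G 0 < G 1"
  proof -
    have "G (1/4) < G (3/4)"
    proof (rule DERIV_pos_imp_increasing[of "1/4" "3/4" G])
      fix x :: real assume "1/4 \<le> x" "x \<le> 3/4"
      then have "0 < x" "x < 1" by simp_all
      then have "g x > 0" by (simp add: g_def e_def)
      then show "\<exists>y. DERIV G x :> y \<and> y > 0" using G(2) by blast
    qed auto
    then show ?thesis using mono[of 0 "1/4"] mono[of "3/4" 1] by simp
  qed
  have left: "G x = G 0" if "x \<le> 0" for x
  proof (rule antisym)
    show "G x \<le> G 0" by (rule mono[OF that])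
    show "G 0 \<le> G x"
      by (rule DERIV_nonpos_imp_nonincreasing[OF that]) (use G(2) in \<open>force simp: g_def e_def\<close>)
  qed
  have right: "G x = G 1" if "1 \<le> x" for x
  proof (rule antisym)
    show "G 1 \<le> G x" by (rule mono[OF that])
    show "G x \<le> G 1"
      by (rule DERIV_nonpos_imp_nonincreasing[OF that]) (use G(2) in \<open>force simp: g_def e_def\<close>)
  qed
  have bd: "G 0 \<le> G x \<and> G x \<le> G 1" for x
    using mono[of 0 x] mono[of x 1] left[of x] right[of x] lt by linarith
  show ?thesis
  proof (rule that[of "\<lambda>x. (G x - G 0) * (1 / (G 1 - G 0))"])
    show "smooth (\<lambda>x. (G x - G 0) * (1 / (G 1 - G 0)))"
      by (intro smooth_mult smooth_diff smooth_const G)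
    show "(G x - G 0) * (1 / (G 1 - G 0)) = 0" if "x \<le> 0" for x
      unfolding left[OF that] by simp
    show "(G x - G 0) * (1 / (G 1 - G 0)) = 1" if "x \<ge> 1" for x
      unfolding right[OF that] using lt by simp
    show "(G x - G 0) * (1 / (G 1 - G 0)) \<in> {0..1}" for x
      using bd[of x] lt by (simp add: divide_simps)
  qed
qed

section \<open>Product test functions\<close>

text \<open>Distinct directions differentiate every factor at most once, so the product form
  survives and no second derivative of a factor appears.\<close>

lemma partial_derivs_prod:
  fixes g :: "'n::euclidean_space \<Rightarrow> real \<Rightarrow> real"
  assumes g: "\<And>b. b \<in> Basis \<Longrightarrow> smooth (g b)"
    and "distinct bs" "set bs \<subseteq> Basis"
  shows "partial_derivs bs (\<lambda>x. \<Prod>b\<in>Basis. g b (x \<bullet> b)) =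
    (\<lambda>x. \<Prod>b\<in>Basis. (if b \<in> set bs then deriv (g b) else g b) (x \<bullet> b))"
  using assms(2,3)
proof (induction bs)
  case (Cons c bs)
  let ?h = "\<lambda>b. if b \<in> set bs then deriv (g b) else g b"
  have h: "smooth (?h b)" if "b \<in> Basis" for b
    using g[OF that] smooth_real_deriv by auto
  have c: "c \<in> Basis" "c \<notin> set bs" using Cons.prems by auto
  have IH: "partial_derivs bs (\<lambda>x. \<Prod>b\<in>Basis. g b (x \<bullet> b)) = (\<lambda>x. \<Prod>b\<in>Basis. ?h b (x \<bullet> b))"
    using Cons by auto
  show ?case
  proof
    fix x :: 'n
    have "((\<lambda>x. ?h b (x \<bullet> b)) has_derivative (\<lambda>v. deriv (?h b) (x \<bullet> b) * (v \<bullet> b))) (at x)"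
      if "b \<in> Basis" for b
    proof -
      have "((\<lambda>x. x \<bullet> b) has_derivative (\<lambda>h. h \<bullet> b)) (at x)"
        by (auto intro!: derivative_eq_intros)
      from has_derivative_compose[OF this
          smooth_real_deriv(1)[OF h[OF that], of "x \<bullet> b", unfolded has_field_derivative_def]]
      show ?thesis by simp
    qed
    from has_derivative_prod[of Basis, OF this]
    have der: "((\<lambda>x. \<Prod>b\<in>Basis. ?h b (x \<bullet> b)) has_derivative
      (\<lambda>v. \<Sum>i\<in>Basis. deriv (?h i) (x \<bullet> i) * (v \<bullet> i) * (\<Prod>j\<in>Basis - {i}. ?h j (x \<bullet> j)))) (at x)" .
    have "partial_derivs (c # bs) (\<lambda>x. \<Prod>b\<in>Basis. g b (x \<bullet> b)) x =
      (\<Sum>i\<in>Basis. deriv (?h i) (x \<bullet> i) * (c \<bullet> i) * (\<Prod>j\<in>Basis - {i}. ?h j (x \<bullet> j)))"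
      unfolding partial_derivs.simps IH frechet_derivative_at[OF der, symmetric] ..
    also have "\<dots> = (\<Sum>i\<in>Basis. if i = c then
        deriv (?h c) (x \<bullet> c) * (\<Prod>j\<in>Basis - {c}. ?h j (x \<bullet> j)) else 0)"
      using c by (intro sum.cong) (auto simp: inner_Basis)
    also have "\<dots> = deriv (?h c) (x \<bullet> c) * (\<Prod>j\<in>Basis - {c}. ?h j (x \<bullet> j))"
      using c by simp
    also have "\<dots> = (\<Prod>b\<in>Basis. (if b \<in> set (c # bs) then deriv (g b) else g b) (x \<bullet> b))"
      using c by (subst (2) prod.remove[of _ c]) (auto intro!: prod.cong)
    finally show "partial_derivs (c # bs) (\<lambda>x. \<Prod>b\<in>Basis. g b (x \<bullet> b)) x =
      (\<Prod>b\<in>Basis. (if b \<in> set (c # bs) then deriv (g b) else g b) (x \<bullet> b))" .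
  qed
qed simp

lemma prod_in_test_functions:
  fixes g :: "'n::euclidean_space \<Rightarrow> real \<Rightarrow> real"
  assumes g: "\<And>b. b \<in> Basis \<Longrightarrow> smooth (g b)"
    and supp: "\<And>b x. b \<in> Basis \<Longrightarrow> x \<notin> {p \<bullet> b..q \<bullet> b} \<Longrightarrow> g b x = 0"
    and sub: "cbox p q \<subseteq> \<Omega>"
  shows "(\<lambda>x. \<Prod>b\<in>Basis. g b (x \<bullet> b)) \<in> test_functions \<Omega>"
proof -
  have "smooth (\<lambda>x. \<Prod>b\<in>Basis. g b (x \<bullet> b))"
    by (intro smooth_prod smooth_inner_comp g)
  moreover have "{x. (\<Prod>b\<in>Basis. g b (x \<bullet> b)) \<noteq> 0} \<subseteq> cbox p q"
  proof
    fix x assume "x \<in> {x. (\<Prod>b\<in>Basis. g b (x \<bullet> b)) \<noteq> 0}"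
    then have "\<forall>b\<in>Basis. g b (x \<bullet> b) \<noteq> 0" by simp
    then show "x \<in> cbox p q" using supp unfolding mem_box atLeastAtMost_iff by blast
  qed
  then have cl: "closure {x. (\<Prod>b\<in>Basis. g b (x \<bullet> b)) \<noteq> 0} \<subseteq> cbox p q"
    by (rule closure_minimal) (rule closed_cbox)
  moreover have "compact (closure {x. (\<Prod>b\<in>Basis. g b (x \<bullet> b)) \<noteq> 0})"
    using cl by (meson bounded_cbox bounded_subset closed_closure compact_eq_bounded_closed)
  ultimately show ?thesis using sub by (auto simp: test_functions_def smooth_def)
qed

lemma deriv_eq_0_outside:
  fixes g :: "real \<Rightarrow> real"
  assumes "\<And>x. x \<notin> {a..b} \<Longrightarrow> g x = 0" and "x \<notin> {a..b}"
  shows "deriv g x = 0"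
proof -
  have "((\<lambda>x. 0) has_real_derivative 0) (at x)" by simp
  then have "(g has_real_derivative 0) (at x)"
    by (rule has_field_derivative_transform_within_open[of _ _ _ "- {a..b}"])
      (use assms in auto)
  then show ?thesis by (rule DERIV_imp_deriv)
qed

section \<open>Locally integrable functions and weak derivatives\<close>

text \<open>Local integrability says nothing about \<open>f\<close> off \<Omega>, so only the
  truncated function can be measurable; it is the limit of the truncations to an exhaustion by
  compact sets.\<close>

lemma locally_integrable_indicator_measurable:
  fixes f :: "'n::euclidean_space \<Rightarrow> 'a::euclidean_space"
  assumes "open \<Omega>" "locally_integrable \<Omega> f"
  shows "(\<lambda>x. indicator \<Omega> x *\<^sub>R f x) \<in> borel_measurable lebesgue"
proof -
  obtain C where C: "\<And>n. compact (C n)" "\<And>n. C n \<subseteq> \<Omega>" "\<And>n. C n \<subseteq> interior (C (Suc n))"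
      "\<Union> (range C) = \<Omega>"
    by (rule open_Union_compact_subsets[OF \<open>open \<Omega>\<close>]) blast
  have mono: "C m \<subseteq> C n" if "m \<le> n" for m n
    using that by (rule lift_Suc_mono_le[rotated]) (use C(3) interior_subset in blast)
  have "(\<lambda>x. indicator (C n) x *\<^sub>R f x) \<in> borel_measurable lebesgue" for n
    using assms(2) C(1,2)[of n] borel_measurable_integrable
    by (fastforce simp: locally_integrable_def set_integrable_def)
  moreover have "(\<lambda>n. indicator (C n) x *\<^sub>R f x) \<longlonglongrightarrow> indicator \<Omega> x *\<^sub>R f x" for x
  proof (cases "x \<in> \<Omega>")
    case True
    then obtain m where "x \<in> C m" using C(4) by blast
    then have "\<forall>\<^sub>F n in sequentially. indicator (C n) x *\<^sub>R f x = indicator \<Omega> x *\<^sub>R f x"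
      using True mono by (intro eventually_sequentiallyI[of m]) (auto simp: indicator_def)
    then show ?thesis by (rule tendsto_eventually)
  next
    case False
    then have "x \<notin> C n" for n using C(2) by blast
    then show ?thesis using False by simp
  qed
  ultimately show ?thesis by (rule borel_measurable_LIMSEQ_metric)
qed

lemma locally_integrable_measurable:
  fixes f :: "'n::euclidean_space \<Rightarrow> 'a::euclidean_space"
  shows "locally_integrable UNIV f \<Longrightarrow> f \<in> borel_measurable lebesgue"
  using locally_integrable_indicator_measurable[of UNIV f] by simp

lemma locally_integrable_diff:
  "locally_integrable \<Omega> f \<Longrightarrow> locally_integrable \<Omega> g \<Longrightarrow> locally_integrable \<Omega> (\<lambda>x. f x - g x)"
  by (auto simp: locally_integrable_def intro: set_integral_diff)

lemma smooth_measurable [measurable]: "smooth f \<Longrightarrow> f \<in> borel_measurable borel"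
  by (simp add: smooth_continuous borel_measurable_continuous_onI)

lemma locally_integrable_mult_compact:
  fixes f :: "'n::euclidean_space \<Rightarrow> 'a::euclidean_space" and \<psi> :: "'n \<Rightarrow> real"
  assumes f: "locally_integrable \<Omega> f" and K: "compact K" "K \<subseteq> \<Omega>"
    and \<psi>: "\<psi> \<in> borel_measurable borel" "\<And>x. x \<notin> K \<Longrightarrow> \<psi> x = 0" "\<And>x. \<bar>\<psi> x\<bar> \<le> B"
  shows "integrable lebesgue (\<lambda>x. \<psi> x *\<^sub>R f x)"
proof (rule Bochner_Integration.integrable_bound)
  have i: "integrable lebesgue (\<lambda>x. indicator K x *\<^sub>R f x)"
    using f K by (auto simp: locally_integrable_def set_integrable_def)
  show "integrable lebesgue (\<lambda>x. B *\<^sub>R (indicator K x *\<^sub>R f x))"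
    using i by (rule integrable_scaleR_right)
  have "(\<lambda>x. \<psi> x *\<^sub>R (indicator K x *\<^sub>R f x)) \<in> borel_measurable lebesgue"
    using \<psi>(1) by (intro borel_measurable_scaleR[OF _ borel_measurable_integrable[OF i]])
      (simp add: measurable_completion)
  moreover have "\<psi> x *\<^sub>R (indicator K x *\<^sub>R f x) = \<psi> x *\<^sub>R f x" for x
    using \<psi>(2)[of x] by (auto simp: indicator_def)
  ultimately show "(\<lambda>x. \<psi> x *\<^sub>R f x) \<in> borel_measurable lebesgue" by (simp only:)
  show "AE x in lebesgue. norm (\<psi> x *\<^sub>R f x) \<le> norm (B *\<^sub>R (indicator K x *\<^sub>R f x))"
  proof (rule AE_I2)
    fix x
    show "norm (\<psi> x *\<^sub>R f x) \<le> norm (B *\<^sub>R (indicator K x *\<^sub>R f x))"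
      using \<psi>(2)[of x] \<psi>(3)[of x]
      by (cases "x \<in> K") (auto intro!: mult_right_mono)
  qed
qed

section \<open>A fixed step function and smooth approximations of box indicators\<close>

definition step :: "real \<Rightarrow> real" where
  "step = (SOME s. smooth s \<and> (\<forall>x\<le>0. s x = 0) \<and> (\<forall>x\<ge>1. s x = 1) \<and> (\<forall>x. s x \<in> {0..1}))"

lemma step: "smooth step" "x \<le> 0 \<Longrightarrow> step x = 0" "x \<ge> 1 \<Longrightarrow> step x = 1" "0 \<le> step x" "step x \<le> 1"
proof -
  have "\<exists>s :: real \<Rightarrow> real. smooth s \<and> (\<forall>x\<le>0. s x = 0) \<and> (\<forall>x\<ge>1. s x = 1) \<and> (\<forall>x. s x \<in> {0..1})"
  proof -
    obtain s :: "real \<Rightarrow> real" where "smooth s" "\<And>x. x \<le> 0 \<Longrightarrow> s x = 0" "\<And>x. x \<ge> 1 \<Longrightarrow> s x = 1"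
        "\<And>x. s x \<in> {0..1}"
      using smooth_step_exists by auto
    then show ?thesis by (intro exI[of _ s]) blast
  qed
  from someI_ex[OF this, folded step_def]
  show "smooth step" "x \<le> 0 \<Longrightarrow> step x = 0" "x \<ge> 1 \<Longrightarrow> step x = 1" "0 \<le> step x" "step x \<le> 1"
    by auto
qed

lemma smooth_step_affine: "smooth (\<lambda>x. step (c * x + d))"
  by (rule smooth_affine_comp[OF step(1)])

lemma deriv_step_eq_0: "x \<notin> {0..1} \<Longrightarrow> deriv step x = 0"
proof -
  assume "x \<notin> {0..1}"
  then consider "x < 0" | "x > 1" by fastforce
  then show "deriv step x = 0"
  proof cases
    case 1
    have "(step has_real_derivative 0) (at x)"
      by (rule has_field_derivative_transform_within_open[of "\<lambda>x. 0" _ _ "{..<0}"])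
        (use 1 step(2) in auto)
    then show ?thesis by (rule DERIV_imp_deriv)
  next
    case 2
    have "(step has_real_derivative 0) (at x)"
      by (rule has_field_derivative_transform_within_open[of "\<lambda>x. 1" _ _ "{1<..}"])
        (use 2 step(3) in auto)
    then show ?thesis by (rule DERIV_imp_deriv)
  qed
qed

text \<open>This constant is the only one in the Sobolev bound, and it is universal because
  \<open>step\<close> is fixed once. Requiring \<open>C \<ge> 1\<close> lets \<open>C * h\<close>
  bound both kinds of factors, \<open>A\<close> and \<open>H\<close>, in
  \<open>product_bump_bound\<close>.\<close>

lemma deriv_step_bounded: obtains C where "C \<ge> 1" "\<And>x. \<bar>deriv step x\<bar> \<le> C"
proof -
  have "compact (deriv step ` {0..1})"
    by (intro compact_continuous_image smooth_continuous smooth_real_deriv step) auto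
  then obtain B where B: "\<And>x. x \<in> {0..1} \<Longrightarrow> \<bar>deriv step x\<bar> \<le> B"
    using compact_imp_bounded bounded_iff by (metis imageI real_norm_def)
  have "\<bar>deriv step x\<bar> \<le> max 1 B" for x
    using B[of x] deriv_step_eq_0[of x] by (cases "x \<in> {0..1}") auto
  then show ?thesis using that[of "max 1 B"] by simp
qed

text \<open>Both ramps, of width \<open>1 / n\<close>, start inside the interval, so the plateaus
  increase towards the indicator without leaving \<open>{p<..<q}\<close>. For \<open>n = 0\<close>
  the function is 0, which is harmless in limits.\<close>

definition plateau :: "real \<Rightarrow> real \<Rightarrow> nat \<Rightarrow> real \<Rightarrow> real" where
  "plateau p q n x = step (real n * (x - p)) * step (real n * (q - x))"

lemma smooth_plateau: "smooth (plateau p q n)"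
proof -
  have "smooth (\<lambda>x. step (real n * x + (- real n * p)) * step (- real n * x + real n * q))"
    by (intro smooth_mult smooth_step_affine)
  then show ?thesis by (simp add: plateau_def[abs_def] algebra_simps)
qed

lemma plateau_bounds: "0 \<le> plateau p q n x" "plateau p q n x \<le> 1"
  using step(4,5) by (simp_all add: plateau_def mult_le_one)

lemma plateau_eq_0: "x \<notin> {p<..<q} \<Longrightarrow> plateau p q n x = 0"
proof -
  assume "x \<notin> {p<..<q}"
  then have "real n * (x - p) \<le> 0 \<or> real n * (q - x) \<le> 0"
    by (auto simp: mult_le_0_iff)
  then show "plateau p q n x = 0" using step(2) by (auto simp: plateau_def)
qed

lemma plateau_tendsto: "(\<lambda>n. plateau p q n x) \<longlonglongrightarrow> indicator {p<..<q} x"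
proof (cases "x \<in> {p<..<q}")
  case True
  obtain m where m: "real m > 1 / (x - p)" "real m > 1 / (q - x)"
    by (metis max_less_iff_conj reals_Archimedean2)
  have "plateau p q n x = 1" if "n \<ge> m" for n
  proof -
    have "real n > 1 / (x - p)" "real n > 1 / (q - x)" using m that by linarith+
    then have "real n * (x - p) \<ge> 1" "real n * (q - x) \<ge> 1"
      using True by (auto simp: field_simps)
    then show ?thesis using step(3) by (simp add: plateau_def)
  qed
  then have "\<forall>\<^sub>F n in sequentially. plateau p q n x = indicator {p<..<q} x"
    using True by (intro eventually_sequentiallyI[of m]) auto
  then show ?thesis by (rule tendsto_eventually)
next
  case False
  then show ?thesis by (simp add: plateau_eq_0)
qed

lemma indicator_box_eq_prod:
  "indicator (box p q) x = (\<Prod>b\<in>Basis. indicator {p \<bullet> b<..<q \<bullet> b} (x \<bullet> b) :: real)"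
  for x :: "'n::euclidean_space"
proof (cases "x \<in> box p q")
  case True
  then show ?thesis by (auto simp: mem_box)
next
  case False
  then obtain b where b: "b \<in> Basis" "x \<bullet> b \<notin> {p \<bullet> b<..<q \<bullet> b}" by (auto simp: mem_box)
  then have "(\<Prod>b\<in>Basis. indicator {p \<bullet> b<..<q \<bullet> b} (x \<bullet> b) :: real) = 0"
    by (intro prod_zero bexI[of _ b]) auto
  then show ?thesis using False by simp
qed

abbreviation box_plateau :: "'n::euclidean_space \<Rightarrow> 'n \<Rightarrow> nat \<Rightarrow> 'n \<Rightarrow> real" where
  "box_plateau p q n x \<equiv> \<Prod>b\<in>Basis. plateau (p \<bullet> b) (q \<bullet> b) n (x \<bullet> b)"

lemma box_plateau_test_function: "cbox p q \<subseteq> \<Omega> \<Longrightarrow> box_plateau p q n \<in> test_functions \<Omega>"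
  by (rule prod_in_test_functions[of "\<lambda>b. plateau (p \<bullet> b) (q \<bullet> b) n" p q])
    (auto intro: smooth_plateau plateau_eq_0)

lemma box_plateau_bounds: "0 \<le> box_plateau p q n x" "box_plateau p q n x \<le> 1"
  using plateau_bounds by (auto intro: prod_nonneg prod_le_1)

lemma box_plateau_eq_0: "x \<notin> box p q \<Longrightarrow> box_plateau p q n x = 0"
  by (auto simp: mem_box intro!: plateau_eq_0)

lemma box_plateau_integral_tendsto:
  fixes f :: "'n::euclidean_space \<Rightarrow> 'a::euclidean_space"
  assumes f: "locally_integrable UNIV f"
  shows "(\<lambda>n. LINT x|lebesgue. box_plateau p q n x *\<^sub>R f x) \<longlonglongrightarrow> integral (cbox p q) f"
proof -
  have si: "set_integrable lebesgue (cbox p q) f"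
    using f by (auto simp: locally_integrable_def)
  have sib: "set_integrable lebesgue (box p q) f"
    by (rule set_integrable_subset[OF si]) (auto simp: box_subset_cbox)
  have [measurable]: "f \<in> borel_measurable lebesgue"
    using f by (rule locally_integrable_measurable)
  have sm: "smooth (box_plateau p q n)" for n
    by (intro smooth_prod smooth_inner_comp smooth_plateau)
  have "(\<lambda>n. LINT x|lebesgue. box_plateau p q n x *\<^sub>R f x) \<longlonglongrightarrow>
      (LINT x|lebesgue. indicator (box p q) x *\<^sub>R f x)"
  proof (rule integral_dominated_convergence[where w = "\<lambda>x. norm (indicator (cbox p q) x *\<^sub>R f x)"])
    show "integrable lebesgue (\<lambda>x. norm (indicator (cbox p q) x *\<^sub>R f x))"
      by (rule integrable_norm[OF si[unfolded set_integrable_def]])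
    show "AE x in lebesgue. (\<lambda>n. box_plateau p q n x *\<^sub>R f x) \<longlonglongrightarrow> indicator (box p q) x *\<^sub>R f x"
      unfolding indicator_box_eq_prod
      by (intro AE_I2 tendsto_scaleR tendsto_prod plateau_tendsto tendsto_const)
    show "AE x in lebesgue. norm (box_plateau p q n x *\<^sub>R f x) \<le> norm (indicator (cbox p q) x *\<^sub>R f x)" for n
    proof (rule AE_I2)
      fix x :: 'n
      show "norm (box_plateau p q n x *\<^sub>R f x) \<le> norm (indicator (cbox p q) x *\<^sub>R f x)"
      proof (cases "x \<in> box p q")
        case True
        then have "x \<in> cbox p q" using box_subset_cbox by blast
        then show ?thesis
          using box_plateau_bounds[of p q n x] by (simp add: mult_left_le_one_le)
      next
        case False
        then have "box_plateau p q n x = 0" by (rule box_plateau_eq_0)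
        then show ?thesis by (simp only: scaleR_zero_left norm_zero norm_ge_zero)
      qed
    qed
    show "(\<lambda>x. box_plateau p q n x *\<^sub>R f x) \<in> borel_measurable lebesgue" for n
      using smooth_measurable[OF sm] by (intro borel_measurable_scaleR) (auto simp: measurable_completion)
    show "(\<lambda>x. indicator (box p q) x *\<^sub>R f x) \<in> borel_measurable lebesgue"
      using sib borel_measurable_integrable by (auto simp: set_integrable_def)
  qed
  \<comment> \<open>The plateaus converge to the indicator of the open box; its boundary is a null
    set.\<close>
  also have "(LINT x|lebesgue. indicator (box p q) x *\<^sub>R f x) = integral (cbox p q) f"
    using set_lebesgue_integral_eq_integral(2)[OF sib]
    by (simp add: set_lebesgue_integral_def integral_open_interval)
  finally show ?thesis .
qed

text \<open>This is Lebesgue differentiation along cubes with corner \<open>x\<close>: the averages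
  are bounded by \<open>C\<close> and converge to \<open>f x\<close> almost everywhere. Only small
  \<open>h\<close> matter, hence the restriction \<open>h \<le> 1\<close>.\<close>

lemma AE_bound_from_cubes:
  fixes f :: "'n::euclidean_space \<Rightarrow> 'a::euclidean_space"
  assumes f: "locally_integrable UNIV f"
    and bd: "\<And>x h. 0 < h \<Longrightarrow> h \<le> 1 \<Longrightarrow> norm (integral (cbox x (x + h *\<^sub>R One)) f) \<le> C * h ^ DIM('n)"
  shows "AE x in lebesgue. norm (f x) \<le> C"
proof -
  have "f integrable_on cbox a b" for a b
    using f by (auto simp: locally_integrable_def intro: set_lebesgue_integral_eq_integral(1))
  then obtain N where N: "negligible N" "\<And>x e. \<lbrakk>x \<notin> N; 0 < e\<rbrakk> \<Longrightarrow>
      \<exists>d>0. \<forall>h. 0 < h \<and> h < d \<longrightarrow> norm (integral (cbox x (x + h *\<^sub>R One)) f /\<^sub>R h ^ DIM('n) - f x) < e"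
    using integrable_ccontinuous_explicit[of f] by blast
  have "norm (f x) \<le> C" if "x \<notin> N" for x
  proof (rule field_le_epsilon)
    fix e :: real assume "0 < e"
    with N(2)[OF that this] obtain d where d: "d > 0"
      "\<And>h. 0 < h \<Longrightarrow> h < d \<Longrightarrow> norm (integral (cbox x (x + h *\<^sub>R One)) f /\<^sub>R h ^ DIM('n) - f x) < e"
      by blast
    define h where "h = min (d / 2) 1"
    have h: "0 < h" "h < d" "h \<le> 1" using d(1) by (auto simp: h_def)
    let ?I = "integral (cbox x (x + h *\<^sub>R One)) f /\<^sub>R h ^ DIM('n)"
    have "norm ?I \<le> C"
      using bd[OF h(1,3), of x] h(1) by (simp add: field_simps)
    moreover have "norm (f x) \<le> norm ?I + norm (?I - f x)"
      by (metis norm_minus_commute norm_triangle_sub)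
    ultimately show "norm (f x) \<le> C + e" using d(2)[OF h(1,2)] by linarith
  qed
  moreover have "N \<in> null_sets lebesgue" using N(1) by (simp add: negligible_iff_null_sets)
  ultimately show ?thesis by (intro AE_I'[of N]) auto
qed

text \<open>The term of order 0 in \<open>H_norm\<close> is phrased with a weak derivative along the
  empty list. This lemma identifies it with the function itself, by testing with plateaus and
  applying \<open>AE_bound_from_cubes\<close> with constant 0 to the difference.\<close>

lemma weak_deriv_Nil_AE_eq:
  fixes f g :: "'n::euclidean_space \<Rightarrow> 'a::euclidean_space"
  assumes w: "weak_deriv UNIV [] f g"
  shows "AE x in lebesgue. f x = g x"
proof -
  have li: "locally_integrable UNIV f" "locally_integrable UNIV g"
    using w by (auto simp: weak_deriv_def)
  have "integral (cbox p q) f = integral (cbox p q) g" for p q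
  proof -
    have "(LINT x|lebesgue. box_plateau p q n x *\<^sub>R f x) = (LINT x|lebesgue. box_plateau p q n x *\<^sub>R g x)" for n
      using w box_plateau_test_function[of p q UNIV n] by (auto simp: weak_deriv_def)
    then show ?thesis
      using box_plateau_integral_tendsto[OF li(1), of p q] box_plateau_integral_tendsto[OF li(2), of p q]
      by (simp add: LIMSEQ_unique)
  qed
  moreover have "f integrable_on cbox p q" "g integrable_on cbox p q" for p q
    using li by (auto simp: locally_integrable_def intro: set_lebesgue_integral_eq_integral(1))
  ultimately have "integral (cbox p q) (\<lambda>x. f x - g x) = 0" for p q
    by (simp add: integral_diff)
  then have "AE x in lebesgue. norm (f x - g x) \<le> 0"
    by (intro AE_bound_from_cubes locally_integrable_diff li) simp
  then show ?thesis by simp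
qed

section \<open>A Sobolev bound\<close>

text \<open>A primitive of \<open>a\<close> is not compactly supported; its final value
  \<open>I\<close> is the mass of the bump. Subtracting \<open>I\<close> times a step that rises
  over the unit interval from \<open>p\<close> restores compact support, and
  \<open>q \<le> p + 1\<close> makes the two cancel beyond \<open>p + 1\<close>. Both subtracted
  terms lie between 0 and \<open>I\<close>, so \<open>A\<close> is as small as the bump is narrow.
  The remainder carries the same mass as \<open>a\<close>, spread over a unit interval and hence
  also small.\<close>

lemma bump_decomposition:
  fixes a :: "real \<Rightarrow> real"
  assumes a: "smooth a" "\<And>x. 0 \<le> a x" "\<And>x. a x \<le> 1" "\<And>x. x \<notin> {p..q} \<Longrightarrow> a x = 0"
    and pq: "p \<le> q" "q \<le> p + 1"
  obtains A I where "smooth A" "\<And>x. x \<notin> {p..p+1} \<Longrightarrow> A x = 0" "\<And>x. \<bar>A x\<bar> \<le> q - p"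
    "0 \<le> I" "I \<le> q - p" "\<And>x. a x = deriv A x + I * deriv step (x - p)"
proof -
  obtain F where F: "smooth F" "\<And>x. (F has_real_derivative a x) (at x)"
    using smooth_antiderivative[OF a(1)] by blast
  have mono: "F x \<le> F y" if "x \<le> y" for x y
    by (rule DERIV_nonneg_imp_nondecreasing[OF that]) (use F a(2) in blast)
  have left: "F x = F p" if "x \<le> p" for x
  proof (cases "x = p")
    case False
    then have xp: "x < p" using that by simp
    have "continuous_on {x..p} F" by (rule smooth_continuous[OF F(1)])
    then show ?thesis
      by (rule DERIV_isconst_end[OF xp, symmetric]) (use F(2) a(4) in \<open>metis atLeastAtMost_iff linorder_not_le\<close>)
  qed simp
  have right: "F x = F q" if "q \<le> x" for x
  proof (cases "x = q")
    case False
    then have xp: "q < x" using that by simp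
    have "continuous_on {q..x} F" by (rule smooth_continuous[OF F(1)])
    then show ?thesis
      by (rule DERIV_isconst_end[OF xp]) (use F(2) a(4) in \<open>metis atLeastAtMost_iff linorder_not_le\<close>)
  qed simp
  define I where "I = F q - F p"
  have bd: "F p \<le> F x" "F x \<le> F q" for x
    using mono[of p x] mono[of x q] left[of x] right[of x] pq mono[of p q] by linarith+
  have I0: "0 \<le> I" using mono[OF pq(1)] by (simp add: I_def)
  have I1: "I \<le> q - p"
  proof -
    have "(\<lambda>x. x - F x) p \<le> (\<lambda>x. x - F x) q"
    proof (rule DERIV_nonneg_imp_nondecreasing[OF pq(1)])
      fix x
      have "((\<lambda>x. x - F x) has_real_derivative 1 - a x) (at x)"
        by (intro DERIV_diff DERIV_ident F(2))
      then show "\<exists>y. ((\<lambda>x. x - F x) has_real_derivative y) (at x) \<and> 0 \<le> y"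
        using a(3)[of x] by (intro exI[of _ "1 - a x"]) auto
    qed
    then show ?thesis by (simp add: I_def)
  qed
  define A where "A x = (F x - F p) - I * step (x - p)" for x
  show ?thesis
  proof (rule that[of A I])
    show "smooth A"
      unfolding A_def using smooth_step_affine[of 1 "-p"]
      by (intro smooth_diff smooth_mult smooth_const F) simp
    have "((\<lambda>x. step (x - p)) has_real_derivative deriv step (x - p)) (at x)" for x
      using smooth_real_deriv(1)[OF step(1), of "x - p"] DERIV_shift[of step _ x "-p"] by simp
    then have d: "(A has_real_derivative a x - 0 - I * deriv step (x - p)) (at x)" for x
      unfolding A_def by (intro DERIV_diff F(2) DERIV_const DERIV_cmult)
    then show "a x = deriv A x + I * deriv step (x - p)" for x
      using DERIV_imp_deriv[OF d, of x] by simp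
    show "A x = 0" if "x \<notin> {p..p+1}" for x
    proof (cases "x < p")
      case True
      then show ?thesis using left[of x] step(2)[of "x - p"] by (simp add: A_def)
    next
      case False
      then show ?thesis using right[of x] pq step(3)[of "x - p"] that by (simp add: A_def I_def)
    qed
    show "\<bar>A x\<bar> \<le> q - p" for x
    proof -
      have "0 \<le> I * step (x - p)" "I * step (x - p) \<le> I"
        using step(4,5)[of "x - p"] I0 by (auto simp: mult_left_le)
      then show ?thesis using bd[of x] I1 unfolding A_def I_def by linarith
    qed
  qed (fact I0 I1)+
qed

text \<open>Expanding a product of sums is indexed by sets of directions, while weak derivatives are
  indexed by lists; a fixed enumeration translates one into the other.\<close>

definition enum_of :: "'a set \<Rightarrow> 'a list" where
  "enum_of S = (SOME bs. set bs = S \<and> distinct bs)"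

lemma enum_of: "finite S \<Longrightarrow> set (enum_of S) = S \<and> distinct (enum_of S)"
  unfolding enum_of_def by (rule someI_ex[OF finite_distinct_list])

text \<open>Each factor of a product bump is \<open>A' + h\<close> with \<open>A\<close>, \<open>h\<close> bounded by the width of the bump.
  Expanding the product therefore turns the bump into a sum of mixed derivatives of bounded
  test functions, which can be moved onto \<open>f\<close>.\<close>

lemma product_bump_bound:
  fixes f :: "'n::euclidean_space \<Rightarrow> real"
  assumes w: "\<And>bs. set bs \<subseteq> Basis \<Longrightarrow> distinct bs \<Longrightarrow> weak_deriv UNIV bs f (G bs)"
    and a: "\<And>b. b \<in> Basis \<Longrightarrow> smooth (a b)" "\<And>b x. 0 \<le> a b x" "\<And>b x. a b x \<le> 1"
      "\<And>b x. b \<in> Basis \<Longrightarrow> x \<notin> {p \<bullet> b..p \<bullet> b + h} \<Longrightarrow> a b x = 0"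
    and h: "0 < h" "h \<le> 1" and C: "C \<ge> 1" "\<And>x. \<bar>deriv step x\<bar> \<le> C"
    and K: "\<And>bs. set bs \<subseteq> Basis \<Longrightarrow> distinct bs \<Longrightarrow>
      (LINT x|lebesgue. indicator (cbox p (p + One)) x * \<bar>G bs x\<bar>) \<le> K"
  shows "\<bar>LINT x|lebesgue. (\<Prod>b\<in>Basis. a b (x \<bullet> b)) * f x\<bar> \<le> (2 * C) ^ DIM('n) * K * h ^ DIM('n)"
proof -
  let ?n = "DIM('n)"
  define P where "P b = (\<lambda>(A, I). smooth A \<and> (\<forall>x. x \<notin> {p \<bullet> b..p \<bullet> b + 1} \<longrightarrow> A x = 0) \<and>
      (\<forall>x. \<bar>A x\<bar> \<le> h) \<and> 0 \<le> I \<and> I \<le> h \<and>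
      (\<forall>x. a b x = deriv A x + I * deriv step (x - p \<bullet> b)))" for b
  have "\<exists>AI. P b AI" if b: "b \<in> Basis" for b
  proof (rule bump_decomposition[of "a b" "p \<bullet> b" "p \<bullet> b + h"])
    show "x \<notin> {p \<bullet> b..p \<bullet> b + h} \<Longrightarrow> a b x = 0" for x by (rule a(4)[OF b])
    fix A I
    assume "smooth A" "\<And>x. x \<notin> {p \<bullet> b..p \<bullet> b + 1} \<Longrightarrow> A x = 0" "\<And>x. \<bar>A x\<bar> \<le> p \<bullet> b + h - p \<bullet> b"
      "0 \<le> I" "I \<le> p \<bullet> b + h - p \<bullet> b" "\<And>x. a b x = deriv A x + I * deriv step (x - p \<bullet> b)"
    then have "P b (A, I)" unfolding P_def by simp
    then show ?thesis ..
  qed (use a(1)[OF b] a(2,3) h in simp_all)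
  then obtain AI where AI: "\<And>b. b \<in> Basis \<Longrightarrow> P b (AI b)"
    using bchoice[of Basis P] by blast
  define A I where "A b = fst (AI b)" and "I b = snd (AI b)" for b
  have P: "P b (A b, I b)" if "b \<in> Basis" for b
    using AI[OF that] by (simp add: A_def I_def)
  have A: "smooth (A b)" "x \<notin> {p \<bullet> b..p \<bullet> b + 1} \<Longrightarrow> A b x = 0" "\<bar>A b x\<bar> \<le> h"
    and I: "0 \<le> I b" "I b \<le> h"
    and dec: "a b x = deriv (A b) x + I b * deriv step (x - p \<bullet> b)" if "b \<in> Basis" for b x
    using P[OF that] unfolding P_def by blast+
  define H where "H b x = I b * deriv step (x - p \<bullet> b)" for b x
  have H: "smooth (H b)" "x \<notin> {p \<bullet> b..p \<bullet> b + 1} \<Longrightarrow> H b x = 0" for b x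
  proof -
    have "smooth (\<lambda>x. deriv step (1 * x + (- (p \<bullet> b))))"
      by (intro smooth_affine_comp smooth_real_deriv step)
    then show "smooth (H b)" unfolding H_def by (intro smooth_mult smooth_const) simp
    show "x \<notin> {p \<bullet> b..p \<bullet> b + 1} \<Longrightarrow> H b x = 0"
      using deriv_step_eq_0[of "x - p \<bullet> b"] by (auto simp: H_def)
  qed
  have HC: "\<bar>H b x\<bar> \<le> C * h" if "b \<in> Basis" for b x
  proof -
    have "\<bar>H b x\<bar> \<le> h * C"
      unfolding H_def abs_mult using I[OF that] C by (intro mult_mono) auto
    then show ?thesis by (simp add: mult.commute)
  qed
  have AC: "\<bar>A b x\<bar> \<le> C * h" if "b \<in> Basis" for b x
    using A(3)[OF that, of x] C(1) h(1) by (smt (verit) mult_le_cancel_right1)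
  \<comment> \<open>Differentiating \<psi> once in every direction of \<open>S\<close> turns
    \<open>A\<close> into its derivative there and leaves \<open>H\<close> elsewhere: exactly the
    summand of index \<open>S\<close> in the expanded product.\<close>
  define g where "g S b = (if b \<in> S then A b else H b)" for S b
  define \<psi> where "\<psi> S x = (\<Prod>b\<in>Basis. g S b (x \<bullet> b))" for S x
  have g: "smooth (g S b)" if "b \<in> Basis" for S b
    using A(1)[OF that] H(1) by (simp add: g_def)
  have g0: "g S b x = 0" if "b \<in> Basis" "x \<notin> {p \<bullet> b..p \<bullet> b + 1}" for S b x
    using A(2)[OF that] H(2)[OF that(2)] by (simp add: g_def)
  have g1: "\<bar>g S b x\<bar> \<le> C * h" if "b \<in> Basis" for S b x
    using AC[OF that] HC[OF that] by (simp add: g_def)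
  have \<psi>_test: "\<psi> S \<in> test_functions UNIV" for S
    unfolding \<psi>_def by (rule prod_in_test_functions[of "g S" p "p + One"])
      (use g g0 in \<open>auto simp: inner_add_left\<close>)
  have \<psi>_smooth: "smooth (\<psi> S)" for S
    unfolding \<psi>_def by (intro smooth_prod smooth_inner_comp g)
  have \<psi>_bd: "\<bar>\<psi> S x\<bar> \<le> (C * h) ^ ?n * indicator (cbox p (p + One)) x" for S x
  proof (cases "x \<in> cbox p (p + One)")
    case True
    have "\<bar>\<psi> S x\<bar> \<le> (\<Prod>b\<in>(Basis::'n set). C * h)"
      unfolding \<psi>_def abs_prod using g1 by (intro prod_mono) auto
    then show ?thesis using True by simp
  next
    case False
    then obtain b where "b \<in> Basis" "x \<bullet> b \<notin> {p \<bullet> b..p \<bullet> b + 1}"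
      by (auto simp: mem_box inner_add_left)
    then have "\<psi> S x = 0" unfolding \<psi>_def by (intro prod_zero bexI[of _ b]) (use g0 in auto)
    then show ?thesis using False by simp
  qed
  let ?D = "\<lambda>S. partial_derivs (enum_of S) (\<psi> S)"
  have fin: "finite S" if "S \<subseteq> (Basis::'n set)" for S
    using that finite_Basis finite_subset by blast
  have D: "?D S x = (\<Prod>b\<in>S. deriv (A b) (x \<bullet> b)) * (\<Prod>b\<in>Basis - S. H b (x \<bullet> b))"
    if S: "S \<subseteq> Basis" for S x
  proof -
    have "?D S x = (\<Prod>b\<in>Basis. (if b \<in> S then deriv (g S b) else g S b) (x \<bullet> b))"
      unfolding \<psi>_def
      by (subst partial_derivs_prod) (use g S enum_of[OF fin[OF S]] in auto)
    also have "\<dots> = (\<Prod>b\<in>Basis. if b \<in> S then deriv (A b) (x \<bullet> b) else H b (x \<bullet> b))"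
      by (intro prod.cong) (auto simp: g_def)
    also have "\<dots> = (\<Prod>b\<in>S. deriv (A b) (x \<bullet> b)) * (\<Prod>b\<in>Basis - S. H b (x \<bullet> b))"
      using S by (subst prod.subset_diff[of S]) (auto simp: mult.commute intro!: arg_cong2[where f="(*)"] prod.cong)
    finally show ?thesis .
  qed
  have expand: "(\<Prod>b\<in>Basis. a b (x \<bullet> b)) = (\<Sum>S\<in>Pow Basis. ?D S x)" for x
  proof -
    have "(\<Prod>b\<in>Basis. a b (x \<bullet> b)) = (\<Prod>b\<in>Basis. deriv (A b) (x \<bullet> b) + H b (x \<bullet> b))"
      by (intro prod.cong) (auto simp: dec H_def)
    also have "\<dots> = (\<Sum>S\<in>Pow Basis. (\<Prod>b\<in>S. deriv (A b) (x \<bullet> b)) * (\<Prod>b\<in>Basis - S. H b (x \<bullet> b)))"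
      by (rule prod_add) simp
    finally show ?thesis using D by simp
  qed
  have li: "locally_integrable UNIV f"
    using w[of "[]"] by (simp add: weak_deriv_def)
  \<comment> \<open>This only serves to split the integral of the sum. The bound \<open>B\<close>
    may depend on the bump; the estimate that is uniform in the bump is
    \<open>bound\<close>.\<close>
  have Dint: "integrable lebesgue (\<lambda>x. ?D S x * f x)" if S: "S \<subseteq> Basis" for S
  proof -
    let ?g = "\<lambda>b. if b \<in> S then deriv (A b) else H b"
    have gs: "smooth (?g b)" if "b \<in> Basis" for b
      using A(1)[OF that] H(1) smooth_real_deriv by auto
    have g0': "?g b x = 0" if "b \<in> Basis" "x \<notin> {p \<bullet> b..p \<bullet> b + 1}" for b x
      using deriv_eq_0_outside[OF A(2)[OF that(1)] that(2)] H(2)[OF that(2)] by auto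
    have D': "?D S = (\<lambda>x. \<Prod>b\<in>Basis. ?g b (x \<bullet> b))"
      unfolding D[OF S] using S
      by (subst (3) prod.subset_diff[of S]) (auto simp: mult.commute intro!: ext arg_cong2[where f="(*)"] prod.cong)
    have sD: "smooth (?D S)" unfolding D' by (intro smooth_prod smooth_inner_comp gs)
    have D0: "?D S x = 0" if "x \<notin> cbox p (p + One)" for x
    proof -
      from that obtain b where "b \<in> Basis" "x \<bullet> b \<notin> {p \<bullet> b..p \<bullet> b + 1}"
        by (auto simp: mem_box inner_add_left)
      then show ?thesis unfolding D' by (intro prod_zero bexI[of _ b]) (use g0' in auto)
    qed
    have "compact (?D S ` cbox p (p + One))"
      by (intro compact_continuous_image smooth_continuous sD) auto
    then obtain B where B: "\<And>x. x \<in> cbox p (p + One) \<Longrightarrow> \<bar>?D S x\<bar> \<le> B"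
      using compact_imp_bounded bounded_iff by (metis imageI real_norm_def)
    have "\<bar>?D S x\<bar> \<le> max 0 B" for x
      using B[of x] D0[of x] by (cases "x \<in> cbox p (p + One)") auto
    then show ?thesis
      using locally_integrable_mult_compact[OF li, of "cbox p (p + One)" "?D S" "max 0 B"] sD D0
      by (auto intro: smooth_measurable)
  qed
  have bound: "\<bar>LINT x|lebesgue. ?D S x * f x\<bar> \<le> (C * h) ^ ?n * K" if S: "S \<subseteq> Basis" for S
  proof -
    let ?bs = "enum_of S"
    have bs: "set ?bs \<subseteq> Basis" "distinct ?bs" using enum_of[OF fin[OF S]] S by auto
    have W: "weak_deriv UNIV ?bs f (G ?bs)" by (rule w[OF bs])
    then have G: "locally_integrable UNIV (G ?bs)" by (simp add: weak_deriv_def)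
    \<comment> \<open>The sign from integrating by parts disappears in the absolute value. What is
      left is a test function of size \<open>(C * h) ^ ?n\<close> on a cube of side 1, against a
      fixed weak derivative of \<open>f\<close>.\<close>
    have "\<bar>LINT x|lebesgue. ?D S x * f x\<bar> = \<bar>LINT x|lebesgue. \<psi> S x * G ?bs x\<bar>"
      using W \<psi>_test[of S] by (simp add: weak_deriv_def abs_mult power_abs)
    also have "\<dots> \<le> (LINT x|lebesgue. (C * h) ^ ?n * (indicator (cbox p (p + One)) x * \<bar>G ?bs x\<bar>))"
    proof (rule integral_abs_bound_integral)
      have "integrable lebesgue (\<lambda>x. \<psi> S x *\<^sub>R G ?bs x)"
      proof (rule locally_integrable_mult_compact[OF G])
        show "\<psi> S \<in> borel_measurable borel" by (rule smooth_measurable[OF \<psi>_smooth])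
        show "\<psi> S x = 0" if "x \<notin> cbox p (p + One)" for x using \<psi>_bd[of S x] that by simp
        show "\<bar>\<psi> S x\<bar> \<le> (C * h) ^ ?n" for x
          using \<psi>_bd[of S x] C(1) h(1) by (cases "x \<in> cbox p (p + One)") auto
      qed auto
      then show "integrable lebesgue (\<lambda>x. \<psi> S x * G ?bs x)" by simp
      have "integrable lebesgue (\<lambda>x. \<bar>indicator (cbox p (p + One)) x *\<^sub>R G ?bs x\<bar>)"
        using G by (intro integrable_abs) (auto simp: locally_integrable_def set_integrable_def)
      then show "integrable lebesgue (\<lambda>x. (C * h) ^ ?n * (indicator (cbox p (p + One)) x * \<bar>G ?bs x\<bar>))"
        by (intro integrable_mult_right) (simp add: abs_mult)
      show "\<bar>\<psi> S x * G ?bs x\<bar> \<le> (C * h) ^ ?n * (indicator (cbox p (p + One)) x * \<bar>G ?bs x\<bar>)" for x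
        unfolding abs_mult mult.assoc[symmetric] by (intro mult_right_mono \<psi>_bd) auto
    qed
    also have "\<dots> \<le> (C * h) ^ ?n * K"
      using K[OF bs] C(1) h(1) by (simp add: mult_left_mono)
    finally show ?thesis .
  qed
  have "(LINT x|lebesgue. (\<Prod>b\<in>Basis. a b (x \<bullet> b)) * f x) =
      (LINT x|lebesgue. (\<Sum>S\<in>Pow Basis. ?D S x * f x))"
    by (simp add: expand sum_distrib_right)
  also have "\<dots> = (\<Sum>S\<in>Pow Basis. LINT x|lebesgue. ?D S x * f x)"
    by (rule Bochner_Integration.integral_sum) (use Dint in auto)
  also have "\<bar>\<dots>\<bar> \<le> (\<Sum>S\<in>Pow (Basis::'n set). (C * h) ^ ?n * K)"
    by (rule order_trans[OF sum_abs sum_mono]) (use bound in auto)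
  \<comment> \<open>The power of 2 counts the subsets of the basis.\<close>
  also have "\<dots> = (2 * C) ^ ?n * K * h ^ ?n"
    by (simp add: card_Pow power_mult_distrib mult_ac)
  finally show ?thesis .
qed

text \<open>The plateaus of a cube of side \<open>h\<close> are product bumps of width
  \<open>h\<close>. Their common bound passes to the integral over the cube, where
  \<open>h ^ DIM('n)\<close> is just the volume, so all averages of \<open>f\<close> are
  bounded.\<close>

proposition AE_bounded_by_mixed_derivatives:
  fixes f :: "'n::euclidean_space \<Rightarrow> real"
  assumes w: "\<And>bs. set bs \<subseteq> Basis \<Longrightarrow> distinct bs \<Longrightarrow> weak_deriv UNIV bs f (G bs)"
    and C: "C \<ge> 1" "\<And>x. \<bar>deriv step x\<bar> \<le> C"
    and K: "\<And>bs p. set bs \<subseteq> Basis \<Longrightarrow> distinct bs \<Longrightarrow>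
      (LINT x|lebesgue. indicator (cbox p (p + One)) x * \<bar>G bs x\<bar>) \<le> K"
  shows "AE x in lebesgue. \<bar>f x\<bar> \<le> (2 * C) ^ DIM('n) * K"
proof -
  have li: "locally_integrable UNIV f"
    using w[of "[]"] by (simp add: weak_deriv_def)
  have "AE x in lebesgue. norm (f x) \<le> (2 * C) ^ DIM('n) * K"
  proof (rule AE_bound_from_cubes[OF li])
    fix p :: 'n and h :: real assume h: "0 < h" "h \<le> 1"
    let ?q = "p + h *\<^sub>R One"
    have "plateau (p \<bullet> b) (?q \<bullet> b) n x = 0" if "b \<in> Basis" "x \<notin> {p \<bullet> b..p \<bullet> b + h}" for b n x
      by (rule plateau_eq_0) (use that in \<open>auto simp: inner_add_left\<close>)
    then have "\<bar>LINT x|lebesgue. box_plateau p ?q n x * f x\<bar> \<le> (2 * C) ^ DIM('n) * K * h ^ DIM('n)" for n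
      by (intro product_bump_bound[OF w _ _ _ _ h C K] smooth_plateau plateau_bounds)
    moreover have "(\<lambda>n. \<bar>LINT x|lebesgue. box_plateau p ?q n x * f x\<bar>) \<longlonglongrightarrow> \<bar>integral (cbox p ?q) f\<bar>"
      using tendsto_rabs[OF box_plateau_integral_tendsto[OF li, of p ?q]] by simp
    ultimately show "norm (integral (cbox p ?q) f) \<le> (2 * C) ^ DIM('n) * K * h ^ DIM('n)"
      by (intro LIMSEQ_le_const2[of _ _ "(2 * C) ^ DIM('n) * K * h ^ DIM('n)"]) auto
  qed
  then show ?thesis by simp
qed

section \<open>Square integrable functions and the extended norms\<close>

definition sq_integrable :: "(real^3 \<Rightarrow> 'a::euclidean_space) \<Rightarrow> bool" where
  "sq_integrable f \<longleftrightarrow> f \<in> borel_measurable lebesgue \<and> integrable lebesgue (\<lambda>x. (norm (f x))\<^sup>2)"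

definition sq_int :: "(real^3 \<Rightarrow> 'a::euclidean_space) \<Rightarrow> real" where
  "sq_int f = (LINT x|lebesgue. (norm (f x))\<^sup>2)"

lemma sq_int_nonneg: "0 \<le> sq_int f"
  by (simp add: sq_int_def)

lemma sq_integrable_bound:
  assumes "sq_integrable g" "f \<in> borel_measurable lebesgue" "AE x in lebesgue. norm (f x) \<le> norm (g x)"
  shows "sq_integrable f" "sq_int f \<le> sq_int g"
proof -
  have le: "AE x in lebesgue. (norm (f x))\<^sup>2 \<le> (norm (g x))\<^sup>2"
    using assms(3) by eventually_elim (simp add: power_mono)
  have "integrable lebesgue (\<lambda>x. (norm (f x))\<^sup>2)"
  proof (rule Bochner_Integration.integrable_bound)
    show "integrable lebesgue (\<lambda>x. (norm (g x))\<^sup>2)"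
      using assms(1) unfolding sq_integrable_def by blast
    show "(\<lambda>x. (norm (f x))\<^sup>2) \<in> borel_measurable lebesgue"
      by (intro borel_measurable_power measurable_compose[OF assms(2) borel_measurable_norm])
    show "AE x in lebesgue. norm ((norm (f x))\<^sup>2) \<le> norm ((norm (g x))\<^sup>2)"
      using le by eventually_elim simp
  qed
  then show "sq_integrable f" using assms(2) by (simp add: sq_integrable_def)
  then show "sq_int f \<le> sq_int g"
    unfolding sq_int_def using assms(1) le by (intro integral_mono_AE) (auto simp: sq_integrable_def)
qed

lemma norm_add_sq_le: "(norm (a + b))\<^sup>2 \<le> 2 * (norm a)\<^sup>2 + 2 * (norm b)\<^sup>2"
proof -
  have "(norm (a + b))\<^sup>2 \<le> (norm a + norm b)\<^sup>2"
    by (simp add: norm_triangle_ineq power_mono)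
  also have "\<dots> \<le> 2 * (norm a)\<^sup>2 + 2 * (norm b)\<^sup>2"
    using sum_squares_bound[of "norm a" "norm b"] by (simp add: power2_sum)
  finally show ?thesis .
qed

lemma sq_integrable_add:
  assumes "sq_integrable f" "sq_integrable g"
  shows "sq_integrable (\<lambda>x. f x + g x)" "sq_int (\<lambda>x. f x + g x) \<le> 2 * sq_int f + 2 * sq_int g"
proof -
  have i: "integrable lebesgue (\<lambda>x. 2 * (norm (f x))\<^sup>2 + 2 * (norm (g x))\<^sup>2)"
    using assms by (simp add: sq_integrable_def)
  have m: "(\<lambda>x. f x + g x) \<in> borel_measurable lebesgue"
    using assms by (auto simp: sq_integrable_def)
  have i': "integrable lebesgue (\<lambda>x. (norm (f x + g x))\<^sup>2)"
    using m norm_add_sq_le by (intro Bochner_Integration.integrable_bound[OF i]) (auto intro!: AE_I2)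
  then show "sq_integrable (\<lambda>x. f x + g x)" using m by (simp add: sq_integrable_def)
  have "sq_int (\<lambda>x. f x + g x) \<le> (LINT x|lebesgue. 2 * (norm (f x))\<^sup>2 + 2 * (norm (g x))\<^sup>2)"
    unfolding sq_int_def by (rule integral_mono[OF i' i]) (rule norm_add_sq_le)
  also have "\<dots> = 2 * sq_int f + 2 * sq_int g"
    using assms by (simp add: sq_int_def sq_integrable_def)
  finally show "sq_int (\<lambda>x. f x + g x) \<le> 2 * sq_int f + 2 * sq_int g" .
qed

lemma sq_integrable_diff:
  assumes "sq_integrable f" "sq_integrable g"
  shows "sq_integrable (\<lambda>x. f x - g x)"
  using sq_integrable_add(1)[of f "\<lambda>x. - g x"] assms by (simp add: sq_integrable_def)

lemma Lp_norm_2_finite: "Lp_norm 2 f < \<infinity> \<Longrightarrow> sq_integrable f"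
  by (auto simp: Lp_norm_def sq_integrable_def split: if_splits)

text \<open>A strict bound by a finite \<open>ennreal e\<close> is the form in which the extended
  norms become real estimates: it yields membership in the space and the size at once.\<close>

lemma Lp_norm_2_less:
  assumes "Lp_norm 2 f < ennreal e"
  shows "sq_integrable f \<and> sq_int f < e\<^sup>2"
proof
  have "Lp_norm 2 f < \<infinity>" using assms less_top order_less_trans by fastforce
  then show i: "sq_integrable f" by (rule Lp_norm_2_finite)
  have "Lp_norm 2 f = ennreal (sqrt (sq_int f))"
    using i sq_int_nonneg[of f] by (simp add: Lp_norm_def sq_integrable_def sq_int_def powr_half_sqrt)
  then have "sqrt (sq_int f) < e"
    using assms by (simp add: ennreal_less_iff sq_int_nonneg)
  then show "sq_int f < e\<^sup>2"
    using power_strict_mono[of "sqrt (sq_int f)" e 2] sq_int_nonneg[of f] by simp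
qed

text \<open>A strict bound on an infimum produces a witness. This is why the estimates on the norms
  below are phrased with a strict inequality.\<close>

lemma D_norm_lessE:
  assumes "D_norm k r f < c"
  obtains G where "\<And>bs. bs \<in> directions k \<Longrightarrow> weak_deriv UNIV bs f (G bs)"
    "Lp_norm r (\<lambda>x. L2_set (\<lambda>bs. norm (G bs x)) (directions k)) < c"
  using assms unfolding D_norm_def INF_less_iff by blast

lemma D_norm_0_less:
  assumes "D_norm 0 2 f < ennreal e"
  shows "sq_integrable f \<and> sq_int f < e\<^sup>2"
proof -
  obtain G where G: "\<And>bs. bs \<in> directions 0 \<Longrightarrow> weak_deriv UNIV bs f (G bs)"
    "Lp_norm 2 (\<lambda>x. L2_set (\<lambda>bs. norm (G bs x)) (directions 0)) < ennreal e"
    using D_norm_lessE[OF assms] by blast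
  have dir0: "directions 0 = {[]}" by (auto simp: directions_def)
  have w: "weak_deriv UNIV [] f (G [])" using G(1) dir0 by simp
  have m: "f \<in> borel_measurable lebesgue"
    using w by (auto simp: weak_deriv_def intro: locally_integrable_measurable)
  have L: "sq_integrable (\<lambda>x. norm (G [] x)) \<and> sq_int (\<lambda>x. norm (G [] x)) < e\<^sup>2"
    using Lp_norm_2_less[OF G(2)] by (simp add: dir0)
  have "AE x in lebesgue. norm (f x) \<le> norm (norm (G [] x))"
    using weak_deriv_Nil_AE_eq[OF w] by eventually_elim simp
  from sq_integrable_bound[OF _ m this] L show ?thesis by auto
qed

lemma D_norm_le_H_norm: "k \<le> s \<Longrightarrow> D_norm k 2 f \<le> H_norm s f"
  unfolding H_norm_def by (rule sum_nonneg_leq_bound[OF _ _ refl]) auto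

lemma H_norm_less: "H_norm s f < ennreal e \<Longrightarrow> sq_integrable f \<and> sq_int f < e\<^sup>2"
  using D_norm_0_less[of f e] D_norm_le_H_norm[of 0 s f] by auto

text \<open>On a cube of volume 1 the elementary bound of \<open>\<bar>g\<bar>\<close> by
  \<open>1 + \<bar>g\<bar>\<^sup>2\<close> replaces the Cauchy-Schwarz inequality. The resulting
  bound is not homogeneous, but only finiteness, uniform in the position of the cube, is
  wanted.\<close>

lemma integral_cube_le:
  assumes "sq_integrable (g :: real^3 \<Rightarrow> real)"
  shows "(LINT x|lebesgue. indicator (cbox p (p + One)) x * \<bar>g x\<bar>) \<le> 1 + sq_int g"
proof -
  let ?Q = "cbox p (p + One) :: (real^3) set"
  have Q: "measure lebesgue ?Q = 1" "emeasure lebesgue ?Q < \<infinity>"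
    using content_cbox[of p "p + One"] emeasure_lborel_cbox_finite[of p "p + One"]
    by (simp_all add: inner_add_left)
  have iQ: "integrable lebesgue (indicator ?Q :: _ \<Rightarrow> real)"
    using Q(2) by (simp add: integrable_indicator_iff)
  have le: "indicator ?Q x * \<bar>g x\<bar> \<le> indicator ?Q x + (norm (g x))\<^sup>2" for x
  proof (cases "x \<in> ?Q")
    case True
    have "\<bar>g x\<bar> \<le> 1 + \<bar>g x\<bar>\<^sup>2"
      using zero_le_power2[of "\<bar>g x\<bar> - 1"] zero_le_power2[of "\<bar>g x\<bar>"]
      by (simp only: power2_diff) simp
    with True show ?thesis by simp
  qed simp
  have "(LINT x|lebesgue. indicator ?Q x * \<bar>g x\<bar>) \<le>
      (LINT x|lebesgue. indicator ?Q x + (norm (g x))\<^sup>2)"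
  proof (rule integral_mono)
    show i: "integrable lebesgue (\<lambda>x. indicator ?Q x + (norm (g x))\<^sup>2)"
      using iQ assms by (simp add: sq_integrable_def)
    have gm: "g \<in> borel_measurable lebesgue" using assms by (simp add: sq_integrable_def)
    show "integrable lebesgue (\<lambda>x. indicator ?Q x * \<bar>g x\<bar>)"
      by (rule Bochner_Integration.integrable_bound[OF i])
        (use gm le in \<open>auto intro!: AE_I2 borel_measurable_times borel_measurable_indicator\<close>)
  qed (rule le)
  also have "\<dots> = 1 + sq_int g"
    using iQ assms Q(1) by (simp add: sq_integrable_def sq_int_def)
  finally show ?thesis .
qed

text \<open>A list of distinct basis vectors of the three-dimensional space has length at most 3,
  which is the reason for the order 3. The constant comes first, so that it can serve all times
  simultaneously.\<close>

proposition H3_AE_bounded: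
  obtains C where "C \<ge> 0" "\<And>f e. H_norm 3 (f :: real^3 \<Rightarrow> real) < ennreal e \<Longrightarrow> AE x in lebesgue. \<bar>f x\<bar> \<le> C * (1 + e\<^sup>2)"
proof -
  obtain C where C: "C \<ge> 1" "\<And>x. \<bar>deriv step x\<bar> \<le> C" using deriv_step_bounded by blast
  have "AE x in lebesgue. \<bar>f x\<bar> \<le> (2 * C) ^ 3 * (1 + e\<^sup>2)"
    if e: "H_norm 3 f < ennreal e" for f :: "real^3 \<Rightarrow> real" and e
  proof -
    define Q where "Q k G \<longleftrightarrow> (\<forall>bs\<in>directions k. weak_deriv UNIV bs f (G bs)) \<and>
        Lp_norm 2 (\<lambda>x. L2_set (\<lambda>bs. norm (G bs x)) (directions k)) < ennreal e"
      for k and G :: "(real^3) list \<Rightarrow> real^3 \<Rightarrow> real"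
    have "\<exists>G. Q k G" if "k \<le> 3" for k
    proof -
      have "D_norm k 2 f < ennreal e" using D_norm_le_H_norm[OF that] e by (rule order_le_less_trans)
      then obtain G where "\<And>bs. bs \<in> directions k \<Longrightarrow> weak_deriv UNIV bs f (G bs)"
        "Lp_norm 2 (\<lambda>x. L2_set (\<lambda>bs. norm (G bs x)) (directions k)) < ennreal e"
        using D_norm_lessE by blast
      then have "Q k G" by (simp add: Q_def)
      then show ?thesis by (rule exI[of "Q k"])
    qed
    then have "\<forall>k\<in>{..3}. \<exists>G. Q k G" by simp
    from bchoice[OF this] obtain G where Q: "\<forall>k\<in>{..3}. Q k (G k)" by blast
    have G: "bs \<in> directions k \<Longrightarrow> weak_deriv UNIV bs f (G k bs)"
      "Lp_norm 2 (\<lambda>x. L2_set (\<lambda>bs. norm (G k bs x)) (directions k)) < ennreal e" if "k \<le> 3" for k bs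
      using Q that by (simp_all add: Q_def)
    have len: "length bs \<le> 3" "bs \<in> directions (length bs)" if "set bs \<subseteq> Basis" "distinct bs" for bs :: "(real^3) list"
    proof -
      have "length bs = card (set bs)" using that(2) by (simp add: distinct_card)
      also have "\<dots> \<le> card (Basis :: (real^3) set)" by (rule card_mono) (use that in auto)
      finally show "length bs \<le> 3" by simp
      show "bs \<in> directions (length bs)" using that by (simp add: directions_def)
    qed
    have "AE x in lebesgue. \<bar>f x\<bar> \<le> (2 * C) ^ DIM(real^3) * (1 + e\<^sup>2)"
    \<comment> \<open>The witnesses for different orders come from separate infima; indexing by the
      length of the list glues them into one family.\<close>
    proof (rule AE_bounded_by_mixed_derivatives[where G = "\<lambda>bs. G (length bs) bs", OF _ C])
      fix bs :: "(real^3) list" assume bs: "set bs \<subseteq> Basis" "distinct bs"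
      let ?k = "length bs" let ?S = "\<lambda>x. L2_set (\<lambda>bs. norm (G ?k bs x)) (directions ?k)"
      show w: "weak_deriv UNIV bs f (G ?k bs)" by (rule G(1)[OF len[OF bs]])
      fix p
      have S: "sq_integrable ?S \<and> sq_int ?S < e\<^sup>2" by (rule Lp_norm_2_less[OF G(2)[OF len(1)[OF bs]]])
      have "finite (directions ?k)"
        unfolding directions_def using finite_lists_length_eq[OF finite_Basis, of ?k]
        by (simp add: conj_commute)
      then have "norm (G ?k bs x) \<le> ?S x" for x
        using member_le_L2_set[of "directions ?k" bs "\<lambda>bs. norm (G ?k bs x)"] len(2)[OF bs] by simp
      then have "AE x in lebesgue. norm (G ?k bs x) \<le> norm (?S x)" by (auto intro!: AE_I2 abs_ge_self order_trans)
      moreover have "G ?k bs \<in> borel_measurable lebesgue"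
        using w by (auto simp: weak_deriv_def intro: locally_integrable_measurable)
      ultimately have "sq_integrable (G ?k bs)" "sq_int (G ?k bs) \<le> sq_int ?S"
        using S by (auto intro: sq_integrable_bound)
      then show "(LINT x|lebesgue. indicator (cbox p (p + One)) x * \<bar>G ?k bs x\<bar>) \<le> 1 + e\<^sup>2"
        using integral_cube_le[of "G ?k bs" p] S by linarith
    qed
    then show ?thesis by simp
  qed
  then show ?thesis using that[of "(2 * C) ^ 3"] C(1) by auto
qed

section \<open>Uniform bounds on a time interval\<close>

text \<open>Compactness of the interval turns local bounds into a global one. The property is
  abstract because it is used both for L^2 norms and for almost everywhere bounds.\<close>

lemma uniform_bound_on_interval:
  fixes P :: "real \<Rightarrow> real \<Rightarrow> bool"
  assumes loc: "\<And>s. s \<in> {0..T} \<Longrightarrow> \<exists>d>0. \<exists>M. \<forall>t\<in>{0..T}. \<bar>t - s\<bar> < d \<longrightarrow> P t M"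
    and mono: "\<And>t M M'. P t M \<Longrightarrow> M \<le> M' \<Longrightarrow> P t M'"
  obtains M where "M \<ge> 1" "\<And>t. t \<in> {0..T} \<Longrightarrow> P t M"
proof -
  obtain d M where d: "\<And>s. s \<in> {0..T} \<Longrightarrow> d s > 0"
    and M: "\<And>s t. s \<in> {0..T} \<Longrightarrow> t \<in> {0..T} \<Longrightarrow> \<bar>t - s\<bar> < d s \<Longrightarrow> P t (M s)"
    using loc by metis
  obtain F where F: "F \<subseteq> {0..T}" "finite F" "{0..T} \<subseteq> (\<Union>s\<in>F. ball s (d s))"
    by (rule compactE_image[of "{0..T}" "{0..T}" "\<lambda>s. ball s (d s)"]) (use d in auto)
  \<comment> \<open>Inserting 1 keeps the maximum meaningful when the interval, and with it
    \<open>F\<close>, is empty.\<close>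
  define B where "B = Max (insert 1 (M ` F))"
  have B: "1 \<le> B" "\<And>s. s \<in> F \<Longrightarrow> M s \<le> B"
    unfolding B_def using F(2) by auto
  show ?thesis
  proof (rule that[OF B(1)])
    fix t assume t: "t \<in> {0..T}"
    then obtain s where s: "s \<in> F" "t \<in> ball s (d s)" using F(3) by blast
    then have "P t (M s)" using M[of s t] F(1) t by (auto simp: dist_real_def abs_minus_commute)
    then show "P t B" using mono B(2)[OF s(1)] by blast
  qed
qed

text \<open>The limit in \<open>C_time\<close> is over a punctured neighbourhood, so
  \<open>t = s\<close> is excluded here and treated as a separate case by the users of this
  lemma.\<close>

lemma C_time_near:
  assumes "C_time T N f" "s \<in> {0..T}" "e > 0"
  obtains d where "d > 0" "\<And>t. t \<in> {0..T} \<Longrightarrow> t \<noteq> s \<Longrightarrow> \<bar>t - s\<bar> < d \<Longrightarrow> N (\<lambda>x. f t x - f s x) < ennreal e"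
proof -
  have "((\<lambda>t. N (\<lambda>x. f t x - f s x)) \<longlongrightarrow> 0) (at s within {0..T})"
    using assms(1,2) by (simp add: C_time_def)
  then have "\<forall>\<^sub>F t in at s within {0..T}. N (\<lambda>x. f t x - f s x) < ennreal e"
    by (rule order_tendstoD) (use assms(3) in simp)
  then show ?thesis unfolding eventually_at using that by (auto simp: dist_real_def)
qed

lemma C_time_finite:
  assumes "C_time T N f" "t \<in> {0..T}"
  obtains e where "e > 0" "N (f t) < ennreal e"
proof -
  have "N (f t) < \<infinity>" using assms by (simp add: C_time_def)
  then obtain c where c: "N (f t) = ennreal c" "c \<ge> 0"
    by (metis ennreal_cases infinity_ennreal_def less_irrefl)
  then show ?thesis using that[of "c + 1"] by (simp add: ennreal_less_iff)
qed

text \<open>An abstract \<open>N\<close> that controls the L^2 norm covers the Sobolev norm of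
  \<open>f\<close> and \<open>u\<close> as well as the plain L^2 norm of the weighted
  gradient.\<close>

lemma C_time_sq_int:
  assumes N: "\<And>g e. N g < ennreal e \<Longrightarrow> sq_integrable g \<and> sq_int g < e\<^sup>2"
    and f: "C_time T N f"
  shows "\<And>t. t \<in> {0..T} \<Longrightarrow> sq_integrable (f t)"
    and "\<exists>M\<ge>1. \<forall>t\<in>{0..T}. sq_int (f t) \<le> M"
    and "\<And>s. s \<in> {0..T} \<Longrightarrow> ((\<lambda>t. sq_int (\<lambda>x. f t x - f s x)) \<longlongrightarrow> 0) (at s within {0..T})"
proof -
  show i: "sq_integrable (f t)" if t: "t \<in> {0..T}" for t
    by (rule C_time_finite[OF f t]) (use N in blast)
  show "\<exists>M\<ge>1. \<forall>t\<in>{0..T}. sq_int (f t) \<le> M"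
  proof (rule uniform_bound_on_interval[of T "\<lambda>t M. sq_int (f t) \<le> M"])
    fix s assume s: "s \<in> {0..T}"
    obtain d where d: "d > 0" "\<And>t. t \<in> {0..T} \<Longrightarrow> t \<noteq> s \<Longrightarrow> \<bar>t - s\<bar> < d \<Longrightarrow> N (\<lambda>x. f t x - f s x) < ennreal 1"
      using C_time_near[OF f s, of 1] by auto
    \<comment> \<open>The first 2 is twice the bound 1 for the difference \<open>f t - f s\<close>,
      from the choice \<open>e = 1\<close> of the neighbourhood.\<close>
    have "sq_int (f t) \<le> 2 + 2 * sq_int (f s)" if t: "t \<in> {0..T}" "\<bar>t - s\<bar> < d" for t
    proof (cases "t = s")
      case True
      then show ?thesis using sq_int_nonneg[of "f s"] by simp
    next
      case False
      from N[OF d(2)[OF t(1) False t(2)]]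
      show ?thesis using sq_integrable_add(2)[of "\<lambda>x. f t x - f s x" "f s"] i[OF s] by simp
    qed
    then show "\<exists>d>0. \<exists>M. \<forall>t\<in>{0..T}. \<bar>t - s\<bar> < d \<longrightarrow> sq_int (f t) \<le> M"
      using d(1) by blast
  qed auto
  show "((\<lambda>t. sq_int (\<lambda>x. f t x - f s x)) \<longlongrightarrow> 0) (at s within {0..T})" if s: "s \<in> {0..T}" for s
  proof (rule tendstoI)
    fix e :: real assume e: "e > 0"
    obtain d where d: "d > 0" "\<And>t. t \<in> {0..T} \<Longrightarrow> t \<noteq> s \<Longrightarrow> \<bar>t - s\<bar> < d \<Longrightarrow> N (\<lambda>x. f t x - f s x) < ennreal (sqrt e)"
      using C_time_near[OF f s, of "sqrt e"] e by auto
    show "\<forall>\<^sub>F t in at s within {0..T}. dist (sq_int (\<lambda>x. f t x - f s x)) 0 < e"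
      unfolding eventually_at
      using d e N[OF d(2)] sq_int_nonneg by (intro exI[of _ d]) (auto simp: dist_real_def abs_of_nonneg[OF sq_int_nonneg])
  qed
qed

lemma C_time_H_norm_sq_int:
  assumes "C_time T (H_norm k) f"
  shows "\<And>t. t \<in> {0..T} \<Longrightarrow> sq_integrable (f t)"
    and "\<exists>M\<ge>1. \<forall>t\<in>{0..T}. sq_int (f t) \<le> M"
    and "\<And>s. s \<in> {0..T} \<Longrightarrow> ((\<lambda>t. sq_int (\<lambda>x. f t x - f s x)) \<longlongrightarrow> 0) (at s within {0..T})"
  by (rule C_time_sq_int[of "H_norm k"]; (rule assms | erule H_norm_less | assumption))+

lemma C_time_L2_sq_int:
  assumes "C_time T (Lp_norm 2) f"
  shows "\<And>t. t \<in> {0..T} \<Longrightarrow> sq_integrable (f t)"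
    and "\<exists>M\<ge>1. \<forall>t\<in>{0..T}. sq_int (f t) \<le> M"
  by (rule C_time_sq_int[of "Lp_norm 2"]; (rule assms | erule Lp_norm_2_less | assumption))+

lemma C_time_H3_bounded:
  fixes f :: "real \<Rightarrow> real^3 \<Rightarrow> real"
  assumes f: "C_time T (H_norm 3) f"
  obtains K where "K \<ge> 1" "\<And>t. t \<in> {0..T} \<Longrightarrow> AE x in lebesgue. \<bar>f t x\<bar> \<le> K"
proof -
  obtain C where C: "C \<ge> 0" "\<And>f e. H_norm 3 (f :: real^3 \<Rightarrow> real) < ennreal e \<Longrightarrow> AE x in lebesgue. \<bar>f x\<bar> \<le> C * (1 + e\<^sup>2)"
    using H3_AE_bounded by blast
  show ?thesis
  proof (rule uniform_bound_on_interval[of T "\<lambda>t M. AE x in lebesgue. \<bar>f t x\<bar> \<le> M"])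
    fix s assume s: "s \<in> {0..T}"
    obtain d where d: "d > 0" "\<And>t. t \<in> {0..T} \<Longrightarrow> t \<noteq> s \<Longrightarrow> \<bar>t - s\<bar> < d \<Longrightarrow> H_norm 3 (\<lambda>x. f t x - f s x) < ennreal 1"
      using C_time_near[OF f s, of 1] by auto
    obtain e where "H_norm 3 (f s) < ennreal e" using C_time_finite[OF f s] by blast
    then have fs: "AE x in lebesgue. \<bar>f s x\<bar> \<le> C * (1 + e\<^sup>2)" by (rule C(2))
    \<comment> \<open>The summand \<open>C * 2\<close> is \<open>C * (1 + 1)\<close>, the sup bound
      for the difference, whose norm is below 1.\<close>
    have "AE x in lebesgue. \<bar>f t x\<bar> \<le> C * (1 + e\<^sup>2) + C * 2" if t: "t \<in> {0..T}" "\<bar>t - s\<bar> < d" for t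
    proof (cases "t = s")
      case True
      then show ?thesis using fs C(1) by auto
    next
      case False
      from C(2)[OF d(2)[OF t(1) False t(2)]] fs show ?thesis by eventually_elim auto
    qed
    then show "\<exists>d>0. \<exists>M. \<forall>t\<in>{0..T}. \<bar>t - s\<bar> < d \<longrightarrow> (AE x in lebesgue. \<bar>f t x\<bar> \<le> M)"
      using d(1) by blast
  next
    show "AE x in lebesgue. \<bar>f t x\<bar> \<le> M'" if "AE x in lebesgue. \<bar>f t x\<bar> \<le> M" "M \<le> M'" for t M M'
      using that(1) by eventually_elim (use that(2) in simp)
  qed (use that in blast)
qed

section \<open>Conservation laws on the slab\<close>

text \<open>Fubini's theorem is applied to a Borel representative \<open>g'\<close>, because
  Lebesgue measure on a product is the completion of the product measure. Almost every slice of
  \<open>g'\<close> agrees almost everywhere with the slice of \<open>g\<close>. The integrable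
  majorant \<open>h\<close> of the inner integrals gives joint integrability by Tonelli.\<close>

lemma Fubini_lebesgue:
  fixes g :: "'a::euclidean_space \<times> 'b::euclidean_space \<Rightarrow> real"
  assumes m: "g \<in> borel_measurable lebesgue"
    and i: "\<And>t. integrable lebesgue (\<lambda>x. g (t, x))"
    and bd: "\<And>t. (LINT x|lebesgue. \<bar>g (t, x)\<bar>) \<le> h t" and h: "integrable lborel h"
  shows "integrable lebesgue g"
    and "(LINT t|lebesgue. LINT x|lebesgue. g (t, x)) = integral\<^sup>L lebesgue g"
proof -
  obtain g' where g'[measurable]: "g' \<in> borel_measurable lborel" and AE: "AE z in lborel. g z = g' z"
    using completion_ex_borel_measurable_real[OF m] by blast
  have AE2: "AE t in lborel. AE x in lborel. g (t, x) = g' (t, x)"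
    using AE unfolding lborel_prod[symmetric] by (rule lborel_pair.AE_pair)
  have g'p[measurable]: "g' \<in> borel_measurable (lborel \<Otimes>\<^sub>M lborel)"
    using g' by (simp add: lborel_prod)
  have slice: "(\<lambda>x. g' (t, x)) \<in> borel_measurable lborel" for t by measurable
  have AE3: "AE t in lborel. (LINT x|lebesgue. g (t, x)) = (LINT x|lborel. g' (t, x)) \<and>
      (\<integral>\<^sup>+x. ennreal \<bar>g' (t, x)\<bar> \<partial>lborel) \<le> ennreal (h t)"
    using AE2
  proof eventually_elim
    case (elim t)
    then have e: "AE x in lebesgue. g (t, x) = g' (t, x)" by (rule AE_completion)
    have "(LINT x|lebesgue. g (t, x)) = (LINT x|lebesgue. g' (t, x))"
      using i[of t] slice[of t] e by (intro integral_cong_AE) (auto intro: measurable_completion)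
    moreover have "(\<integral>\<^sup>+x. ennreal \<bar>g' (t, x)\<bar> \<partial>lborel) = (\<integral>\<^sup>+x. ennreal \<bar>g' (t, x)\<bar> \<partial>lebesgue)"
      by (rule nn_integral_completion[symmetric])
    moreover have "\<dots> = (\<integral>\<^sup>+x. ennreal \<bar>g (t, x)\<bar> \<partial>lebesgue)"
      by (rule nn_integral_cong_AE) (use e in eventually_elim, simp)
    moreover have "\<dots> = ennreal (LINT x|lebesgue. \<bar>g (t, x)\<bar>)"
      using i[of t] by (intro nn_integral_eq_integral) auto
    ultimately show ?case
      using bd[of t] slice[of t] by (auto simp: integral_completion ennreal_leI)
  qed
  have ig': "integrable (lborel \<Otimes>\<^sub>M lborel) g'"
    unfolding integrable_iff_bounded
  proof
    have "(\<integral>\<^sup>+z. ennreal (norm (g' z)) \<partial>(lborel \<Otimes>\<^sub>M lborel)) =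
        (\<integral>\<^sup>+t. \<integral>\<^sup>+x. ennreal \<bar>g' (t, x)\<bar> \<partial>lborel \<partial>lborel)"
      using lborel.nn_integral_fst[of "\<lambda>z. ennreal (norm (g' z))" lborel] by simp
    also have "\<dots> \<le> (\<integral>\<^sup>+t. ennreal (h t) \<partial>lborel)"
      by (rule nn_integral_mono_AE) (use AE3 in eventually_elim, simp)
    also have "\<dots> \<le> (\<integral>\<^sup>+t. ennreal (norm (h t)) \<partial>lborel)"
      by (intro nn_integral_mono ennreal_leI) simp
    also have "\<dots> < \<infinity>"
      using h unfolding integrable_iff_bounded by blast
    finally show "(\<integral>\<^sup>+z. ennreal (norm (g' z)) \<partial>(lborel \<Otimes>\<^sub>M lborel)) < \<infinity>" .
  qed (rule g'p)
  have AEl: "AE z in lebesgue. g z = g' z" using AE by (rule AE_completion)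
  have ml: "g' \<in> borel_measurable lebesgue" using g' by (rule measurable_completion)
  have "integrable lebesgue g'" using ig' g' by (simp add: integrable_completion lborel_prod)
  then show "integrable lebesgue g"
    using integrable_cong_AE[OF m ml AEl] by blast
  have "integral\<^sup>L lebesgue g = integral\<^sup>L lebesgue g'" by (rule integral_cong_AE[OF m ml AEl])
  also have "\<dots> = integral\<^sup>L (lborel \<Otimes>\<^sub>M lborel) g'"
    using g' by (simp add: integral_completion lborel_prod)
  also have "\<dots> = (LINT t|lborel. LINT x|lborel. g' (t, x))"
    by (rule lborel_pair.integral_fst'[OF ig', symmetric])
  also have "\<dots> = (LINT t|lebesgue. LINT x|lborel. g' (t, x))"
    by (rule integral_completion[symmetric]) measurable
  also have "\<dots> = (LINT t|lebesgue. LINT x|lebesgue. g (t, x))"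
  \<comment> \<open>Measurability in \<open>t\<close> of the inner integral of \<open>g\<close> is
    inherited from \<open>g'\<close> through completeness.\<close>
  proof (rule integral_cong_AE)
    show 1: "(\<lambda>t. LINT x|lborel. g' (t, x)) \<in> borel_measurable lebesgue"
      by (rule measurable_completion) measurable
    have ae: "AE t in lebesgue. (LINT x|lborel. g' (t, x)) = (LINT x|lebesgue. g (t, x))"
      by (rule AE_completion) (use AE3 in eventually_elim, simp)
    then show "(\<lambda>t. LINT x|lebesgue. g (t, x)) \<in> borel_measurable lebesgue"
      by (rule borel_measurable_AE[OF 1])
    show "AE t in lebesgue. (LINT x|lborel. g' (t, x)) = (LINT x|lebesgue. g (t, x))" by (rule ae)
  qed
  finally show "(LINT t|lebesgue. LINT x|lebesgue. g (t, x)) = integral\<^sup>L lebesgue g" ..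
qed

lemma indicator_slab: "indicator (slab T) (t, x) = (indicator {0<..<T} t :: real)"
  by (auto simp: indicator_def)

text \<open>Local integrability on the open slab supplies joint measurability only: it controls
  nothing near spatial infinity or near the end times. Integrability comes from the uniform bound on
  the slices.\<close>

lemma slab_integrable:
  fixes F :: "real \<Rightarrow> real^3 \<Rightarrow> real"
  assumes li: "locally_integrable (slab T) (\<lambda>(t, x). F t x)"
    and i: "\<And>t. 0 < t \<Longrightarrow> t < T \<Longrightarrow> integrable lebesgue (F t)"
    and bd: "\<And>t. 0 < t \<Longrightarrow> t < T \<Longrightarrow> (LINT x|lebesgue. \<bar>F t x\<bar>) \<le> M"
    and \<theta>: "\<theta> \<in> borel_measurable borel" "\<And>t. \<bar>\<theta> t\<bar> \<le> B"
  shows "integrable lebesgue (\<lambda>(t, x). indicator {0<..<T} t * F t x * \<theta> t)"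
    and "(LINT (t, x)|lebesgue. indicator {0<..<T} t * F t x * \<theta> t) =
      (LINT t|lebesgue. indicator {0<..<T} t * \<theta> t * (LINT x|lebesgue. F t x))"
proof -
  let ?g = "\<lambda>(t, x). indicator {0<..<T} t * F t x * \<theta> t"
  have "open (slab T)" by (simp add: open_Times)
  then have 1: "(\<lambda>z. indicator (slab T) z *\<^sub>R (case z of (t, x) \<Rightarrow> F t x)) \<in> borel_measurable lebesgue"
    using li by (rule locally_integrable_indicator_measurable)
  have "(\<lambda>z :: real \<times> (real^3). \<theta> (fst z)) \<in> borel_measurable borel"
    using \<theta>(1) by (intro measurable_compose[OF _ \<theta>(1)] borel_measurable_continuous_onI continuous_intros)
  then have 2: "(\<lambda>z :: real \<times> (real^3). \<theta> (fst z)) \<in> borel_measurable lebesgue"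
    by (simp add: measurable_completion)
  have m: "?g \<in> borel_measurable lebesgue"
    using borel_measurable_times[OF 1[unfolded real_scaleR_def] 2]
    by (rule measurable_cong[THEN iffD1, rotated]) (auto simp: indicator_slab split_beta)
  have ii: "integrable lebesgue (\<lambda>x. ?g (t, x))" for t
    using i[of t] by (cases "0 < t \<and> t < T") auto
  have bdd: "(LINT x|lebesgue. \<bar>?g (t, x)\<bar>) \<le> indicator {0<..<T} t * (M * B)" for t
  proof (cases "0 < t \<and> t < T")
    case True
    have "(LINT x|lebesgue. \<bar>F t x\<bar>) * \<bar>\<theta> t\<bar> \<le> M * B"
    proof (rule mult_mono)
      have "0 \<le> (LINT x|lebesgue. \<bar>F t x\<bar>)" by simp
      then show "0 \<le> M" using bd[of t] True by linarith
    qed (use bd[of t] \<theta>(2)[of t] True in auto)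
    then show ?thesis using True by (simp add: abs_mult)
  qed auto
  have h: "integrable lborel (\<lambda>t. indicator {0<..<T} t * (M * B) :: real)"
    by (intro integrable_mult_left integrable_real_indicator) (use emeasure_bounded_finite[of "{0<..<T}"] in auto)
  show "integrable lebesgue ?g" by (rule Fubini_lebesgue(1)[OF m ii bdd h])
  have "(LINT (t, x)|lebesgue. indicator {0<..<T} t * F t x * \<theta> t) = (LINT t|lebesgue. LINT x|lebesgue. ?g (t, x))"
    by (rule Fubini_lebesgue(2)[OF m ii bdd h, symmetric])
  also have "\<dots> = (LINT t|lebesgue. indicator {0<..<T} t * \<theta> t * (LINT x|lebesgue. F t x))"
    by (intro Bochner_Integration.integral_cong) auto
  finally show "(LINT (t, x)|lebesgue. indicator {0<..<T} t * F t x * \<theta> t) =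
      (LINT t|lebesgue. indicator {0<..<T} t * \<theta> t * (LINT x|lebesgue. F t x))" .
qed

text \<open>The product over the basis is \<open>\<theta>(t)\<close> times a spatial cutoff that equals 1 on the cube of side \<open>2n\<close>.\<close>

definition cutoff_factor :: "(real \<Rightarrow> real) \<Rightarrow> nat \<Rightarrow> real \<times> (real^3) \<Rightarrow> real \<Rightarrow> real" where
  "cutoff_factor \<theta> n b = (if b = time_dir then \<theta> else (\<lambda>y. step (y + (real n + 1)) * step (- y + (real n + 1))))"

definition cutoff :: "(real \<Rightarrow> real) \<Rightarrow> nat \<Rightarrow> real \<times> (real^3) \<Rightarrow> real" where
  "cutoff \<theta> n z = (\<Prod>b\<in>Basis. cutoff_factor \<theta> n b (z \<bullet> b))"

lemma time_dir_Basis: "time_dir \<in> Basis" and space_dir_Basis: "space_dir j \<in> Basis"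
  by (auto simp: Basis_prod_def axis_in_Basis_iff)

lemma smooth_cutoff_factor: "smooth \<theta> \<Longrightarrow> smooth (cutoff_factor \<theta> n b)"
proof -
  have "smooth (\<lambda>y. step (1 * y + (real n + 1)) * step (- 1 * y + (real n + 1)))"
    by (intro smooth_mult smooth_step_affine)
  then show "smooth \<theta> \<Longrightarrow> smooth (cutoff_factor \<theta> n b)" by (simp add: cutoff_factor_def)
qed

lemma cutoff_test_function:
  assumes \<theta>: "smooth \<theta>" "\<And>t. t \<notin> {a..b} \<Longrightarrow> \<theta> t = 0" and ab: "0 < a" "b < T"
  shows "cutoff \<theta> n \<in> test_functions (slab T)"
  unfolding cutoff_def[abs_def]
proof (rule prod_in_test_functions)
  let ?p = "(a, - (real n + 1) *\<^sub>R One) :: real \<times> (real^3)" and ?q = "(b, (real n + 1) *\<^sub>R One) :: real \<times> (real^3)"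
  show "smooth (cutoff_factor \<theta> n c)" for c by (rule smooth_cutoff_factor[OF \<theta>(1)])
  show "cutoff_factor \<theta> n c y = 0" if c: "c \<in> Basis" and y: "y \<notin> {?p \<bullet> c..?q \<bullet> c}" for c y
  proof (cases "c = time_dir")
    case True
    then show ?thesis using y \<theta>(2)[of y] by (simp add: cutoff_factor_def)
  next
    case False
    then obtain v where "c = (0, v)" "v \<in> Basis" using c by (auto simp: Basis_prod_def)
    then have "y + (real n + 1) \<le> 0 \<or> - y + (real n + 1) \<le> 0" using y by auto
    then show ?thesis using False step(2) by (auto simp: cutoff_factor_def)
  qed
  show "cbox ?p ?q \<subseteq> slab T"
    using ab by (auto simp: cbox_Pair_eq)
qed

text \<open>Enlarging \<open>n\<close> only translates the two ramps, so their slopes are bounded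
  independently of \<open>n\<close>; the product of two ramps accounts for \<open>2 * C\<close>.
  This uniform \<open>B\<close> makes dominated convergence possible.\<close>

lemma cutoff_deriv_bounds:
  assumes \<theta>: "smooth \<theta>" "\<And>t. t \<notin> {a..b} \<Longrightarrow> \<theta> t = 0"
  obtains B where "B \<ge> 1" "\<And>n c y. \<bar>cutoff_factor \<theta> n c y\<bar> \<le> B" "\<And>n c y. \<bar>deriv (cutoff_factor \<theta> n c) y\<bar> \<le> B"
proof -
  obtain C where C: "C \<ge> 1" "\<And>x. \<bar>deriv step x\<bar> \<le> C" using deriv_step_bounded by blast
  have "compact (\<theta> ` {a..b})" "compact (deriv \<theta> ` {a..b})"
    by (intro compact_continuous_image smooth_continuous smooth_real_deriv \<theta>; simp)+
  then obtain B1 B2 where B: "\<And>x. x \<in> {a..b} \<Longrightarrow> \<bar>\<theta> x\<bar> \<le> B1" "\<And>x. x \<in> {a..b} \<Longrightarrow> \<bar>deriv \<theta> x\<bar> \<le> B2"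
    using compact_imp_bounded bounded_iff by (metis imageI real_norm_def)
  define D where "D = max (2 * C) (max B1 B2)"
  have D: "D \<ge> 1" "D \<ge> 2 * C" "D \<ge> B1" "D \<ge> B2" using C(1) by (auto simp: D_def)
  have t0: "\<bar>\<theta> y\<bar> \<le> D" for y
    using B(1)[of y] \<theta>(2)[of y] D by (cases "y \<in> {a..b}") auto
  have t1: "\<bar>deriv \<theta> y\<bar> \<le> D" for y
  proof (cases "y \<in> {a..b}")
    case False
    have "deriv \<theta> y = 0" by (rule deriv_eq_0_outside[OF _ False]) (rule \<theta>(2))
    then show ?thesis using D by simp
  qed (use B(2)[of y] D in linarith)
  let ?\<zeta> = "\<lambda>n y. step (y + (real n + 1)) * step (- y + (real n + 1))"
  have z0: "\<bar>?\<zeta> n y\<bar> \<le> D" for n y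
  proof -
    have "\<bar>?\<zeta> n y\<bar> \<le> 1" using step(4,5) by (simp add: abs_mult mult_le_one)
    then show ?thesis using D(1) by linarith
  qed
  have z1: "\<bar>deriv (?\<zeta> n) y\<bar> \<le> D" for n y
  proof -
    have d: "(step has_real_derivative deriv step x) (at x)" for x
      by (rule smooth_real_deriv(1)[OF step(1)])
    have "((\<lambda>y. step (y + (real n + 1))) has_real_derivative deriv step (y + (real n + 1)) * 1) (at y)"
      by (rule DERIV_chain2[OF d]) (auto intro!: derivative_eq_intros)
    moreover have "((\<lambda>y. step (- y + (real n + 1))) has_real_derivative deriv step (- y + (real n + 1)) * - 1) (at y)"
      by (rule DERIV_chain2[OF d]) (auto intro!: derivative_eq_intros)
    ultimately have "(?\<zeta> n has_real_derivative
        deriv step (y + (real n + 1)) * 1 * step (- y + (real n + 1)) +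
        deriv step (- y + (real n + 1)) * - 1 * step (y + (real n + 1))) (at y)"
      by (rule DERIV_mult)
    then have "deriv (?\<zeta> n) y = deriv step (y + (real n + 1)) * step (- y + (real n + 1)) -
        deriv step (- y + (real n + 1)) * step (y + (real n + 1))"
      by (simp add: DERIV_imp_deriv)
    also have "\<bar>\<dots>\<bar> \<le> \<bar>deriv step (y + (real n + 1)) * step (- y + (real n + 1))\<bar> +
        \<bar>deriv step (- y + (real n + 1)) * step (y + (real n + 1))\<bar>"
      by (rule abs_triangle_ineq4)
    also have "\<dots> \<le> C * 1 + C * 1"
      unfolding abs_mult using step(4,5) C by (intro add_mono mult_mono) auto
    finally show ?thesis using D(2) by simp
  qed
  show ?thesis
    by (rule that[OF D(1)]) (use t0 t1 z0 z1 in \<open>auto simp: cutoff_factor_def\<close>)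
qed

text \<open>The derivative does not become uniformly small: it vanishes in the limit because every
  fixed point is eventually inside the flat part.\<close>

lemma cutoff_factor_tendsto:
  assumes "c \<noteq> time_dir"
  shows "(\<lambda>n. cutoff_factor \<theta> n c y) \<longlonglongrightarrow> 1" "(\<lambda>n. deriv (cutoff_factor \<theta> n c) y) \<longlonglongrightarrow> 0"
proof -
  obtain m where m: "real m > \<bar>y\<bar>" using reals_Archimedean2 by blast
  have one: "cutoff_factor \<theta> n c x = 1" if "x \<in> {- real n<..<real n}" for n x
    using that assms step(3) by (simp add: cutoff_factor_def)
  have y: "y \<in> {- real n<..<real n}" if "n \<ge> m" for n using m that by auto
  then have "\<forall>\<^sub>F n in sequentially. cutoff_factor \<theta> n c y = 1"
    using one by (intro eventually_sequentiallyI[of m]) blast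
  then show "(\<lambda>n. cutoff_factor \<theta> n c y) \<longlonglongrightarrow> 1" by (rule tendsto_eventually)
  have "deriv (cutoff_factor \<theta> n c) y = 0" if "n \<ge> m" for n
  proof -
    have "((\<lambda>x. 1) has_real_derivative 0) (at y)" by simp
    then have "(cutoff_factor \<theta> n c has_real_derivative 0) (at y)"
      by (rule has_field_derivative_transform_within_open[of _ _ _ "{- real n<..<real n}"])
        (use y[OF that] one in auto)
    then show ?thesis by (rule DERIV_imp_deriv)
  qed
  then have "\<forall>\<^sub>F n in sequentially. deriv (cutoff_factor \<theta> n c) y = 0"
    by (intro eventually_sequentiallyI[of m]) blast
  then show "(\<lambda>n. deriv (cutoff_factor \<theta> n c) y) \<longlonglongrightarrow> 0" by (rule tendsto_eventually)
qed

text \<open>Dominated convergence with a constant multiple of the integrable \<open>F\<close> as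
  majorant. A spatial derivative hits one of the cutoff factors and tends to 0; a time derivative
  hits \<theta>, and the cutoff factors tend to 1.\<close>

lemma dist_deriv_cutoff_tendsto:
  fixes F :: "real \<Rightarrow> real^3 \<Rightarrow> real"
  assumes li: "locally_integrable (slab T) (\<lambda>(t, x). F t x)"
    and i: "\<And>t. 0 < t \<Longrightarrow> t < T \<Longrightarrow> integrable lebesgue (F t)"
    and bd: "\<And>t. 0 < t \<Longrightarrow> t < T \<Longrightarrow> (LINT x|lebesgue. \<bar>F t x\<bar>) \<le> M"
    and \<theta>: "smooth \<theta>" "\<And>t. t \<notin> {a..b} \<Longrightarrow> \<theta> t = 0" and ab: "0 < a" "b < T"
    and c: "c \<in> Basis"
  shows "(\<lambda>n. dist_deriv c (\<lambda>(t, x). F t x) (cutoff \<theta> n)) \<longlonglongrightarrow>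
    (if c = time_dir then - (LINT t|lebesgue. indicator {0<..<T} t * deriv \<theta> t * (LINT x|lebesgue. F t x)) else 0)"
proof -
  obtain B where B: "B \<ge> 1" "\<And>n c y. \<bar>cutoff_factor \<theta> n c y\<bar> \<le> B" "\<And>n c y. \<bar>deriv (cutoff_factor \<theta> n c) y\<bar> \<le> B"
    using cutoff_deriv_bounds[OF \<theta>] by blast
  let ?d = "\<lambda>n z. \<Prod>b\<in>Basis. (if b = c then deriv (cutoff_factor \<theta> n b) else cutoff_factor \<theta> n b) (z \<bullet> b)"
  have pd: "partial_derivs [c] (cutoff \<theta> n) = ?d n" for n
    unfolding cutoff_def[abs_def]
    by (subst partial_derivs_prod) (use c smooth_cutoff_factor[OF \<theta>(1)] in auto)
  have dsm: "smooth (?d n)" for n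
    by (intro smooth_prod smooth_inner_comp) (auto intro: smooth_cutoff_factor \<theta>(1) smooth_real_deriv)
  have d_bd: "\<bar>?d n z\<bar> \<le> B ^ DIM(real \<times> (real^3))" for n z
  proof -
    have "\<bar>?d n z\<bar> \<le> (\<Prod>b\<in>(Basis :: (real \<times> (real^3)) set). B)"
      unfolding abs_prod using B by (intro prod_mono) auto
    then show ?thesis by simp
  qed
  \<comment> \<open>\<open>F\<close> is arbitrary outside the slab, whereas
    \<open>dist_deriv\<close> integrates over all of space-time. Since the test function vanishes
    there, the indicator of the slab may be inserted.\<close>
  have d0: "?d n z = 0" if "fst z \<notin> {0<..<T}" for n and z :: "real \<times> (real^3)"
  proof (rule prod_zero)
    have ab': "fst z \<notin> {a..b}" using that ab by auto
    have "\<theta> (fst z) = 0" by (rule \<theta>(2)[OF ab'])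
    moreover have "deriv \<theta> (fst z) = 0" by (rule deriv_eq_0_outside[OF _ ab']) (rule \<theta>(2))
    ultimately show "\<exists>b\<in>Basis. (if b = c then deriv (cutoff_factor \<theta> n b) else cutoff_factor \<theta> n b) (z \<bullet> b) = 0"
      using time_dir_Basis by (intro bexI[of _ time_dir]) (auto simp: cutoff_factor_def inner_prod_def)
  qed simp
  define L where "L z = (if c = time_dir then deriv \<theta> (fst z) else 0)" for z :: "real \<times> (real^3)"
  have lim: "(\<lambda>n. ?d n z) \<longlonglongrightarrow> L z" for z
  proof -
    have "(\<lambda>n. ?d n z) \<longlonglongrightarrow> (\<Prod>b\<in>Basis. if b = c then (if b = time_dir then deriv \<theta> (z \<bullet> b) else 0)
        else if b = time_dir then \<theta> (z \<bullet> b) else 1)"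
    proof (rule tendsto_prod)
      fix b :: "real \<times> (real^3)"
      show "(\<lambda>n. (if b = c then deriv (cutoff_factor \<theta> n b) else cutoff_factor \<theta> n b) (z \<bullet> b)) \<longlonglongrightarrow>
        (if b = c then (if b = time_dir then deriv \<theta> (z \<bullet> b) else 0) else if b = time_dir then \<theta> (z \<bullet> b) else 1)"
      proof (cases "b = time_dir")
        case True
        then show ?thesis by (simp add: cutoff_factor_def)
      next
        case False
        then show ?thesis using cutoff_factor_tendsto[OF False] by (cases "b = c") auto
      qed
    qed
    also have "(\<Prod>b\<in>Basis. if b = c then (if b = time_dir then deriv \<theta> (z \<bullet> b) else 0)
        else if b = time_dir then \<theta> (z \<bullet> b) else 1) = L z"
    proof (cases "c = time_dir")
      case True
      then have "(\<Prod>b\<in>Basis. if b = c then (if b = time_dir then deriv \<theta> (z \<bullet> b) else 0)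
        else if b = time_dir then \<theta> (z \<bullet> b) else 1) = (\<Prod>b\<in>Basis. if b = c then deriv \<theta> (z \<bullet> c) else 1)"
        by (intro prod.cong) auto
      also have "\<dots> = L z" using c True by (simp add: L_def inner_prod_def)
      finally show ?thesis .
    next
      case False
      then show ?thesis unfolding L_def using c by (auto intro!: prod_zero)
    qed
    finally show ?thesis .
  qed
  have int: "integrable lebesgue (\<lambda>(t, x). indicator {0<..<T} t * F t x * 1)"
    using slab_integrable(1)[OF li i bd, of "\<lambda>_. 1" 1] by simp
  have dth: "deriv \<theta> \<in> borel_measurable borel" "\<And>t. \<bar>deriv \<theta> t\<bar> \<le> B"
    using smooth_real_deriv(2)[OF \<theta>(1)] B(3)[of _ time_dir]
    by (auto intro: smooth_measurable simp: cutoff_factor_def)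
  let ?E = "\<lambda>z. case z of (t, x) \<Rightarrow> indicator {0<..<T} t * F t x * 1"
  have "(\<lambda>n. LINT z|lebesgue. ?E z * ?d n z) \<longlonglongrightarrow> (LINT z|lebesgue. ?E z * L z)"
  proof (rule integral_dominated_convergence[where w = "\<lambda>z. \<bar>?E z\<bar> * B ^ DIM(real \<times> (real^3))"])
    have Em: "?E \<in> borel_measurable lebesgue" using int by (rule borel_measurable_integrable)
    have dm: "?d n \<in> borel_measurable lebesgue" for n
      using smooth_measurable[OF dsm] by (simp add: measurable_completion)
    show "(\<lambda>z. ?E z * ?d n z) \<in> borel_measurable lebesgue" for n
      using Em dm by (rule borel_measurable_times)
    have "L \<in> borel_measurable lebesgue"
      by (rule borel_measurable_LIMSEQ_metric[OF dm lim])
    with Em show "(\<lambda>z. ?E z * L z) \<in> borel_measurable lebesgue" by (rule borel_measurable_times)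
    show "integrable lebesgue (\<lambda>z. \<bar>?E z\<bar> * B ^ DIM(real \<times> (real^3)))"
      using int by (intro integrable_mult_left integrable_abs)
    show "AE z in lebesgue. (\<lambda>n. ?E z * ?d n z) \<longlonglongrightarrow> ?E z * L z"
      by (intro AE_I2 tendsto_mult_left lim)
    show "AE z in lebesgue. norm (?E z * ?d n z) \<le> \<bar>?E z\<bar> * B ^ DIM(real \<times> (real^3))" for n
      unfolding real_norm_def abs_mult by (intro AE_I2 mult_left_mono d_bd) auto
  qed
  moreover have "(LINT z|lebesgue. ?E z * ?d n z) = - dist_deriv c (\<lambda>(t, x). F t x) (cutoff \<theta> n)" for n
    unfolding dist_deriv_def pd minus_minus
  proof (rule Bochner_Integration.integral_cong)
    fix z :: "real \<times> (real^3)"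
    obtain t x where z: "z = (t, x)" by (cases z)
    show "?E z * ?d n z = (case z of (t, x) \<Rightarrow> F t x) * ?d n z"
      using d0[of z n] by (cases "t \<in> {0<..<T}") (simp_all add: z)
  qed simp
  moreover have "(LINT z|lebesgue. ?E z * L z) =
      (if c = time_dir then (LINT t|lebesgue. indicator {0<..<T} t * deriv \<theta> t * (LINT x|lebesgue. F t x)) else 0)"
  proof (cases "c = time_dir")
    case True
    have "(LINT z|lebesgue. ?E z * L z) = (LINT (t, x)|lebesgue. indicator {0<..<T} t * F t x * deriv \<theta> t)"
      by (intro Bochner_Integration.integral_cong) (auto simp: L_def True)
    also have "\<dots> = (LINT t|lebesgue. indicator {0<..<T} t * deriv \<theta> t * (LINT x|lebesgue. F t x))"
      by (rule slab_integrable(2)[OF li i bd dth])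
    finally show ?thesis using True by simp
  qed (simp add: L_def)
  ultimately have "(\<lambda>n. - dist_deriv c (\<lambda>(t, x). F t x) (cutoff \<theta> n)) \<longlonglongrightarrow>
      (if c = time_dir then (LINT t|lebesgue. indicator {0<..<T} t * deriv \<theta> t * (LINT x|lebesgue. F t x)) else 0)"
    by simp
  from tendsto_minus[OF this] show ?thesis by (simp split: if_splits)
qed

text \<open>Testing with \<open>\<theta>(t) = \<Phi>(t) - \<Phi>(t - d)\<close>, where \<open>\<Phi>'\<close> approximates the indicator of
  \<open>[p, p + h]\<close>, shows that the integral of \<open>Q\<close> over an interval of length \<open>h\<close> does not depend on
  the position of the interval.\<close>

lemma weakly_constant_imp_constant:
  fixes Q :: "real \<Rightarrow> real"
  assumes cont: "continuous_on {0..T} Q"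
    and weak: "\<And>\<theta> a b. smooth \<theta> \<Longrightarrow> (\<And>t. t \<notin> {a..b} \<Longrightarrow> \<theta> t = 0) \<Longrightarrow> 0 < a \<Longrightarrow> b < T \<Longrightarrow>
      (LINT t|lebesgue. indicator {0<..<T} t * deriv \<theta> t * Q t) = 0"
    and st: "s \<in> {0..T}" "t \<in> {0..T}"
  shows "Q s = Q t"
proof (cases "s = t")
  case False
  then have T: "0 < T" using st by auto
  \<comment> \<open>The restriction to the open interval, extended by 0, is locally integrable on
    the whole line, as the plateau approximation requires.\<close>
  define q where "q t = indicator {0<..<T} t *\<^sub>R Q t" for t
  have iQ: "integrable lebesgue (\<lambda>t. indicator {0..T} t *\<^sub>R Q t)"
    using absolutely_integrable_continuous_real[OF cont] by (simp add: set_integrable_def)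
  have "set_integrable lebesgue {0<..<T} Q"
    by (rule set_integrable_subset[of lebesgue "{0..T}"])
      (use iQ in \<open>auto simp: set_integrable_def\<close>)
  then have iq: "integrable lebesgue q" unfolding q_def[abs_def] set_integrable_def .
  have li: "locally_integrable UNIV q"
    unfolding locally_integrable_def set_integrable_def
    by (intro allI impI integrable_mult_indicator[OF _ iq]) (auto intro: lmeasurable_compact fmeasurableD)
  have shift: "integral {y..y + h} Q = integral {z..z + h} Q"
    if "0 < y" "y \<le> z" "0 < h" "z + h < T" for y z h
  proof -
    define d where "d = z - y"
    have "(LINT t|lebesgue. plateau y (y + h) n t * q t) = (LINT t|lebesgue. plateau z (z + h) n t * q t)" for n
    proof -
      let ?a = "plateau y (y + h) n"
      obtain \<Phi> where \<Phi>: "smooth \<Phi>" "\<And>x. (\<Phi> has_real_derivative ?a x) (at x)"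
        using smooth_antiderivative[OF smooth_plateau] by blast
      have left: "\<Phi> x = \<Phi> y" if "x \<le> y" for x
      proof (cases "x = y")
        case False
        then have xp: "x < y" using that by simp
        have "continuous_on {x..y} \<Phi>" by (rule smooth_continuous[OF \<Phi>(1)])
        then show ?thesis
          by (rule DERIV_isconst_end[OF xp, symmetric])
            (use \<Phi>(2) plateau_eq_0[of _ y "y + h" n] in \<open>metis greaterThanLessThan_iff order_less_imp_not_less\<close>)
      qed simp
      have right: "\<Phi> x = \<Phi> (y + h)" if "y + h \<le> x" for x
      proof (cases "x = y + h")
        case False
        then have xp: "y + h < x" using that by simp
        have "continuous_on {y + h..x} \<Phi>" by (rule smooth_continuous[OF \<Phi>(1)])
        then show ?thesis
          by (rule DERIV_isconst_end[OF xp])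
            (use \<Phi>(2) plateau_eq_0[of _ y "y + h" n] in \<open>metis greaterThanLessThan_iff order_less_imp_not_less\<close>)
      qed simp
      \<comment> \<open>To the left of \<open>y\<close> and to the right of \<open>z + h\<close> the
        primitive and its translate agree, so the difference has compact support even if \<Phi> has
        not.\<close>
      define \<theta> where "\<theta> x = \<Phi> x - \<Phi> (x - d)" for x
      have \<theta>1: "smooth \<theta>"
        unfolding \<theta>_def using smooth_affine_comp[OF \<Phi>(1), of 1 "- d"] by (intro smooth_diff \<Phi>) simp
      have pz: "?a (x - d) = plateau z (z + h) n x" for x
        by (simp add: plateau_def d_def algebra_simps)
      have "((\<lambda>x. \<Phi> (x - d)) has_real_derivative ?a (x - d)) (at x)" for x
        using \<Phi>(2)[of "x - d"] DERIV_shift[of \<Phi> _ x "-d"] by simp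
      then have "(\<theta> has_real_derivative ?a x - ?a (x - d)) (at x)" for x
        unfolding \<theta>_def by (intro DERIV_diff \<Phi>(2))
      then have d\<theta>: "deriv \<theta> x = ?a x - plateau z (z + h) n x" for x
        unfolding pz by (rule DERIV_imp_deriv)
      have \<theta>2: "\<theta> x = 0" if "x \<notin> {y..z + h}" for x
      proof (cases "x < y")
        case True
        then show ?thesis using left[of x] left[of "x - d"] \<open>y \<le> z\<close> by (simp add: \<theta>_def d_def)
      next
        case False
        then have "x > z + h" using that by simp
        then show ?thesis using right[of x] right[of "x - d"] \<open>y \<le> z\<close> by (simp add: \<theta>_def d_def)
      qed
      have ip: "integrable lebesgue (\<lambda>t. plateau p r n t * q t)" for p r
      proof -
        have "integrable lebesgue (\<lambda>t. plateau p r n t *\<^sub>R q t)"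
          by (rule locally_integrable_mult_compact[OF li, where K = "{p..r}" and B = 1])
            (use plateau_bounds[of p r n] smooth_measurable[OF smooth_plateau] in \<open>auto intro: plateau_eq_0\<close>)
        then show ?thesis by simp
      qed
      have "0 = (LINT t|lebesgue. indicator {0<..<T} t * deriv \<theta> t * Q t)"
        by (rule weak[OF \<theta>1 \<theta>2, symmetric]) (use that in auto)
      also have "\<dots> = (LINT t|lebesgue. ?a t * q t - plateau z (z + h) n t * q t)"
        by (intro Bochner_Integration.integral_cong) (auto simp: d\<theta> q_def algebra_simps)
      also have "\<dots> = (LINT t|lebesgue. ?a t * q t) - (LINT t|lebesgue. plateau z (z + h) n t * q t)"
        by (rule Bochner_Integration.integral_diff) (rule ip)+
      finally show ?thesis by simp
    qed
    moreover have "(\<lambda>n. LINT t|lebesgue. plateau p r n t * q t) \<longlonglongrightarrow> integral {p..r} q" for p r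
      using box_plateau_integral_tendsto[OF li, of p r] by simp
    ultimately have "integral {y..y + h} q = integral {z..z + h} q"
      using LIMSEQ_unique by (metis (no_types, lifting) ext)
    moreover have "integral {p..p + h} q = integral {p..p + h} Q" if "0 < p" "p + h < T" for p
      by (rule integral_cong) (use that in \<open>auto simp: q_def\<close>)
    ultimately show ?thesis using that by simp
  qed
  have Qi: "Q integrable_on {0..T}" by (rule integrable_continuous_real[OF cont])
  define G where "G x = integral {0..x} Q" for x
  have Gd: "(G has_real_derivative Q x) (at x)" if "0 < x" "x < T" for x
  proof -
    have "(G has_real_derivative Q x) (at x within {0..T})"
      unfolding G_def by (rule integral_has_real_derivative[OF cont]) (use that in auto)
    then show ?thesis using that at_within_Icc_at[of 0 x T] by simp
  qed
  have G_diff: "integral {y..y + h} Q = G (y + h) - G y" if "0 < y" "0 < h" "y + h < T" for y h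
  proof -
    have "Q integrable_on {0..y + h}" by (rule integrable_subinterval_real[OF Qi]) (use that in auto)
    from Henstock_Kurzweil_Integration.integral_combine[OF _ _ this, of y] that
    show ?thesis by (simp add: G_def)
  qed
  \<comment> \<open>By \<open>shift\<close> the increment \<open>G (y + h) - G y\<close> does not
    depend on \<open>y\<close>; its derivative at \<open>p\<close> is
    \<open>Q (p + h) - Q p\<close>.\<close>
  have inner: "Q (p + h) = Q p" if p: "0 < p" "0 < h" "p + h < T" for p h
  proof -
    have "((\<lambda>y. G (y + h) - G y) has_real_derivative Q (p + h) - Q p) (at p)"
      using Gd[of "p + h"] Gd[of p] p DERIV_shift[of G "Q (p + h)" p h] by (intro DERIV_diff) auto
    moreover have "((\<lambda>y. G (y + h) - G y) has_real_derivative 0) (at p)"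
    proof (rule has_field_derivative_transform_within_open[of "\<lambda>y. G (p + h) - G p"])
      show "G (p + h) - G p = G (y + h) - G y" if "y \<in> {0<..<T - h}" for y
      proof -
        have "integral {p..p + h} Q = integral {y..y + h} Q"
        proof (cases "p \<le> y")
          case True
          show ?thesis by (rule shift) (use that p True in auto)
        next
          case False
          show ?thesis by (rule shift[symmetric]) (use that p False in auto)
        qed
        moreover have "integral {y..y + h} Q = G (y + h) - G y"
          by (rule G_diff) (use that p in auto)
        ultimately show ?thesis using G_diff[OF p] by linarith
      qed
    qed (use p in auto)
    ultimately have "Q (p + h) - Q p = 0" by (rule DERIV_unique)
    then show ?thesis by simp
  qed
  have const: "Q x = Q (T / 2)" if x: "x \<in> {0<..<T}" for x
    using inner[of x "T / 2 - x"] inner[of "T / 2" "x - T / 2"] x T by (cases x "T / 2" rule: linorder_cases) auto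
  have cl: "closure {0<..<T} = {0..T}" using T by simp
  have "Q x = Q (T / 2)" if "x \<in> {0..T}" for x
  proof (rule continuous_constant_on_closure[of "{0<..<T}" Q])
    show "continuous_on (closure {0<..<T}) Q" unfolding cl by (rule cont)
    show "x \<in> closure {0<..<T}" unfolding cl by (rule that)
  qed (rule const)
  from this[OF st(1)] this[OF st(2)] show ?thesis by (rule trans[OF _ sym])
qed simp

text \<open>The time term has two limits as the cutoff grows: minus the integral of \<theta>'
  against the total quantity, and 0 because the balance law equates the term with vanishing
  fluxes.\<close>

lemma conserved_quantity:
  fixes q :: "real \<Rightarrow> real^3 \<Rightarrow> real"
  assumes li: "locally_integrable (slab T) (\<lambda>(t, x). q t x)"
    and i: "\<And>t. t \<in> {0..T} \<Longrightarrow> integrable lebesgue (q t)"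
    and bd: "\<And>t. t \<in> {0..T} \<Longrightarrow> (LINT x|lebesgue. \<bar>q t x\<bar>) \<le> M"
    and cont: "continuous_on {0..T} (\<lambda>t. LINT x|lebesgue. q t x)"
    and flux: "\<And>\<theta> a b. smooth \<theta> \<Longrightarrow> (\<And>t. t \<notin> {a..b} \<Longrightarrow> \<theta> t = 0) \<Longrightarrow> 0 < a \<Longrightarrow> b < T \<Longrightarrow>
      (\<lambda>n. dist_deriv time_dir (\<lambda>(t, x). q t x) (cutoff \<theta> n)) \<longlonglongrightarrow> 0"
    and st: "s \<in> {0..T}" "t \<in> {0..T}"
  shows "(LINT x|lebesgue. q s x) = (LINT x|lebesgue. q t x)"
proof (rule weakly_constant_imp_constant[OF cont _ st])
  fix \<theta> :: "real \<Rightarrow> real" and a b :: real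
  assume \<theta>: "smooth \<theta>" "\<And>t. t \<notin> {a..b} \<Longrightarrow> \<theta> t = 0" "0 < a" "b < T"
  have "(\<lambda>n. dist_deriv time_dir (\<lambda>(t, x). q t x) (cutoff \<theta> n)) \<longlonglongrightarrow>
      - (LINT t|lebesgue. indicator {0<..<T} t * deriv \<theta> t * (LINT x|lebesgue. q t x))"
    using dist_deriv_cutoff_tendsto[OF li _ _ \<theta> time_dir_Basis, of M] i bd by simp
  from LIMSEQ_unique[OF this flux[OF \<theta>]]
  show "(LINT t|lebesgue. indicator {0<..<T} t * deriv \<theta> t * (LINT x|lebesgue. q t x)) = 0" by simp
qed

lemma flux_vanishes:
  fixes F :: "real \<Rightarrow> real^3 \<Rightarrow> real"
  assumes li: "locally_integrable (slab T) (\<lambda>(t, x). F t x)"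
    and i: "\<And>t. t \<in> {0..T} \<Longrightarrow> integrable lebesgue (F t)"
    and bd: "\<And>t. t \<in> {0..T} \<Longrightarrow> (LINT x|lebesgue. \<bar>F t x\<bar>) \<le> M"
    and \<theta>: "smooth \<theta>" "\<And>t. t \<notin> {a..b} \<Longrightarrow> \<theta> t = 0" "0 < a" "b < T"
  shows "(\<lambda>n. dist_deriv (space_dir j) (\<lambda>(t, x). F t x) (cutoff \<theta> n)) \<longlonglongrightarrow> 0"
  using dist_deriv_cutoff_tendsto[OF li _ _ \<theta> space_dir_Basis, of M j] i bd by simp

section \<open>Integrability from square integrability\<close>

text \<open>Every density and flux below is dominated in this form, which combines Young's
  inequality with the L^2 bounds.\<close>

lemma integrable_by_squares:
  fixes F :: "real^3 \<Rightarrow> real"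
  assumes m: "F \<in> borel_measurable lebesgue" and g: "sq_integrable g1" "sq_integrable g2"
    and le: "AE x in lebesgue. \<bar>F x\<bar> \<le> c * ((norm (g1 x))\<^sup>2 + (norm (g2 x))\<^sup>2)"
  shows "integrable lebesgue F" "(LINT x|lebesgue. \<bar>F x\<bar>) \<le> c * (sq_int g1 + sq_int g2)"
proof -
  have i: "integrable lebesgue (\<lambda>x. c * ((norm (g1 x))\<^sup>2 + (norm (g2 x))\<^sup>2))"
    using g by (simp add: sq_integrable_def)
  show F: "integrable lebesgue F"
    by (rule Bochner_Integration.integrable_bound[OF i m])
      (use le in eventually_elim, simp)
  have "(LINT x|lebesgue. \<bar>F x\<bar>) \<le> (LINT x|lebesgue. c * ((norm (g1 x))\<^sup>2 + (norm (g2 x))\<^sup>2))"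
    by (rule integral_mono_AE[OF integrable_abs[OF F] i le])
  also have "\<dots> = c * (sq_int g1 + sq_int g2)"
    using g by (simp add: sq_integrable_def sq_int_def)
  finally show "(LINT x|lebesgue. \<bar>F x\<bar>) \<le> c * (sq_int g1 + sq_int g2)" .
qed

text \<open>The weight \<eta> puts a small coefficient on a factor that is merely bounded, at the
  price of a large one on a factor that tends to 0.\<close>

lemma mult_le_weighted_squares:
  fixes a b \<eta> :: real
  assumes "\<eta> > 0"
  shows "a * b \<le> \<eta> * a\<^sup>2 + b\<^sup>2 / \<eta>"
proof -
  have "0 \<le> (\<eta> * a - b)\<^sup>2 + (\<eta> * a)\<^sup>2 + b\<^sup>2" by simp
  also have "\<dots> = 2 * \<eta> * (\<eta> * a\<^sup>2 + b\<^sup>2 / \<eta> - a * b)"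
    using assms by (simp add: field_simps power2_eq_square)
  finally show ?thesis using assms by (simp add: zero_le_mult_iff)
qed

text \<open>Each product pairs an L^2 bounded factor \<open>g\<close> with a factor \<open>d\<close>
  that vanishes in L^2. First \<eta> is fixed to make the bounded part small, then \<open>t\<close>
  tends to \<open>s\<close>.\<close>

lemma integral_tendsto_by_products:
  fixes q :: "real \<Rightarrow> real^3 \<Rightarrow> real"
  assumes i: "\<And>t. t \<in> S \<Longrightarrow> integrable lebesgue (q t)" and s: "s \<in> S"
    and g: "\<And>t. t \<in> S \<Longrightarrow> sq_integrable (g1 t)" "\<And>t. t \<in> S \<Longrightarrow> sq_int (g1 t) \<le> M"
      "\<And>t. t \<in> S \<Longrightarrow> sq_integrable (g2 t)" "\<And>t. t \<in> S \<Longrightarrow> sq_int (g2 t) \<le> M"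
    and d: "\<And>t. t \<in> S \<Longrightarrow> sq_integrable (d1 t)" "((\<lambda>t. sq_int (d1 t)) \<longlongrightarrow> 0) (at s within S)"
      "\<And>t. t \<in> S \<Longrightarrow> sq_integrable (d2 t)" "((\<lambda>t. sq_int (d2 t)) \<longlongrightarrow> 0) (at s within S)"
    and c: "c \<ge> 0"
    and le: "\<And>t. t \<in> S \<Longrightarrow> AE x in lebesgue. \<bar>q t x - q s x\<bar> \<le>
      c * (norm (g1 t x) * norm (d1 t x) + norm (g2 t x) * norm (d2 t x))"
  shows "((\<lambda>t. LINT x|lebesgue. q t x) \<longlongrightarrow> (LINT x|lebesgue. q s x)) (at s within S)"
proof (rule tendstoI)
  fix e :: real assume e: "e > 0"
  have M: "M \<ge> 0" using g(2)[OF s] sq_int_nonneg[of "g1 s"] by linarith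
  \<comment> \<open>This makes \<open>c * (\<eta> * (2 * M))\<close> at most \<open>e / 2\<close>;
    adding 1 to \<open>c\<close> and to \<open>M\<close> avoids a zero denominator.\<close>
  define \<eta> where "\<eta> = e / (4 * (c + 1) * (M + 1))"
  have \<eta>: "\<eta> > 0" using e c M by (simp add: \<eta>_def)
  have bound: "\<bar>(LINT x|lebesgue. q t x) - (LINT x|lebesgue. q s x)\<bar> \<le>
      c * (\<eta> * (2 * M)) + c * (sq_int (d1 t) + sq_int (d2 t)) / \<eta>" if t: "t \<in> S" for t
  proof -
    note sq = g(1)[OF t] g(3)[OF t] d(1)[OF t] d(3)[OF t]
    let ?R = "\<lambda>x. c * ((\<eta> * (norm (g1 t x))\<^sup>2 + (norm (d1 t x))\<^sup>2 / \<eta>) +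
        (\<eta> * (norm (g2 t x))\<^sup>2 + (norm (d2 t x))\<^sup>2 / \<eta>))"
    have R: "integrable lebesgue ?R" using sq by (simp add: sq_integrable_def)
    have ae: "AE x in lebesgue. \<bar>q t x - q s x\<bar> \<le> ?R x"
      using le[OF t]
    proof eventually_elim
      case (elim x)
      show ?case
        by (rule order_trans[OF elim mult_left_mono[OF _ c]])
          (intro add_mono mult_le_weighted_squares \<eta>)
    qed
    have "\<bar>(LINT x|lebesgue. q t x) - (LINT x|lebesgue. q s x)\<bar> = \<bar>LINT x|lebesgue. q t x - q s x\<bar>"
      using i[OF t] i[OF s] by simp
    also have "\<dots> \<le> (LINT x|lebesgue. \<bar>q t x - q s x\<bar>)" by (rule integral_abs_bound)
    also have "\<dots> \<le> integral\<^sup>L lebesgue ?R"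
      using i[OF t] i[OF s] by (intro integral_mono_AE R ae) auto
    also have "\<dots> = c * ((\<eta> * sq_int (g1 t) + sq_int (d1 t) / \<eta>) + (\<eta> * sq_int (g2 t) + sq_int (d2 t) / \<eta>))"
      using sq by (simp add: sq_integrable_def sq_int_def)
    also have "\<dots> \<le> c * ((\<eta> * M + sq_int (d1 t) / \<eta>) + (\<eta> * M + sq_int (d2 t) / \<eta>))"
      using g(2)[OF t] g(4)[OF t] \<eta> c by (intro mult_left_mono add_mono) auto
    also have "\<dots> = c * (\<eta> * (2 * M)) + c * (sq_int (d1 t) + sq_int (d2 t)) / \<eta>"
      by (simp add: algebra_simps add_divide_distrib)
    finally show ?thesis .
  qed
  have "((\<lambda>t. c * (\<eta> * (2 * M)) + c * (sq_int (d1 t) + sq_int (d2 t)) / \<eta>) \<longlongrightarrow>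
      c * (\<eta> * (2 * M)) + c * (0 + 0) / \<eta>) (at s within S)"
    using \<eta> by (intro tendsto_intros d) auto
  moreover have "c * (\<eta> * (2 * M)) + c * (0 + 0) / \<eta> < e"
  proof -
    have "c * (\<eta> * (2 * M)) \<le> (c + 1) * (\<eta> * (2 * (M + 1)))"
      using c M \<eta> by (intro mult_mono) auto
    also have "\<dots> = \<eta> * (4 * (c + 1) * (M + 1)) / 2" by (simp add: algebra_simps)
    also have "\<eta> * (4 * (c + 1) * (M + 1)) = e"
    proof -
      have "4 * (c + 1) * (M + 1) \<noteq> 0" using c M by simp
      then show ?thesis using nonzero_eq_divide_eq[THEN iffD1, OF _ \<eta>_def] by blast
    qed
    finally show ?thesis using e by simp
  qed
  ultimately have "\<forall>\<^sub>F t in at s within S.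
      c * (\<eta> * (2 * M)) + c * (sq_int (d1 t) + sq_int (d2 t)) / \<eta> < e"
    by (rule order_tendstoD(2))
  moreover have "\<forall>\<^sub>F t in at s within S. t \<in> S" by (simp add: eventually_at_filter)
  ultimately show "\<forall>\<^sub>F t in at s within S. dist (LINT x|lebesgue. q t x) (LINT x|lebesgue. q s x) < e"
    by eventually_elim (use bound in \<open>force simp: dist_real_def\<close>)
qed

section \<open>Pointwise estimates for powers of the density and for the stress\<close>

lemma powr_le_square:
  fixes a K p :: real
  assumes "0 < a" "a \<le> K" "p \<ge> 2"
  shows "a powr p \<le> K powr (p - 2) * a\<^sup>2"
proof -
  have "a powr p = a powr (p - 2) * a powr 2"
    by (simp flip: powr_add)
  also have "a powr 2 = a\<^sup>2" using assms(1) by simp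
  finally show ?thesis using assms by (simp add: mult_right_mono powr_mono2)
qed

text \<open>By the mean value theorem. The point is to keep a factor \<open>a + b\<close> next to
  \<open>\<bar>a - b\<bar>\<close>: a product of two L^2 functions is integrable over the whole
  space, whereas a Lipschitz bound by \<open>\<bar>a - b\<bar>\<close> alone need not be. Keeping
  this factor uses \<open>p \<ge> 2\<close>.\<close>

lemma powr_diff_le:
  fixes a b K p :: real
  assumes a: "0 < a" "a \<le> K" and b: "0 < b" "b \<le> K" and p: "p \<ge> 2"
  shows "\<bar>a powr p - b powr p\<bar> \<le> p * K powr (p - 2) * ((a + b) * \<bar>a - b\<bar>)"
  using a b
proof (induction a b rule: linorder_wlog)
  case (sym a b)
  then show ?case by (simp add: abs_minus_commute add.commute)
next
  case (le a b)
  show ?case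
  proof (cases "a = b")
    case False
    then have ab: "a < b" using le by simp
    have "\<exists>z>a. z < b \<and> b powr p - a powr p = (b - a) * (p * z powr (p - 1))"
      by (rule MVT2[OF ab]) (use le in \<open>auto intro!: derivative_eq_intros simp: powr_diff\<close>)
    then obtain z where z: "a < z" "z < b" "b powr p - a powr p = (b - a) * (p * z powr (p - 1))"
      by blast
    have "z powr (p - 1) \<le> b powr (p - 1)" using z le p by (intro powr_mono2) auto
    also have "b powr (p - 1) = b powr (p - 2) * b powr 1"
      using powr_add[of b "p - 2" 1] by simp
    also have "\<dots> = b powr (p - 2) * b" using le by simp
    also have "\<dots> \<le> K powr (p - 2) * (a + b)"
      using le p by (intro mult_mono powr_mono2) auto
    finally have zz: "z powr (p - 1) \<le> K powr (p - 2) * (a + b)" .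
    have "\<bar>a powr p - b powr p\<bar> = (b - a) * (p * z powr (p - 1))"
    proof -
      have "0 \<le> (b - a) * (p * z powr (p - 1))" using ab p by simp
      then show ?thesis using z(3) by linarith
    qed
    also have "\<dots> \<le> (b - a) * (p * (K powr (p - 2) * (a + b)))"
      using zz ab p by (intro mult_left_mono) auto
    also have "\<dots> = p * K powr (p - 2) * ((a + b) * \<bar>a - b\<bar>)" using ab by simp
    finally show ?thesis .
  qed simp
qed

text \<open>The 2 counts an entry and its transpose, the 3 the diagonal entries of the
  trace.\<close>

lemma viscous_stress_bound:
  "\<bar>viscous_stress \<alpha> \<beta> \<delta> r M $ i $ j\<bar> \<le> (2 * \<bar>\<alpha>\<bar> + 3 * \<bar>\<beta>\<bar>) * (r powr \<delta> * norm M)"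
proof -
  have e: "\<bar>M $ i $ j\<bar> \<le> norm M" for i j
    by (metis Finite_Cartesian_Product.norm_nth_le norm_bound_component_le_cart order_trans real_norm_def)
  have m: "\<bar>M $ i $ j + M $ j $ i\<bar> \<le> 2 * norm M"
    using e[of i j] e[of j i] by linarith
  have tr: "\<bar>trace M\<bar> \<le> 3 * norm M"
  proof -
    have "\<bar>trace M\<bar> \<le> (\<Sum>i\<in>UNIV. \<bar>M $ i $ i\<bar>)" unfolding trace_def by (rule sum_abs)
    also have "\<dots> \<le> (\<Sum>i\<in>(UNIV :: 3 set). norm M)" by (intro sum_mono e)
    finally show ?thesis by simp
  qed
  have "\<bar>viscous_stress \<alpha> \<beta> \<delta> r M $ i $ j\<bar> =
      \<bar>\<alpha> * r powr \<delta> * (M $ i $ j + M $ j $ i) + \<beta> * r powr \<delta> * trace M * (mat 1 :: real^3^3) $ i $ j\<bar>"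
    by (simp add: viscous_stress_def transpose_def)
  also have "\<dots> \<le> \<bar>\<alpha> * r powr \<delta> * (M $ i $ j + M $ j $ i)\<bar> + \<bar>\<beta> * r powr \<delta> * trace M * (mat 1 :: real^3^3) $ i $ j\<bar>"
    by (rule abs_triangle_ineq)
  also have "\<dots> \<le> \<bar>\<alpha>\<bar> * r powr \<delta> * (2 * norm M) + \<bar>\<beta>\<bar> * r powr \<delta> * (3 * norm M) * 1"
    unfolding abs_mult using m tr by (intro add_mono mult_mono) (auto simp: mat_def)
  also have "\<dots> = (2 * \<bar>\<alpha>\<bar> + 3 * \<bar>\<beta>\<bar>) * (r powr \<delta> * norm M)"
    by (simp add: algebra_simps)
  finally show ?thesis .
qed

lemma locally_integrable_component:
  "locally_integrable \<Omega> f \<Longrightarrow> locally_integrable \<Omega> (\<lambda>x. f x \<bullet> b)"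
  unfolding locally_integrable_def set_integrable_def
  by (auto dest!: spec intro!: integrable_inner_left simp flip: inner_scaleR_left)

section \<open>Mass and momentum of regular solutions\<close>

text \<open>Below \<open>r\<close> is a density, \<open>a = r powr (\<gamma> - 1)\<close> the function controlled in \<open>H\<^sup>3\<close> and \<open>p\<close> the
  inverse exponent; \<open>\<gamma> \<le> 3 / 2\<close> means \<open>p \<ge> 2\<close>, which makes \<open>r = a powr p\<close> integrable for bounded \<open>a\<close>.\<close>

lemma density_bounds:
  fixes r a K p \<gamma> \<delta> w :: real
  assumes r: "r > 0" and a: "a = r powr (\<gamma> - 1)" and p: "p = 1 / (\<gamma> - 1)"
    and \<gamma>: "1 < \<gamma>" "\<gamma> \<le> 3 / 2" and K: "a \<le> K" and \<delta>: "0 \<le> \<delta>"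
  shows "2 \<le> p" "0 < a" "a powr p = r" "r \<le> K powr (p - 2) * a\<^sup>2" "r \<le> K powr p"
    "r powr \<gamma> \<le> K powr (p - 2) * K * a\<^sup>2"
    "r * w \<le> K powr (p - 2) * K * (a\<^sup>2 + w\<^sup>2)"
    "r powr \<delta> * w \<le> ((K powr p) powr \<delta> * K powr (p - 2) + 1) * (a\<^sup>2 + (r powr ((\<delta> - 1) / 2) * w)\<^sup>2)"
proof -
  show p2: "2 \<le> p" using \<gamma> by (simp add: p field_simps)
  show a0: "0 < a" using r by (simp add: a)
  show ap: "a powr p = r" using r \<gamma> by (simp add: a p powr_powr)
  let ?c = "K powr (p - 2)"
  have K0: "K > 0" using a0 K by simp
  show r1: "r \<le> ?c * a\<^sup>2" using powr_le_square[OF a0 K p2] ap by simp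
  show r2: "r \<le> K powr p" using powr_mono2[of p a K] a0 K p2 ap by simp
  have ra: "r powr \<gamma> = r * a"
    using powr_add[of r 1 "\<gamma> - 1"] r by (simp add: a)
  have "r * a \<le> ?c * a\<^sup>2 * K" using r1 K a0 r by (intro mult_mono) auto
  then show "r powr \<gamma> \<le> ?c * K * a\<^sup>2" by (simp add: ra mult_ac)
  show "r * w \<le> ?c * K * (a\<^sup>2 + w\<^sup>2)"
  proof -
    have "r * w \<le> r * \<bar>w\<bar>" using r by (simp add: mult_left_mono)
    also have "\<dots> \<le> ?c * a\<^sup>2 * \<bar>w\<bar>" using r1 by (intro mult_right_mono) auto
    also have "\<dots> = ?c * a * (a * \<bar>w\<bar>)" by (simp add: power2_eq_square mult_ac)
    also have "\<dots> \<le> ?c * K * (a\<^sup>2 + w\<^sup>2)"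
    proof (rule mult_mono)
      show "a * \<bar>w\<bar> \<le> a\<^sup>2 + w\<^sup>2" using mult_le_weighted_squares[of 1 a "\<bar>w\<bar>"] by simp
    qed (use K a0 in \<open>auto intro: mult_left_mono\<close>)
    finally show ?thesis .
  qed
  show "r powr \<delta> * w \<le> ((K powr p) powr \<delta> * ?c + 1) * (a\<^sup>2 + (r powr ((\<delta> - 1) / 2) * w)\<^sup>2)"
  proof -
    \<comment> \<open>The power \<delta> is split as (\<delta> + 1)/2 plus (\<delta> - 1)/2. The
      second part turns \<open>w\<close> into the weighted gradient that is square integrable; the
      first, squared, is \<open>r powr \<delta> * r\<close>, a bounded factor times a multiple of
      \<open>a\<^sup>2\<close>.\<close>
    let ?w = "r powr ((\<delta> - 1) / 2) * w"
    have "r powr ((\<delta> + 1) / 2) * r powr ((\<delta> - 1) / 2) = r powr \<delta>"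
      by (simp flip: powr_add add: field_simps)
    then have "r powr \<delta> * w = r powr ((\<delta> + 1) / 2) * ?w" by (simp flip: mult.assoc)
    also have "\<dots> \<le> (r powr ((\<delta> + 1) / 2))\<^sup>2 + ?w\<^sup>2"
      using mult_le_weighted_squares[of 1 "r powr ((\<delta> + 1) / 2)" ?w] by simp
    also have "(r powr ((\<delta> + 1) / 2))\<^sup>2 = r powr \<delta> * r"
    proof -
      have "(r powr ((\<delta> + 1) / 2))\<^sup>2 = r powr ((\<delta> + 1) / 2 + (\<delta> + 1) / 2)"
        by (simp only: power2_eq_square powr_add)
      also have "\<dots> = r powr (\<delta> + 1)" by (simp only: field_sum_of_halves)
      also have "\<dots> = r powr \<delta> * r powr 1" by (rule powr_add)
      finally show ?thesis using r by simp
    qed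
    also have "r powr \<delta> * r \<le> (K powr p) powr \<delta> * (?c * a\<^sup>2)"
      using r r1 r2 \<delta> by (intro mult_mono powr_mono2) auto
    also have "(K powr p) powr \<delta> * (?c * a\<^sup>2) + ?w\<^sup>2 \<le>
        ((K powr p) powr \<delta> * ?c + 1) * (a\<^sup>2 + ?w\<^sup>2)"
      by (simp add: algebra_simps)
    finally show ?thesis by simp
  qed
qed

lemma viscous_stress_nth:
  "viscous_stress \<alpha> \<beta> \<delta> r M $ i $ j =
    \<alpha> * r powr \<delta> * (M $ i $ j + M $ j $ i) + \<beta> * r powr \<delta> * (\<Sum>k\<in>UNIV. M $ k $ k) * (mat 1 :: real^3^3) $ i $ j"
  by (simp add: viscous_stress_def transpose_def trace_def)

lemma borel_measurable_vec_nth_lebesgue: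
  fixes f :: "'a::euclidean_space \<Rightarrow> 'b::euclidean_space ^ 'n::finite"
  assumes "f \<in> borel_measurable lebesgue"
  shows "(\<lambda>x. f x $ i) \<in> borel_measurable lebesgue"
  by (rule measurable_compose[OF assms]) (intro borel_measurable_continuous_onI continuous_intros)

text \<open>The closed interval matters: initial data are attained at time 0, and the end time
  \<open>T\<close> may itself be the late time. Integrability belongs to the conclusion because
  integrals of nonintegrable functions default to 0.\<close>

proposition regular_solution_conservation:
  assumes reg: "regular_solution A \<alpha> \<beta> \<gamma> \<delta> \<rho>0 u0 T \<rho> u"
    and \<gamma>: "1 < \<gamma>" "\<gamma> \<le> 3 / 2" and \<delta>: "0 \<le> \<delta>" and t: "t \<in> {0..T}"
  shows "\<And>x. \<rho> t x > 0" "integrable lebesgue (\<rho> t)" "integrable lebesgue (\<lambda>x. \<rho> t x * u t x $ i)"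
    "(LINT x|lebesgue. \<rho> t x) = (LINT x|lebesgue. \<rho>0 x)"
    "(LINT x|lebesgue. \<rho> t x * u t x $ i) = (LINT x|lebesgue. \<rho>0 x * u0 x $ i)"
proof -
  obtain Du where sol: "solves_CP A \<alpha> \<beta> \<gamma> \<delta> \<rho>0 u0 T \<rho> u Du"
    and grad: "\<And>t. t \<in> {0..T} \<Longrightarrow> weak_gradient (u t) (Du t)"
    and pos: "\<And>t x. t \<in> {0..T} \<Longrightarrow> \<rho> t x > 0"
    and Cf: "C_time T (H_norm 3) (\<lambda>t x. \<rho> t x powr (\<gamma> - 1))"
    and Cu: "C_time T (H_norm 3) u"
    and Cw: "C_time T (Lp_norm 2) (\<lambda>t x. \<rho> t x powr ((\<delta> - 1) / 2) *\<^sub>R Du t x)"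
    using reg unfolding regular_solution_def by blast
  have mass: "mass_equation T \<rho> u" and momentum: "momentum_equation A \<alpha> \<beta> \<gamma> \<delta> T \<rho> u Du"
    and init: "\<rho> 0 = \<rho>0" "u 0 = u0"
    using sol unfolding solves_CP_def by auto
  define f where "f t x = \<rho> t x powr (\<gamma> - 1)" for t x
  define w where "w t x = \<rho> t x powr ((\<delta> - 1) / 2) *\<^sub>R Du t x" for t x
  define p where "p = 1 / (\<gamma> - 1)"
  note f_facts = C_time_H_norm_sq_int[OF Cf, folded f_def]
  note u_facts = C_time_H_norm_sq_int[OF Cu]
  note w_facts = C_time_L2_sq_int[OF Cw, folded w_def]
  obtain K where K: "K \<ge> 1" "\<And>t. t \<in> {0..T} \<Longrightarrow> AE x in lebesgue. \<bar>f t x\<bar> \<le> K"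
    using C_time_H3_bounded[OF Cf, folded f_def] by blast
  obtain Mf Mu Mw where M: "Mf \<ge> 1" "\<And>t. t \<in> {0..T} \<Longrightarrow> sq_int (f t) \<le> Mf"
    "Mu \<ge> 1" "\<And>t. t \<in> {0..T} \<Longrightarrow> sq_int (u t) \<le> Mu"
    "Mw \<ge> 1" "\<And>t. t \<in> {0..T} \<Longrightarrow> sq_int (w t) \<le> Mw"
    using f_facts(2) u_facts(2) w_facts(2) by blast
  let ?c = "K powr (p - 2)"
  have c0: "?c \<ge> 0" "K powr p \<ge> 0" by simp_all
  \<comment> \<open>The bound \<open>K\<close> on \<open>f t\<close> holds only almost everywhere,
    so the pointwise estimates are collected off one null set for each time.\<close>
  have bounds: "AE x in lebesgue. 0 < f t x \<and> f t x \<le> K \<and> f t x powr p = \<rho> t x \<and> \<rho> t x \<le> ?c * (f t x)\<^sup>2 \<and>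
      \<rho> t x \<le> K powr p \<and> \<rho> t x powr \<gamma> \<le> ?c * K * (f t x)\<^sup>2 \<and>
      \<rho> t x * norm (u t x) \<le> ?c * K * ((f t x)\<^sup>2 + (norm (u t x))\<^sup>2) \<and>
      \<rho> t x powr \<delta> * norm (Du t x) \<le> ((K powr p) powr \<delta> * ?c + 1) * ((f t x)\<^sup>2 + (norm (w t x))\<^sup>2)"
    if t: "t \<in> {0..T}" for t
    using K(2)[OF t]
  proof eventually_elim
    case (elim x)
    then have fK: "f t x \<le> K" by simp
    note b = density_bounds[OF pos[OF t] f_def p_def \<gamma> fK \<delta>]
    show ?case using b(2-6) b(7)[of "norm (u t x)"] b(8)[of "norm (Du t x)"] fK by (simp add: w_def)
  qed
  have p2: "p \<ge> 2" using \<gamma> by (simp add: p_def field_simps)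
  have fm: "f t \<in> borel_measurable lebesgue" and um: "u t \<in> borel_measurable lebesgue" if "t \<in> {0..T}" for t
    using f_facts(1)[OF that] u_facts(1)[OF that] by (simp_all add: sq_integrable_def)
  have uim: "(\<lambda>x. u t x $ i) \<in> borel_measurable lebesgue" if "t \<in> {0..T}" for t i
    by (rule borel_measurable_vec_nth_lebesgue[OF um[OF that]])
  \<comment> \<open>Joint measurability does not reach each individual time; the slice is measurable
    because it is a power of \<open>f t\<close>, by positivity of the density.\<close>
  have \<rho>m: "\<rho> t \<in> borel_measurable lebesgue" if t: "t \<in> {0..T}" for t
  proof -
    have "\<rho> t x = f t x powr p" for x
      using pos[OF t, of x] \<gamma> by (simp add: f_def p_def powr_powr)
    then have "\<rho> t = (\<lambda>x. f t x powr p)" by (rule ext)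
    moreover have "(\<lambda>x. f t x powr p) \<in> borel_measurable lebesgue"
      by (intro powr_real_measurable fm[OF t] borel_measurable_const)
    ultimately show ?thesis by simp
  qed
  have Dum: "(\<lambda>x. Du t x $ i $ j) \<in> borel_measurable lebesgue" if t: "t \<in> {0..T}" for t i j
  proof -
    have "(\<lambda>x. Du t x $ i) \<in> borel_measurable lebesgue"
      using grad[OF t] by (auto simp: weak_gradient_def weak_deriv_def intro: locally_integrable_measurable)
    then show ?thesis by (rule borel_measurable_vec_nth_lebesgue)
  qed

  have I1: "integrable lebesgue (\<rho> t)" "(LINT x|lebesgue. \<bar>\<rho> t x\<bar>) \<le> ?c * (Mf + Mf)" if t: "t \<in> {0..T}" for t
  proof -
    have "AE x in lebesgue. \<bar>\<rho> t x\<bar> \<le> ?c * ((norm (f t x))\<^sup>2 + (norm (f t x))\<^sup>2)"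
      using bounds[OF t]
    proof eventually_elim
      case (elim x)
      moreover have "0 \<le> ?c * (f t x)\<^sup>2" by simp
      ultimately show ?case using pos[OF t, of x] by (simp add: distrib_left)
    qed
    note b = integrable_by_squares[OF \<rho>m[OF t] f_facts(1)[OF t] f_facts(1)[OF t] this]
    show "integrable lebesgue (\<rho> t)" by (rule b(1))
    show "(LINT x|lebesgue. \<bar>\<rho> t x\<bar>) \<le> ?c * (Mf + Mf)"
      by (rule order_trans[OF b(2)]) (intro mult_left_mono add_mono M t c0)
  qed
  have I2: "integrable lebesgue (\<lambda>x. \<rho> t x * u t x $ i)"
    "(LINT x|lebesgue. \<bar>\<rho> t x * u t x $ i\<bar>) \<le> ?c * K * (Mf + Mu)" if t: "t \<in> {0..T}" for t i
  proof -
    have ae: "AE x in lebesgue. \<bar>\<rho> t x * u t x $ i\<bar> \<le> ?c * K * ((norm (f t x))\<^sup>2 + (norm (u t x))\<^sup>2)"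
      using bounds[OF t]
    proof eventually_elim
      case (elim x)
      have "\<bar>\<rho> t x * u t x $ i\<bar> \<le> \<rho> t x * norm (u t x)"
        using pos[OF t, of x] component_le_norm_cart[of "u t x" i] by (simp add: abs_mult)
      with elim show ?case by simp
    qed
    have "(\<lambda>x. \<rho> t x * u t x $ i) \<in> borel_measurable lebesgue"
      using \<rho>m[OF t] uim[OF t] by (rule borel_measurable_times)
    note b = integrable_by_squares[OF this f_facts(1)[OF t] u_facts(1)[OF t] ae]
    show "integrable lebesgue (\<lambda>x. \<rho> t x * u t x $ i)" by (rule b(1))
    show "(LINT x|lebesgue. \<bar>\<rho> t x * u t x $ i\<bar>) \<le> ?c * K * (Mf + Mu)"
      by (rule order_trans[OF b(2)]) (use K(1) in \<open>intro mult_left_mono add_mono M t; simp\<close>)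
  qed
  have I3: "integrable lebesgue (\<lambda>x. \<rho> t x * u t x $ i * u t x $ j)"
    "(LINT x|lebesgue. \<bar>\<rho> t x * u t x $ i * u t x $ j\<bar>) \<le> K powr p * (Mu + Mu)" if t: "t \<in> {0..T}" for t i j
  proof -
    have ae: "AE x in lebesgue. \<bar>\<rho> t x * u t x $ i * u t x $ j\<bar> \<le> K powr p * ((norm (u t x))\<^sup>2 + (norm (u t x))\<^sup>2)"
      using bounds[OF t]
    proof eventually_elim
      case (elim x)
      have "\<bar>\<rho> t x * u t x $ i * u t x $ j\<bar> = \<rho> t x * (\<bar>u t x $ i\<bar> * \<bar>u t x $ j\<bar>)"
        using pos[OF t, of x] by (simp add: abs_mult)
      also have "\<dots> \<le> K powr p * (norm (u t x) * norm (u t x))"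
        using elim pos[OF t, of x] component_le_norm_cart[of "u t x"] by (intro mult_mono) auto
      also have "\<dots> \<le> K powr p * ((norm (u t x))\<^sup>2 + (norm (u t x))\<^sup>2)"
        by (intro mult_left_mono) (auto simp: power2_eq_square)
      finally show ?case .
    qed
    have "(\<lambda>x. \<rho> t x * u t x $ i * u t x $ j) \<in> borel_measurable lebesgue"
      by (intro borel_measurable_times \<rho>m[OF t] uim[OF t])
    note b = integrable_by_squares[OF this u_facts(1)[OF t] u_facts(1)[OF t] ae]
    show "integrable lebesgue (\<lambda>x. \<rho> t x * u t x $ i * u t x $ j)" by (rule b(1))
    show "(LINT x|lebesgue. \<bar>\<rho> t x * u t x $ i * u t x $ j\<bar>) \<le> K powr p * (Mu + Mu)"
      by (rule order_trans[OF b(2)]) (intro mult_left_mono add_mono M t c0)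
  qed
  have I4: "integrable lebesgue (\<lambda>x. A * \<rho> t x powr \<gamma>)"
    "(LINT x|lebesgue. \<bar>A * \<rho> t x powr \<gamma>\<bar>) \<le> \<bar>A\<bar> * (?c * K) * (Mf + Mf)" if t: "t \<in> {0..T}" for t
  proof -
    have ae: "AE x in lebesgue. \<bar>A * \<rho> t x powr \<gamma>\<bar> \<le> \<bar>A\<bar> * (?c * K) * ((norm (f t x))\<^sup>2 + (norm (f t x))\<^sup>2)"
      using bounds[OF t]
    proof eventually_elim
      case (elim x)
      have "\<bar>A * \<rho> t x powr \<gamma>\<bar> = \<bar>A\<bar> * \<rho> t x powr \<gamma>" by (simp add: abs_mult)
      also have "\<dots> \<le> \<bar>A\<bar> * (?c * K * (f t x)\<^sup>2)" using elim by (intro mult_left_mono) auto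
      also have "\<dots> \<le> \<bar>A\<bar> * (?c * K * ((f t x)\<^sup>2 + (f t x)\<^sup>2))"
        using K(1) by (intro mult_left_mono) auto
      finally show ?case by (simp add: mult.assoc)
    qed
    have "(\<lambda>x. A * \<rho> t x powr \<gamma>) \<in> borel_measurable lebesgue"
      by (intro borel_measurable_times powr_real_measurable \<rho>m[OF t] borel_measurable_const)
    note b = integrable_by_squares[OF this f_facts(1)[OF t] f_facts(1)[OF t] ae]
    show "integrable lebesgue (\<lambda>x. A * \<rho> t x powr \<gamma>)" by (rule b(1))
    show "(LINT x|lebesgue. \<bar>A * \<rho> t x powr \<gamma>\<bar>) \<le> \<bar>A\<bar> * (?c * K) * (Mf + Mf)"
      by (rule order_trans[OF b(2)]) (use K(1) in \<open>intro mult_left_mono add_mono M t; simp\<close>)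
  qed
  let ?C = "(2 * \<bar>\<alpha>\<bar> + 3 * \<bar>\<beta>\<bar>) * ((K powr p) powr \<delta> * ?c + 1)"
  have I5: "integrable lebesgue (\<lambda>x. viscous_stress \<alpha> \<beta> \<delta> (\<rho> t x) (Du t x) $ i $ j)"
    "(LINT x|lebesgue. \<bar>viscous_stress \<alpha> \<beta> \<delta> (\<rho> t x) (Du t x) $ i $ j\<bar>) \<le> ?C * (Mf + Mw)" if t: "t \<in> {0..T}" for t i j
  proof -
    have ae: "AE x in lebesgue. \<bar>viscous_stress \<alpha> \<beta> \<delta> (\<rho> t x) (Du t x) $ i $ j\<bar> \<le>
        ?C * ((norm (f t x))\<^sup>2 + (norm (w t x))\<^sup>2)"
      using bounds[OF t]
    proof eventually_elim
      case (elim x)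
      have "\<bar>viscous_stress \<alpha> \<beta> \<delta> (\<rho> t x) (Du t x) $ i $ j\<bar> \<le>
          (2 * \<bar>\<alpha>\<bar> + 3 * \<bar>\<beta>\<bar>) * (\<rho> t x powr \<delta> * norm (Du t x))" by (rule viscous_stress_bound)
      also have "\<dots> \<le> (2 * \<bar>\<alpha>\<bar> + 3 * \<bar>\<beta>\<bar>) *
          (((K powr p) powr \<delta> * ?c + 1) * ((f t x)\<^sup>2 + (norm (w t x))\<^sup>2))"
        using elim by (intro mult_left_mono) auto
      finally show ?case by (simp add: mult.assoc)
    qed
    have "(\<lambda>x. viscous_stress \<alpha> \<beta> \<delta> (\<rho> t x) (Du t x) $ i $ j) \<in> borel_measurable lebesgue"
      unfolding viscous_stress_nth
      by (intro borel_measurable_times borel_measurable_add borel_measurable_sum powr_real_measurable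
          borel_measurable_const \<rho>m[OF t] Dum[OF t])
    note b = integrable_by_squares[OF this f_facts(1)[OF t] w_facts(1)[OF t] ae]
    show "integrable lebesgue (\<lambda>x. viscous_stress \<alpha> \<beta> \<delta> (\<rho> t x) (Du t x) $ i $ j)" by (rule b(1))
    show "(LINT x|lebesgue. \<bar>viscous_stress \<alpha> \<beta> \<delta> (\<rho> t x) (Du t x) $ i $ j\<bar>) \<le> ?C * (Mf + Mw)"
      by (rule order_trans[OF b(2)]) (intro mult_left_mono add_mono M t; simp)
  qed

  let ?L = "p * ?c"
  have diff: "AE x in lebesgue. \<bar>\<rho> t x - \<rho> s x\<bar> \<le> ?L * ((f t x + f s x) * \<bar>f t x - f s x\<bar>)"
    if t: "t \<in> {0..T}" and s: "s \<in> {0..T}" for t s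
    using bounds[OF t] bounds[OF s]
  proof eventually_elim
    case (elim x)
    then show ?case using powr_diff_le[of "f t x" K "f s x" p] p2 by simp
  qed
  have cont1: "continuous_on {0..T} (\<lambda>t. LINT x|lebesgue. \<rho> t x)"
    unfolding continuous_on_def
  proof
    fix s assume s: "s \<in> {0..T}"
    show "((\<lambda>t. LINT x|lebesgue. \<rho> t x) \<longlongrightarrow> (LINT x|lebesgue. \<rho> s x)) (at s within {0..T})"
    \<comment> \<open>Distributing \<open>(f t + f s) * \<bar>f t - f s\<bar>\<close> gives two
      products with the same vanishing factor, one bounded factor moving with \<open>t\<close> and
      one frozen at \<open>s\<close>.\<close>
    proof (rule integral_tendsto_by_products[where ?g1.0 = f and ?g2.0 = "\<lambda>_. f s" and c = ?L
          and ?d1.0 = "\<lambda>t x. f t x - f s x" and ?d2.0 = "\<lambda>t x. f t x - f s x" and M = Mf])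
      show "sq_integrable (\<lambda>x. f t x - f s x)" if "t \<in> {0..T}" for t
        using sq_integrable_diff[OF f_facts(1)[OF that] f_facts(1)[OF s]] .
      then show "sq_integrable (\<lambda>x. f t x - f s x)" if "t \<in> {0..T}" for t using that by simp
      show "AE x in lebesgue. \<bar>\<rho> t x - \<rho> s x\<bar> \<le>
          ?L * (norm (f t x) * norm (f t x - f s x) + norm (f s x) * norm (f t x - f s x))"
        if t: "t \<in> {0..T}" for t
        using diff[OF t s] bounds[OF t] bounds[OF s]
        by eventually_elim (simp add: distrib_right)
    qed (use s I1(1) f_facts M p2 in auto)
  qed
  have cont2: "continuous_on {0..T} (\<lambda>t. LINT x|lebesgue. \<rho> t x * u t x $ i)" for i
    unfolding continuous_on_def
  proof
    fix s assume s: "s \<in> {0..T}"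
    \<comment> \<open>The difference of momenta splits into
      \<open>(\<rho> t - \<rho> s) * u t\<close> and \<open>\<rho> s * (u t - u s)\<close>. The
      first has constant \<open>?L * (2 * K)\<close>, as \<open>f t + f s\<close> is at most
      \<open>2 * K\<close>; the second has \<open>?c * K\<close>, as \<open>\<rho> s\<close> is at
      most this multiple of \<open>f s\<close>. Their sum serves both.\<close>
    let ?k = "?L * (2 * K) + ?c * K"
    show "((\<lambda>t. LINT x|lebesgue. \<rho> t x * u t x $ i) \<longlongrightarrow> (LINT x|lebesgue. \<rho> s x * u s x $ i)) (at s within {0..T})"
    proof (rule integral_tendsto_by_products[where ?g1.0 = u and ?g2.0 = "\<lambda>_. f s" and c = ?k
          and ?d1.0 = "\<lambda>t x. f t x - f s x" and ?d2.0 = "\<lambda>t x. u t x - u s x" and M = "Mu + Mf"])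
      show "sq_integrable (\<lambda>x. f t x - f s x)" if "t \<in> {0..T}" for t
        using sq_integrable_diff[OF f_facts(1)[OF that] f_facts(1)[OF s]] .
      show "sq_integrable (\<lambda>x. u t x - u s x)" if "t \<in> {0..T}" for t
        using sq_integrable_diff[OF u_facts(1)[OF that] u_facts(1)[OF s]] .
      show "sq_int (u t) \<le> Mu + Mf" if "t \<in> {0..T}" for t using M(4)[OF that] M(1) by linarith
      show "sq_int (f s) \<le> Mu + Mf" using M(2)[OF s] M(3) by linarith
      show "AE x in lebesgue. \<bar>\<rho> t x * u t x $ i - \<rho> s x * u s x $ i\<bar> \<le>
          ?k * (norm (u t x) * norm (f t x - f s x) + norm (f s x) * norm (u t x - u s x))"
        if t: "t \<in> {0..T}" for t
        using diff[OF t s] bounds[OF t] bounds[OF s]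
      proof eventually_elim
        case (elim x)
        let ?d = "\<bar>f t x - f s x\<bar>" and ?e = "norm (u t x - u s x)"
        have "\<bar>\<rho> t x - \<rho> s x\<bar> \<le> ?L * ((f t x + f s x) * ?d)" using elim by blast
        also have "\<dots> \<le> ?L * ((2 * K) * ?d)"
          using elim p2 by (intro mult_left_mono mult_right_mono) auto
        finally have d1: "\<bar>\<rho> t x - \<rho> s x\<bar> \<le> ?L * (2 * K) * ?d" by (simp add: mult.assoc)
        have "\<rho> s x \<le> ?c * (f s x * f s x)" using elim by (simp add: power2_eq_square)
        also have "\<dots> \<le> ?c * (K * f s x)" using elim by (intro mult_left_mono mult_right_mono) auto
        finally have d2: "\<rho> s x \<le> ?c * K * f s x" by (simp add: mult.assoc)
        have "\<bar>\<rho> t x * u t x $ i - \<rho> s x * u s x $ i\<bar> =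
            \<bar>(\<rho> t x - \<rho> s x) * u t x $ i + \<rho> s x * (u t x - u s x) $ i\<bar>"
          by (simp add: algebra_simps)
        also have "\<dots> \<le> \<bar>(\<rho> t x - \<rho> s x) * u t x $ i\<bar> + \<bar>\<rho> s x * (u t x - u s x) $ i\<bar>"
          by (rule abs_triangle_ineq)
        also have "\<dots> \<le> ?L * (2 * K) * ?d * norm (u t x) + ?c * K * f s x * ?e"
          unfolding abs_mult using d1 d2 pos[OF s, of x] elim K(1) p2
          by (intro add_mono mult_mono component_le_norm_cart) auto
        also have "\<dots> \<le> ?k * (norm (u t x) * ?d) + ?k * (f s x * ?e)"
        proof -
          have "?L * (2 * K) * (norm (u t x) * ?d) \<le> ?k * (norm (u t x) * ?d)"
            using K(1) by (intro mult_right_mono) auto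
          moreover have "?c * K * (f s x * ?e) \<le> ?k * (f s x * ?e)"
            using K(1) p2 elim by (intro mult_right_mono) auto
          ultimately show ?thesis by (simp add: mult_ac)
        qed
        finally show ?case using elim by (simp add: distrib_left)
      qed
    qed (use s I2(1) f_facts u_facts p2 K(1) in auto)
  qed

  have li1: "locally_integrable (slab T) (\<lambda>(t, x). \<rho> t x)"
    and li2v: "locally_integrable (slab T) (\<lambda>(t, x). \<rho> t x *\<^sub>R u t x)"
    and mass_eq: "\<And>\<phi>. \<phi> \<in> test_functions (slab T) \<Longrightarrow> dist_deriv time_dir (\<lambda>(t, x). \<rho> t x) \<phi> +
        (\<Sum>j\<in>UNIV. dist_deriv (space_dir j) (\<lambda>(t, x). \<rho> t x * u t x $ j) \<phi>) = 0"
    using mass unfolding mass_equation_def by blast+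
  have li3: "\<And>i j. locally_integrable (slab T) (\<lambda>(t, x). \<rho> t x * u t x $ i * u t x $ j)"
    and li4: "locally_integrable (slab T) (\<lambda>(t, x). A * \<rho> t x powr \<gamma>)"
    and li5m: "locally_integrable (slab T) (\<lambda>(t, x). viscous_stress \<alpha> \<beta> \<delta> (\<rho> t x) (Du t x))"
    and mom_eq: "\<And>\<phi> i. \<phi> \<in> test_functions (slab T) \<Longrightarrow>
        dist_deriv time_dir (\<lambda>(t, x). \<rho> t x * u t x $ i) \<phi> +
        (\<Sum>j\<in>UNIV. dist_deriv (space_dir j) (\<lambda>(t, x). \<rho> t x * u t x $ i * u t x $ j) \<phi>) +
        dist_deriv (space_dir i) (\<lambda>(t, x). A * \<rho> t x powr \<gamma>) \<phi> =
        (\<Sum>j\<in>UNIV. dist_deriv (space_dir j)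
           (\<lambda>(t, x). viscous_stress \<alpha> \<beta> \<delta> (\<rho> t x) (Du t x) $ i $ j) \<phi>)"
    using momentum unfolding momentum_equation_def by blast+
  have li2: "locally_integrable (slab T) (\<lambda>(t, x). \<rho> t x * u t x $ i)" for i
    using locally_integrable_component[OF li2v, of "axis i 1"] by (simp add: case_prod_unfold inner_axis)
  have li5: "locally_integrable (slab T) (\<lambda>(t, x). viscous_stress \<alpha> \<beta> \<delta> (\<rho> t x) (Du t x) $ i $ j)" for i j
    using locally_integrable_component[OF li5m, of "axis i (axis j 1)"] by (simp add: case_prod_unfold inner_axis)

  have T0: "0 \<in> {0..T}" using t by auto
  show "\<rho> t x > 0" for x by (rule pos[OF t])
  show "integrable lebesgue (\<rho> t)" by (rule I1(1)[OF t])
  show "integrable lebesgue (\<lambda>x. \<rho> t x * u t x $ i)" by (rule I2(1)[OF t])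
  show "(LINT x|lebesgue. \<rho> t x) = (LINT x|lebesgue. \<rho>0 x)"
    unfolding init(1)[symmetric]
  proof (rule conserved_quantity[OF li1 I1 cont1 _ t T0])
    fix \<theta> :: "real \<Rightarrow> real" and a b :: real
    assume \<theta>: "smooth \<theta>" "\<And>t. t \<notin> {a..b} \<Longrightarrow> \<theta> t = 0" "0 < a" "b < T"
    have "dist_deriv time_dir (\<lambda>(t, x). \<rho> t x) (cutoff \<theta> n) =
        - (\<Sum>j\<in>UNIV. dist_deriv (space_dir j) (\<lambda>(t, x). \<rho> t x * u t x $ j) (cutoff \<theta> n))" for n
      using mass_eq[OF cutoff_test_function[OF \<theta>], of n] by linarith
    moreover have "(\<lambda>n. - (\<Sum>j\<in>UNIV. dist_deriv (space_dir j) (\<lambda>(t, x). \<rho> t x * u t x $ j) (cutoff \<theta> n)))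
        \<longlonglongrightarrow> - (\<Sum>j\<in>(UNIV :: 3 set). 0)"
      by (intro tendsto_minus tendsto_sum flux_vanishes[OF li2 I2 \<theta>])
    ultimately show "(\<lambda>n. dist_deriv time_dir (\<lambda>(t, x). \<rho> t x) (cutoff \<theta> n)) \<longlonglongrightarrow> 0" by simp
  qed
  show "(LINT x|lebesgue. \<rho> t x * u t x $ i) = (LINT x|lebesgue. \<rho>0 x * u0 x $ i)"
    unfolding init[symmetric]
  proof (rule conserved_quantity[OF li2 I2 cont2 _ t T0])
    fix \<theta> :: "real \<Rightarrow> real" and a b :: real
    assume \<theta>: "smooth \<theta>" "\<And>t. t \<notin> {a..b} \<Longrightarrow> \<theta> t = 0" "0 < a" "b < T"
    have "dist_deriv time_dir (\<lambda>(t, x). \<rho> t x * u t x $ i) (cutoff \<theta> n) =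
        (\<Sum>j\<in>UNIV. dist_deriv (space_dir j)
           (\<lambda>(t, x). viscous_stress \<alpha> \<beta> \<delta> (\<rho> t x) (Du t x) $ i $ j) (cutoff \<theta> n)) -
        (\<Sum>j\<in>UNIV. dist_deriv (space_dir j) (\<lambda>(t, x). \<rho> t x * u t x $ i * u t x $ j) (cutoff \<theta> n)) -
        dist_deriv (space_dir i) (\<lambda>(t, x). A * \<rho> t x powr \<gamma>) (cutoff \<theta> n)" for n
      using mom_eq[OF cutoff_test_function[OF \<theta>], of i n] by linarith
    moreover have "(\<lambda>n. (\<Sum>j\<in>UNIV. dist_deriv (space_dir j)
           (\<lambda>(t, x). viscous_stress \<alpha> \<beta> \<delta> (\<rho> t x) (Du t x) $ i $ j) (cutoff \<theta> n)) -
        (\<Sum>j\<in>UNIV. dist_deriv (space_dir j) (\<lambda>(t, x). \<rho> t x * u t x $ i * u t x $ j) (cutoff \<theta> n)) -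
        dist_deriv (space_dir i) (\<lambda>(t, x). A * \<rho> t x powr \<gamma>) (cutoff \<theta> n))
        \<longlonglongrightarrow> (\<Sum>j\<in>(UNIV :: 3 set). 0) - (\<Sum>j\<in>(UNIV :: 3 set). 0) - 0"
      by (intro tendsto_diff tendsto_sum flux_vanishes[OF li5 I5 \<theta>] flux_vanishes[OF li3 I3 \<theta>]
          flux_vanishes[OF li4 I4 \<theta>])
    ultimately show "(\<lambda>n. dist_deriv time_dir (\<lambda>(t, x). \<rho> t x * u t x $ i) (cutoff \<theta> n)) \<longlonglongrightarrow> 0" by simp
  qed
qed

section \<open>The contradiction between conserved momentum and decay\<close>

lemma Linfty_norm_less_AE:
  assumes "Linfty_norm v < ennreal c"
  shows "AE x in lebesgue. norm (v x) \<le> c"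
proof -
  have "esssup lebesgue (\<lambda>x. ennreal (norm (v x))) < ennreal c"
    using assms by (simp add: Linfty_norm_def split: if_splits)
  moreover have "AE x in lebesgue. ennreal (norm (v x)) \<le> esssup lebesgue (\<lambda>x. ennreal (norm (v x)))"
    by (rule esssup_AE)
  ultimately have "AE x in lebesgue. ennreal (norm (v x)) < ennreal c"
    by (auto elim!: eventually_mono intro: order_le_less_trans)
  then show ?thesis
    by eventually_elim (simp add: ennreal_less_iff)
qed

theorem corollary1p1:
  fixes A \<alpha> \<beta> \<gamma> \<delta> :: real
    and \<rho>0 :: "real^3 \<Rightarrow> real" and u0 :: "real^3 \<Rightarrow> real^3"
  assumes "A > 0" and "\<alpha> > 0" and "2 * \<alpha> + 3 * \<beta> \<ge> 0"
    and "1 < \<gamma>" and "\<gamma> \<le> 3 / 2" and "\<delta> \<in> {\<gamma> - 1..<1}"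
    and "\<forall>x. \<rho>0 x \<ge> 0"
    and "total_mass \<rho>0 > 0" and "norm (total_momentum \<rho>0 u0) > 0"
  shows "\<not> (\<exists>\<rho> u. global_regular_solution A \<alpha> \<beta> \<gamma> \<delta> \<rho>0 u0 \<rho> u \<and>
                 Limsup at_top (\<lambda>t. Linfty_norm (u t)) = 0)"
proof
  assume "\<exists>\<rho> u. global_regular_solution A \<alpha> \<beta> \<gamma> \<delta> \<rho>0 u0 \<rho> u \<and>
                 Limsup at_top (\<lambda>t. Linfty_norm (u t)) = 0"
  then obtain \<rho> u where glob: "\<And>T. T > 0 \<Longrightarrow> regular_solution A \<alpha> \<beta> \<gamma> \<delta> \<rho>0 u0 T \<rho> u"
    and decay: "Limsup at_top (\<lambda>t. Linfty_norm (u t)) = 0"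
    unfolding global_regular_solution_def by blast
  have \<delta>0: "0 \<le> \<delta>" using assms(4,6) by simp
  let ?P = "total_momentum \<rho>0 u0"
  have "?P \<noteq> 0" using assms(9) by simp
  then obtain i where Pi: "?P $ i \<noteq> 0" by (metis vec_eq_iff zero_index)
  \<comment> \<open>The integral of a nonintegrable function is 0 by default, so the nonzero
    momentum itself provides integrability.\<close>
  have "integrable lebesgue (\<lambda>x. \<rho>0 x *\<^sub>R u0 x)"
    using \<open>?P \<noteq> 0\<close> not_integrable_integral_eq unfolding total_momentum_def by blast
  then have P_eq: "?P $ i = (LINT x|lebesgue. \<rho>0 x * u0 x $ i)"
    using integral_inner_left[of "axis i 1" lebesgue "\<lambda>x. \<rho>0 x *\<^sub>R u0 x"]
    by (simp add: total_momentum_def inner_axis)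
  define m where "m = (LINT x|lebesgue. \<rho>0 x)"
  have m0: "m \<ge> 0" unfolding m_def using assms(7) by simp
  \<comment> \<open>Chosen so that \<open>\<eta> * m\<close> is strictly below the conserved
    component; \<open>m + 1\<close> keeps the denominator positive without knowing
    \<open>m > 0\<close>.\<close>
  define \<eta> where "\<eta> = \<bar>?P $ i\<bar> / (2 * (m + 1))"
  have \<eta>: "\<eta> > 0" using Pi m0 by (simp add: \<eta>_def)
  have "\<forall>\<^sub>F t in at_top. Linfty_norm (u t) < ennreal \<eta>"
    by (rule Limsup_lessD) (use decay \<eta> in simp)
  then obtain N where N: "\<And>t. t \<ge> N \<Longrightarrow> Linfty_norm (u t) < ennreal \<eta>"
    unfolding eventually_at_top_linorder by blast
  \<comment> \<open>The maximum with 1 makes \<open>t\<close> positive, so that it can be the length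
    of the time interval on which conservation is applied.\<close>
  define t where "t = max N 1"
  have t: "t \<in> {0..t}" "t > 0" "t \<ge> N" by (auto simp: t_def)
  note cons = regular_solution_conservation[OF glob[OF t(2)] assms(4,5) \<delta>0 t(1)]
  have small: "AE x in lebesgue. norm (u t x) \<le> \<eta>" by (rule Linfty_norm_less_AE[OF N[OF t(3)]])
  have "\<bar>?P $ i\<bar> = \<bar>LINT x|lebesgue. \<rho> t x * u t x $ i\<bar>" by (simp add: P_eq cons(5))
  also have "\<dots> \<le> (LINT x|lebesgue. \<bar>\<rho> t x * u t x $ i\<bar>)" by (rule integral_abs_bound)
  also have "\<dots> \<le> (LINT x|lebesgue. \<eta> * \<rho> t x)"
  proof (rule integral_mono_AE)
    show "AE x in lebesgue. \<bar>\<rho> t x * u t x $ i\<bar> \<le> \<eta> * \<rho> t x"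
      using small
    proof eventually_elim
      case (elim x)
      have "\<bar>\<rho> t x * u t x $ i\<bar> = \<bar>u t x $ i\<bar> * \<rho> t x"
        using cons(1)[of x] by (simp add: abs_mult mult.commute)
      also have "\<dots> \<le> \<eta> * \<rho> t x"
        using order_trans[OF component_le_norm_cart elim] cons(1)[of x] by (intro mult_right_mono) auto
      finally show ?case .
    qed
  qed (use cons(2,3) in auto)
  also have "\<dots> = \<eta> * m" using cons(4) by (simp add: m_def)
  also have "\<dots> < \<eta> * (2 * (m + 1))" using \<eta> m0 by (intro mult_strict_left_mono) auto
  also have "\<dots> = \<bar>?P $ i\<bar>" using m0 by (simp add: \<eta>_def)
  finally show False by simp
qed

end
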